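(* Let $(\mathcal{U},I,\otimes,\mathrm{Tr})$ be a uniform traced category. There is a thin symmetric monoidal double category $(\mathbb{I}\mathsf{nt}(\mathcal{U}),(I,I),(\otimes,\otimes))$, for which the category of tight maps is $\mathcal{U}\times\mathcal{U}$, for which the loose maps (with their composition) are given by the $\mathsf{Int}$ construction, and for which a cell exists iff the obvious diagram commutes. Explicitly: (i) an object is a pair $(A^-,A^+)$ of objects of $\mathcal{U}$; (ii) the monoidal unit is $(I,I)$ and the monoidal product is $(A^-,A^+)\otimes(B^-,B^+):=(A^-\otimes B^-,A^+\otimes B^+)$; (iii) a tight map $(A_1^-,A_1^+)\to(A_2^-,A_2^+)$ is a pair of maps $s^-\colon A_1^-\to A_2^-$ and $s^+\colon A_1^+\to A_2^+$ in $\mathcal{U}$; (iv) a loose map from $(A^-,A^+)$ to $(B^-,B^+)$ is a map $f\colon B^-\otimes A^+\to B^+\otimes A^-$ in $\mathcal{U}$; (v) there is a (unique) cell with loose source $f_1\colon(A_1^-,A_1^+)\to(B_1^-,B_1^+)$, loose target $f_2\colon(A_2^-,A_2^+)\to(B_2^-,B_2^+)$, and left and right tight maps $(s^-,s^+)\colon(A_1^-,A_1^+)\to(A_2^-,A_2^+)$ and $(t^-,t^+)\colon(B_1^-,B_1^+)\to(B_2^-,B_2^+)$ if and only if $(t^+\otimes s^-)\circ f_1=f_2\circ(t^-\otimes s^+)$ as maps $B_1^-\otimes A_1^+\to B_2^+\otimes A_2^-$.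
   Context: A traced category is a symmetric monoidal category $(\mathcal{T},I,\otimes)$ (associators and unitors suppressed, braiding $\sigma$) with functions $\mathrm{Tr}^U_{A,B}\colon\mathcal{T}(A\otimes U,B\otimes U)\to\mathcal{T}(A,B)$ for all objects $A,B,U$ such that: (naturality) $\mathrm{Tr}^U_{A',B'}((g\otimes U)\circ k\circ(f\otimes U))=g\circ\mathrm{Tr}^U_{A,B}(k)\circ f$ for $f\colon A'\to A$, $g\colon B\to B'$, $k\colon A\otimes U\to B\otimes U$; (dinaturality) $\mathrm{Tr}^V_{A,B}((B\otimes h)\circ k)=\mathrm{Tr}^U_{A,B}(k\circ(A\otimes h))$ for $h\colon U\to V$, $k\colon A\otimes V\to B\otimes U$; (monoidality) $\mathrm{Tr}^I_{A,B}$ is the canonical identification and $\mathrm{Tr}^{U\otimes V}_{A,B}=\mathrm{Tr}^U_{A,B}\circ\mathrm{Tr}^V_{A\otimes U,B\otimes U}$; (superposing) $\mathrm{Tr}^U_{A'\otimes A,B'\otimes B}(h\otimes k)=h\otimes\mathrm{Tr}^U_{A,B}(k)$ for $h\colon A'\to B'$; (yanking) $\mathrm{Tr}^U_{U,U}(\sigma_{U,U})=\mathrm{id}_U$. A morphism $s\colon U\to V$ is strict if for all $A,B$, $f\colon A\otimes U\to B\otimes U$, $g\colon A\otimes V\to B\otimes V$ with $(B\otimes s)\circ f=g\circ(A\otimes s)$ one has $\mathrm{Tr}^U_{A,B}(f)=\mathrm{Tr}^V_{A,B}(g)$. A traced category is uniform if every morphism is strict. The $\mathsf{Int}$ construction (Joyal–Street–Verity):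 for a traced category $\mathcal{T}$, the compact closed category $\mathsf{Int}(\mathcal{T})$ has as objects pairs $(A^-,A^+)$ of objects of $\mathcal{T}$, hom-sets $\mathsf{Int}(\mathcal{T})((A^-,A^+),(B^-,B^+))=\mathcal{T}(B^-\otimes A^+,B^+\otimes A^-)$, identities given by the braidings $A^-\otimes A^+\to A^+\otimes A^-$, unit $(I,I)$, product $(A^-\otimes B^-,A^+\otimes B^+)$ on objects and the tensor product in $\mathcal{T}$ (conjugated by the evident symmetries) on morphisms, and duals $(A^-,A^+)^*=(A^+,A^-)$. The composite of $f\colon(A^-,A^+)\to(B^-,B^+)$ and $g\colon(B^-,B^+)\to(C^-,C^+)$ is $$\mathrm{Tr}^{B^-}_{C^-\otimes A^+,\,C^+\otimes A^-}\big(C^-\otimes B^-\otimes A^+\xrightarrow{C^-\otimes f}C^-\otimes B^+\otimes A^-\xrightarrow{g\otimes A^-}C^+\otimes B^-\otimes A^-\big),$$ where the middle factor $B^-$ is traced out after inserting the evident braidings. In a double category, "tight" maps are one kind of 1-morphism and "loose" maps the other; cells are squares with two loose and two tight sides. A double category is thin if there is at most one cell with any given boundary. *)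

theory Defs
  imports Main
begin

text \<open>
  Categories have an explicit carrier of objects and of arrows; all operations are total functions
  whose values outside the carriers are irrelevant. \<open>g \<cdot> f\<close> is composition in the usual
  (applicative) order.
\<close>

record ('o, 'm) category =
  Obj :: "'o set"
  Arr :: "'m set"
  Dom :: "'m \<Rightarrow> 'o"
  Cod :: "'m \<Rightarrow> 'o"
  Ident :: "'o \<Rightarrow> 'm" (\<open>\<one>\<index>\<close>)
  Comp :: "'m \<Rightarrow> 'm \<Rightarrow> 'm" (infixr \<open>\<cdot>\<index>\<close> 55)

definition Hom :: "('o, 'm, 'z) category_scheme \<Rightarrow> 'o \<Rightarrow> 'o \<Rightarrow> 'm set" where
  "Hom C A B = {f \<in> Arr C. Dom C f = A \<and> Cod C f = B}"

locale category =
  fixes C :: "('o, 'm, 'z) category_scheme" (structure)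
  assumes Dom_Obj: "f \<in> Arr C \<Longrightarrow> Dom C f \<in> Obj C"
    and Cod_Obj: "f \<in> Arr C \<Longrightarrow> Cod C f \<in> Obj C"
    and Ident_Hom: "A \<in> Obj C \<Longrightarrow> \<one> A \<in> Hom C A A"
    and Comp_Hom: "f \<in> Hom C A B \<Longrightarrow> g \<in> Hom C B D \<Longrightarrow> g \<cdot> f \<in> Hom C A D"
    and Comp_Ident: "f \<in> Hom C A B \<Longrightarrow> f \<cdot> \<one> A = f"
    and Ident_Comp: "f \<in> Hom C A B \<Longrightarrow> \<one> B \<cdot> f = f"
    and Comp_assoc: "f \<in> Hom C A B \<Longrightarrow> g \<in> Hom C B D \<Longrightarrow> h \<in> Hom C D E \<Longrightarrow>
      (h \<cdot> g) \<cdot> f = h \<cdot> (g \<cdot> f)"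

definition is_inverse :: "('o, 'm, 'z) category_scheme \<Rightarrow> 'm \<Rightarrow> 'm \<Rightarrow> bool" where
  "is_inverse C f g \<longleftrightarrow> g \<in> Hom C (Cod C f) (Dom C f) \<and>
     g \<cdot>\<^bsub>C\<^esub> f = \<one>\<^bsub>C\<^esub> (Dom C f) \<and> f \<cdot>\<^bsub>C\<^esub> g = \<one>\<^bsub>C\<^esub> (Cod C f)"

definition iso :: "('o, 'm, 'z) category_scheme \<Rightarrow> 'm \<Rightarrow> bool" where
  "iso C f \<longleftrightarrow> f \<in> Arr C \<and> (\<exists>g. is_inverse C f g)"

definition Inverse :: "('o, 'm, 'z) category_scheme \<Rightarrow> 'm \<Rightarrow> 'm" where
  "Inverse C f = (THE g. is_inverse C f g)"

definition is_functor ::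
  "('o, 'm, 'z) category_scheme \<Rightarrow> ('p, 'n, 'y) category_scheme \<Rightarrow>
   ('o \<Rightarrow> 'p) \<Rightarrow> ('m \<Rightarrow> 'n) \<Rightarrow> bool" where
  "is_functor C D Fo Fa \<longleftrightarrow>
     (\<forall>A \<in> Obj C. Fo A \<in> Obj D \<and> Fa (\<one>\<^bsub>C\<^esub> A) = \<one>\<^bsub>D\<^esub> (Fo A)) \<and>
     (\<forall>f \<in> Arr C. Fa f \<in> Hom D (Fo (Dom C f)) (Fo (Cod C f))) \<and>
     (\<forall>f \<in> Arr C. \<forall>g \<in> Arr C. Cod C f = Dom C g \<longrightarrow>
        Fa (g \<cdot>\<^bsub>C\<^esub> f) = Fa g \<cdot>\<^bsub>D\<^esub> Fa f)"


text \<open>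
  Monoidal categories are not assumed strict: \<open>Assoc A B C : (A \<boxtimes> B) \<boxtimes> C \<rightarrow> A \<boxtimes> (B \<boxtimes> C)\<close>,
  \<open>Lunit A : I \<boxtimes> A \<rightarrow> A\<close>, \<open>Runit A : A \<boxtimes> I \<rightarrow> A\<close>, \<open>Braid A B : A \<boxtimes> B \<rightarrow> B \<boxtimes> A\<close>. The tensor product
  is written \<open>\<boxtimes>\<close> on objects and \<open>\<otimes>\<close> on arrows.
\<close>

record ('o, 'm) smc = "('o, 'm) category" +
  MUnit :: "'o"
  TensorO :: "'o \<Rightarrow> 'o \<Rightarrow> 'o" (infixr \<open>\<boxtimes>\<index>\<close> 70)
  TensorA :: "'m \<Rightarrow> 'm \<Rightarrow> 'm" (infixr \<open>\<otimes>\<index>\<close> 70)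
  Assoc :: "'o \<Rightarrow> 'o \<Rightarrow> 'o \<Rightarrow> 'm"
  Lunit :: "'o \<Rightarrow> 'm"
  Runit :: "'o \<Rightarrow> 'm"
  Braid :: "'o \<Rightarrow> 'o \<Rightarrow> 'm"

locale symmetric_monoidal_category = category C
  for C :: "('o, 'm, 'z) smc_scheme" (structure) +
  assumes MUnit_Obj: "MUnit C \<in> Obj C"
    and TensorO_Obj: "A \<in> Obj C \<Longrightarrow> B \<in> Obj C \<Longrightarrow> A \<boxtimes> B \<in> Obj C"
    and TensorA_Hom: "f \<in> Hom C A B \<Longrightarrow> g \<in> Hom C A' B' \<Longrightarrow> f \<otimes> g \<in> Hom C (A \<boxtimes> A') (B \<boxtimes> B')"
    and TensorA_Ident: "A \<in> Obj C \<Longrightarrow> B \<in> Obj C \<Longrightarrow> \<one> A \<otimes> \<one> B = \<one> (A \<boxtimes> B)"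
    and TensorA_Comp: "f \<in> Hom C A B \<Longrightarrow> g \<in> Hom C B D \<Longrightarrow>
      f' \<in> Hom C A' B' \<Longrightarrow> g' \<in> Hom C B' D' \<Longrightarrow>
      (g \<cdot> f) \<otimes> (g' \<cdot> f') = (g \<otimes> g') \<cdot> (f \<otimes> f')"
    and Assoc_Hom: "A \<in> Obj C \<Longrightarrow> B \<in> Obj C \<Longrightarrow> D \<in> Obj C \<Longrightarrow>
      Assoc C A B D \<in> Hom C ((A \<boxtimes> B) \<boxtimes> D) (A \<boxtimes> (B \<boxtimes> D))"
    and Assoc_iso: "A \<in> Obj C \<Longrightarrow> B \<in> Obj C \<Longrightarrow> D \<in> Obj C \<Longrightarrow> iso C (Assoc C A B D)"
    and Assoc_natural: "f \<in> Hom C A A' \<Longrightarrow> g \<in> Hom C B B' \<Longrightarrow> h \<in> Hom C D D' \<Longrightarrow>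
      Assoc C A' B' D' \<cdot> ((f \<otimes> g) \<otimes> h) = (f \<otimes> (g \<otimes> h)) \<cdot> Assoc C A B D"
    and Lunit_Hom: "A \<in> Obj C \<Longrightarrow> Lunit C A \<in> Hom C (MUnit C \<boxtimes> A) A"
    and Lunit_iso: "A \<in> Obj C \<Longrightarrow> iso C (Lunit C A)"
    and Lunit_natural: "f \<in> Hom C A B \<Longrightarrow>
      Lunit C B \<cdot> (\<one> (MUnit C) \<otimes> f) = f \<cdot> Lunit C A"
    and Runit_Hom: "A \<in> Obj C \<Longrightarrow> Runit C A \<in> Hom C (A \<boxtimes> MUnit C) A"
    and Runit_iso: "A \<in> Obj C \<Longrightarrow> iso C (Runit C A)"
    and Runit_natural: "f \<in> Hom C A B \<Longrightarrow>
      Runit C B \<cdot> (f \<otimes> \<one> (MUnit C)) = f \<cdot> Runit C A"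
    and pentagon: "A \<in> Obj C \<Longrightarrow> B \<in> Obj C \<Longrightarrow> D \<in> Obj C \<Longrightarrow> E \<in> Obj C \<Longrightarrow>
      Assoc C A B (D \<boxtimes> E) \<cdot> Assoc C (A \<boxtimes> B) D E =
      (\<one> A \<otimes> Assoc C B D E) \<cdot> Assoc C A (B \<boxtimes> D) E \<cdot> (Assoc C A B D \<otimes> \<one> E)"
    and triangle: "A \<in> Obj C \<Longrightarrow> B \<in> Obj C \<Longrightarrow>
      (\<one> A \<otimes> Lunit C B) \<cdot> Assoc C A (MUnit C) B = Runit C A \<otimes> \<one> B"
    and Braid_Hom: "A \<in> Obj C \<Longrightarrow> B \<in> Obj C \<Longrightarrow> Braid C A B \<in> Hom C (A \<boxtimes> B) (B \<boxtimes> A)"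
    and Braid_natural: "f \<in> Hom C A A' \<Longrightarrow> g \<in> Hom C B B' \<Longrightarrow>
      Braid C A' B' \<cdot> (f \<otimes> g) = (g \<otimes> f) \<cdot> Braid C A B"
    and Braid_symmetric: "A \<in> Obj C \<Longrightarrow> B \<in> Obj C \<Longrightarrow>
      Braid C B A \<cdot> Braid C A B = \<one> (A \<boxtimes> B)"
    and hexagon: "A \<in> Obj C \<Longrightarrow> B \<in> Obj C \<Longrightarrow> D \<in> Obj C \<Longrightarrow>
      Assoc C B D A \<cdot> Braid C A (B \<boxtimes> D) \<cdot> Assoc C A B D =
      (\<one> B \<otimes> Braid C A D) \<cdot> Assoc C B A D \<cdot> (Braid C A B \<otimes> \<one> D)"

definition strict_sm_functor ::
  "('o, 'm, 'z) smc_scheme \<Rightarrow> ('p, 'n, 'y) smc_scheme \<Rightarrow>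
   ('o \<Rightarrow> 'p) \<Rightarrow> ('m \<Rightarrow> 'n) \<Rightarrow> bool" where
  "strict_sm_functor C D Fo Fa \<longleftrightarrow> is_functor C D Fo Fa \<and>
     Fo (MUnit C) = MUnit D \<and>
     (\<forall>A \<in> Obj C. \<forall>B \<in> Obj C. Fo (A \<boxtimes>\<^bsub>C\<^esub> B) = Fo A \<boxtimes>\<^bsub>D\<^esub> Fo B) \<and>
     (\<forall>f \<in> Arr C. \<forall>g \<in> Arr C. Fa (f \<otimes>\<^bsub>C\<^esub> g) = Fa f \<otimes>\<^bsub>D\<^esub> Fa g) \<and>
     (\<forall>A \<in> Obj C. \<forall>B \<in> Obj C. \<forall>E \<in> Obj C.
        Fa (Assoc C A B E) = Assoc D (Fo A) (Fo B) (Fo E)) \<and>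
     (\<forall>A \<in> Obj C. Fa (Lunit C A) = Lunit D (Fo A)) \<and>
     (\<forall>A \<in> Obj C. Fa (Runit C A) = Runit D (Fo A)) \<and>
     (\<forall>A \<in> Obj C. \<forall>B \<in> Obj C. Fa (Braid C A B) = Braid D (Fo A) (Fo B))"

definition prod_smc ::
  "('o, 'm, 'z) smc_scheme \<Rightarrow> ('p, 'n, 'y) smc_scheme \<Rightarrow> ('o \<times> 'p, 'm \<times> 'n) smc" where
  "prod_smc C D = \<lparr>
     Obj = Obj C \<times> Obj D,
     Arr = Arr C \<times> Arr D,
     Dom = map_prod (Dom C) (Dom D),
     Cod = map_prod (Cod C) (Cod D),
     Ident = map_prod (Ident C) (Ident D),
     Comp = (\<lambda>(g, g') (f, f'). (g \<cdot>\<^bsub>C\<^esub> f, g' \<cdot>\<^bsub>D\<^esub> f')),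
     MUnit = (MUnit C, MUnit D),
     TensorO = (\<lambda>(A, A') (B, B'). (A \<boxtimes>\<^bsub>C\<^esub> B, A' \<boxtimes>\<^bsub>D\<^esub> B')),
     TensorA = (\<lambda>(f, f') (g, g'). (f \<otimes>\<^bsub>C\<^esub> g, f' \<otimes>\<^bsub>D\<^esub> g')),
     Assoc = (\<lambda>(A, A') (B, B') (E, E'). (Assoc C A B E, Assoc D A' B' E')),
     Lunit = map_prod (Lunit C) (Lunit D),
     Runit = map_prod (Runit C) (Runit D),
     Braid = (\<lambda>(A, A') (B, B'). (Braid C A B, Braid D A' B'))\<rparr>"


text \<open>
  \<open>Trace T U A B k\<close> is \<open>Tr\<^sup>U\<^bsub>A,B\<^esub>(k)\<close>, for \<open>k : A \<boxtimes> U \<rightarrow> B \<boxtimes> U\<close>.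
\<close>

record ('o, 'm) traced_category = "('o, 'm) smc" +
  Trace :: "'o \<Rightarrow> 'o \<Rightarrow> 'o \<Rightarrow> 'm \<Rightarrow> 'm"

locale traced_category = symmetric_monoidal_category T
  for T :: "('o, 'm, 'z) traced_category_scheme" (structure) +
  assumes Trace_Hom: "A \<in> Obj T \<Longrightarrow> B \<in> Obj T \<Longrightarrow> U \<in> Obj T \<Longrightarrow>
      k \<in> Hom T (A \<boxtimes> U) (B \<boxtimes> U) \<Longrightarrow> Trace T U A B k \<in> Hom T A B"
    and naturality: "A \<in> Obj T \<Longrightarrow> B \<in> Obj T \<Longrightarrow> A' \<in> Obj T \<Longrightarrow> B' \<in> Obj T \<Longrightarrow> U \<in> Obj T \<Longrightarrow>
      f \<in> Hom T A' A \<Longrightarrow> g \<in> Hom T B B' \<Longrightarrow> k \<in> Hom T (A \<boxtimes> U) (B \<boxtimes> U) \<Longrightarrow>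
      Trace T U A' B' ((g \<otimes> \<one> U) \<cdot> k \<cdot> (f \<otimes> \<one> U)) = g \<cdot> Trace T U A B k \<cdot> f"
    and dinaturality: "A \<in> Obj T \<Longrightarrow> B \<in> Obj T \<Longrightarrow> U \<in> Obj T \<Longrightarrow> V \<in> Obj T \<Longrightarrow>
      h \<in> Hom T U V \<Longrightarrow> k \<in> Hom T (A \<boxtimes> V) (B \<boxtimes> U) \<Longrightarrow>
      Trace T V A B ((\<one> B \<otimes> h) \<cdot> k) = Trace T U A B (k \<cdot> (\<one> A \<otimes> h))"
    and monoidality_unit: "A \<in> Obj T \<Longrightarrow> B \<in> Obj T \<Longrightarrow>
      k \<in> Hom T (A \<boxtimes> MUnit T) (B \<boxtimes> MUnit T) \<Longrightarrow>
      Trace T (MUnit T) A B k = Runit T B \<cdot> k \<cdot> Inverse T (Runit T A)"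
    and monoidality_tensor: "A \<in> Obj T \<Longrightarrow> B \<in> Obj T \<Longrightarrow> U \<in> Obj T \<Longrightarrow> V \<in> Obj T \<Longrightarrow>
      k \<in> Hom T (A \<boxtimes> (U \<boxtimes> V)) (B \<boxtimes> (U \<boxtimes> V)) \<Longrightarrow>
      Trace T (U \<boxtimes> V) A B k =
      Trace T U A B (Trace T V (A \<boxtimes> U) (B \<boxtimes> U) (Inverse T (Assoc T B U V) \<cdot> k \<cdot> Assoc T A U V))"
    and superposing: "A \<in> Obj T \<Longrightarrow> B \<in> Obj T \<Longrightarrow> A' \<in> Obj T \<Longrightarrow> B' \<in> Obj T \<Longrightarrow> U \<in> Obj T \<Longrightarrow>
      h \<in> Hom T A' B' \<Longrightarrow> k \<in> Hom T (A \<boxtimes> U) (B \<boxtimes> U) \<Longrightarrow>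
      Trace T U (A' \<boxtimes> A) (B' \<boxtimes> B) (Inverse T (Assoc T B' B U) \<cdot> (h \<otimes> k) \<cdot> Assoc T A' A U) =
      h \<otimes> Trace T U A B k"
    and yanking: "U \<in> Obj T \<Longrightarrow> Trace T U U U (Braid T U U) = \<one> U"

definition strict_arrow :: "('o, 'm, 'z) traced_category_scheme \<Rightarrow> 'm \<Rightarrow> bool" where
  "strict_arrow T s \<longleftrightarrow> (let U = Dom T s; V = Cod T s in
     \<forall>A \<in> Obj T. \<forall>B \<in> Obj T.
     \<forall>f \<in> Hom T (A \<boxtimes>\<^bsub>T\<^esub> U) (B \<boxtimes>\<^bsub>T\<^esub> U). \<forall>g \<in> Hom T (A \<boxtimes>\<^bsub>T\<^esub> V) (B \<boxtimes>\<^bsub>T\<^esub> V).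
       (\<one>\<^bsub>T\<^esub> B \<otimes>\<^bsub>T\<^esub> s) \<cdot>\<^bsub>T\<^esub> f = g \<cdot>\<^bsub>T\<^esub> (\<one>\<^bsub>T\<^esub> A \<otimes>\<^bsub>T\<^esub> s) \<longrightarrow> Trace T U A B f = Trace T V A B g)"

locale uniform_traced_category = traced_category T
  for T :: "('o, 'm, 'z) traced_category_scheme" (structure) +
  assumes uniform: "s \<in> Arr T \<Longrightarrow> strict_arrow T s"


text \<open>
  An arrow of \<open>Int_category T\<close> is tagged with its source and target: \<open>(A, B, f) : A \<rightarrow> B\<close> with
  \<open>f : B\<^sup>- \<boxtimes> A\<^sup>+ \<rightarrow> B\<^sup>+ \<boxtimes> A\<^sup>-\<close>; objects are pairs \<open>A = (A\<^sup>-, A\<^sup>+)\<close>.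
\<close>

type_synonym ('o, 'm) int_arrow = "('o \<times> 'o) \<times> ('o \<times> 'o) \<times> 'm"

context
  fixes T :: "('o, 'm, 'z) traced_category_scheme" (structure)
begin

text \<open>The canonical symmetry \<open>(X \<boxtimes> Y) \<boxtimes> (Z \<boxtimes> W) \<rightarrow> (X \<boxtimes> Z) \<boxtimes> (Y \<boxtimes> W)\<close>.\<close>

definition interchange :: "'o \<Rightarrow> 'o \<Rightarrow> 'o \<Rightarrow> 'o \<Rightarrow> 'm" where
  "interchange X Y Z W =
     Inverse T (Assoc T X Z (Y \<boxtimes> W)) \<cdot>
     (\<one> X \<otimes> (Assoc T Z Y W \<cdot> (Braid T Y Z \<otimes> \<one> W) \<cdot> Inverse T (Assoc T Y Z W))) \<cdot>
     Assoc T X Y (Z \<boxtimes> W)"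

text \<open>
  The traced arrow is
  \<open>(C\<^sup>- \<boxtimes> A\<^sup>+) \<boxtimes> B\<^sup>- \<rightarrow> C\<^sup>- \<boxtimes> (B\<^sup>- \<boxtimes> A\<^sup>+) \<rightarrow> C\<^sup>- \<boxtimes> (B\<^sup>+ \<boxtimes> A\<^sup>-) \<rightarrow> (C\<^sup>- \<boxtimes> B\<^sup>+) \<boxtimes> A\<^sup>- \<rightarrow>
  (C\<^sup>+ \<boxtimes> B\<^sup>-) \<boxtimes> A\<^sup>- \<rightarrow> (C\<^sup>+ \<boxtimes> A\<^sup>-) \<boxtimes> B\<^sup>-\<close>.
\<close>

fun int_comp :: "('o, 'm) int_arrow \<Rightarrow> ('o, 'm) int_arrow \<Rightarrow> ('o, 'm) int_arrow" where
  "int_comp (_, (Cm, Cp), g) ((Am, Ap), (Bm, Bp), f) =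
     ((Am, Ap), (Cm, Cp),
      Trace T Bm (Cm \<boxtimes> Ap) (Cp \<boxtimes> Am)
        ((Inverse T (Assoc T Cp Am Bm) \<cdot> (\<one> Cp \<otimes> Braid T Bm Am) \<cdot> Assoc T Cp Bm Am) \<cdot>
         (g \<otimes> \<one> Am) \<cdot>
         Inverse T (Assoc T Cm Bp Am) \<cdot>
         (\<one> Cm \<otimes> f) \<cdot>
         ((\<one> Cm \<otimes> Braid T Ap Bm) \<cdot> Assoc T Cm Ap Bm)))"

fun int_ident :: "'o \<times> 'o \<Rightarrow> ('o, 'm) int_arrow" where
  "int_ident (Am, Ap) = ((Am, Ap), (Am, Ap), Braid T Am Ap)"

fun int_tensor :: "('o, 'm) int_arrow \<Rightarrow> ('o, 'm) int_arrow \<Rightarrow> ('o, 'm) int_arrow" where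
  "int_tensor ((Am, Ap), (Bm, Bp), f) ((A'm, A'p), (B'm, B'p), f') =
     ((Am \<boxtimes> A'm, Ap \<boxtimes> A'p), (Bm \<boxtimes> B'm, Bp \<boxtimes> B'p),
      interchange Bp Am B'p A'm \<cdot> (f \<otimes> f') \<cdot> interchange Bm B'm Ap A'p)"

definition Int_category :: "('o \<times> 'o, ('o, 'm) int_arrow) category" where
  "Int_category = \<lparr>
     Obj = Obj T \<times> Obj T,
     Arr = {((Am, Ap), (Bm, Bp), f) | Am Ap Bm Bp f.
              Am \<in> Obj T \<and> Ap \<in> Obj T \<and> Bm \<in> Obj T \<and> Bp \<in> Obj T \<and>
              f \<in> Hom T (Bm \<boxtimes> Ap) (Bp \<boxtimes> Am)},
     Dom = (\<lambda>(A, B, f). A),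
     Cod = (\<lambda>(A, B, f). B),
     Ident = int_ident,
     Comp = int_comp\<rparr>"

end


text \<open>
  A double category is a category internal to categories: \<open>Tight D\<close> is the category of objects and
  tight maps, and \<open>Cells D\<close> is the category whose objects are the loose maps and whose arrows are
  the cells, composed in the tight direction. Thus \<open>Dom\<close> and \<open>Cod\<close> of a cell are its loose source
  and target, while its left and right tight sides are given by the functors \<open>Left\<close> and \<open>Right\<close>,
  which on loose maps give the source and target objects. \<open>LCompO N M\<close> is the loose composite of
  \<open>M\<close> followed by \<open>N\<close>. The data include monoidal structures on \<open>Tight D\<close> and \<open>Cells D\<close>, which are
  ignored by the locale \<open>double_category\<close>.
\<close>

record ('o, 't, 'l, 'c) double_category =
  Tight :: "('o, 't) smc"
  Cells :: "('l, 'c) smc"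
  LeftO :: "'l \<Rightarrow> 'o"
  LeftA :: "'c \<Rightarrow> 't"
  RightO :: "'l \<Rightarrow> 'o"
  RightA :: "'c \<Rightarrow> 't"
  LIdentO :: "'o \<Rightarrow> 'l"
  LIdentA :: "'t \<Rightarrow> 'c"
  LCompO :: "'l \<Rightarrow> 'l \<Rightarrow> 'l"
  LCompA :: "'c \<Rightarrow> 'c \<Rightarrow> 'c"

text \<open>The pullback of \<open>Left\<close> and \<open>Right\<close>, with componentwise structure.\<close>

definition composable :: "('o, 't, 'l, 'c, 'z) double_category_scheme \<Rightarrow> ('l \<times> 'l, 'c \<times> 'c) smc" where
  "composable D = (prod_smc (Cells D) (Cells D)) \<lparr>
     Obj := {(N, M) \<in> Obj (Cells D) \<times> Obj (Cells D). LeftO D N = RightO D M},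
     Arr := {(\<beta>, \<alpha>) \<in> Arr (Cells D) \<times> Arr (Cells D). LeftA D \<beta> = RightA D \<alpha>}\<rparr>"

locale double_category =
  fixes D :: "('o, 't, 'l, 'c, 'z) double_category_scheme"
  assumes Tight_category: "category (Tight D)"
    and Cells_category: "category (Cells D)"
    and Left_functor: "is_functor (Cells D) (Tight D) (LeftO D) (LeftA D)"
    and Right_functor: "is_functor (Cells D) (Tight D) (RightO D) (RightA D)"
    and LIdent_functor: "is_functor (Tight D) (Cells D) (LIdentO D) (LIdentA D)"
    and LComp_functor: "is_functor (composable D) (Cells D)
      (\<lambda>(N, M). LCompO D N M) (\<lambda>(\<beta>, \<alpha>). LCompA D \<beta> \<alpha>)"
    and LIdentO_sides: "A \<in> Obj (Tight D) \<Longrightarrow>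
      LeftO D (LIdentO D A) = A \<and> RightO D (LIdentO D A) = A"
    and LIdentA_sides: "s \<in> Arr (Tight D) \<Longrightarrow>
      LeftA D (LIdentA D s) = s \<and> RightA D (LIdentA D s) = s"
    and LCompO_sides: "(N, M) \<in> Obj (composable D) \<Longrightarrow>
      LeftO D (LCompO D N M) = LeftO D M \<and> RightO D (LCompO D N M) = RightO D N"
    and LCompA_sides: "(\<beta>, \<alpha>) \<in> Arr (composable D) \<Longrightarrow>
      LeftA D (LCompA D \<beta> \<alpha>) = LeftA D \<alpha> \<and> RightA D (LCompA D \<beta> \<alpha>) = RightA D \<beta>"
    and LCompO_LIdentO: "M \<in> Obj (Cells D) \<Longrightarrow>
      LCompO D M (LIdentO D (LeftO D M)) = M \<and> LCompO D (LIdentO D (RightO D M)) M = M"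
    and LCompA_LIdentA: "\<alpha> \<in> Arr (Cells D) \<Longrightarrow>
      LCompA D \<alpha> (LIdentA D (LeftA D \<alpha>)) = \<alpha> \<and> LCompA D (LIdentA D (RightA D \<alpha>)) \<alpha> = \<alpha>"
    and LCompO_assoc: "(P, N) \<in> Obj (composable D) \<Longrightarrow> (N, M) \<in> Obj (composable D) \<Longrightarrow>
      LCompO D (LCompO D P N) M = LCompO D P (LCompO D N M)"
    and LCompA_assoc: "(\<gamma>, \<beta>) \<in> Arr (composable D) \<Longrightarrow> (\<beta>, \<alpha>) \<in> Arr (composable D) \<Longrightarrow>
      LCompA D (LCompA D \<gamma> \<beta>) \<alpha> = LCompA D \<gamma> (LCompA D \<beta> \<alpha>)"

text \<open>
  The associators, unitors and braidings of the monoidal product are tight maps, respectively cells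
  having these as left and right sides; they need not be identities. By contrast, the loose
  composition is strictly associative and unital, and the monoidal product preserves loose
  identities and composites strictly. This is the strict case of the definition in which both hold
  only up to coherent globular isomorphism; when every globular cell is an identity, as happens for
  cells given by commuting squares, the two definitions agree.
\<close>

locale symmetric_monoidal_double_category = double_category D
  for D :: "('o, 't, 'l, 'c, 'z) double_category_scheme" +
  assumes Tight_smc: "symmetric_monoidal_category (Tight D)"
    and Cells_smc: "symmetric_monoidal_category (Cells D)"
    and Left_sm: "strict_sm_functor (Cells D) (Tight D) (LeftO D) (LeftA D)"
    and Right_sm: "strict_sm_functor (Cells D) (Tight D) (RightO D) (RightA D)"
    and LIdent_sm: "strict_sm_functor (Tight D) (Cells D) (LIdentO D) (LIdentA D)"
    and LComp_sm: "strict_sm_functor (composable D) (Cells D)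
      (\<lambda>(N, M). LCompO D N M) (\<lambda>(\<beta>, \<alpha>). LCompA D \<beta> \<alpha>)"

definition is_cell ::
  "('o, 't, 'l, 'c, 'z) double_category_scheme \<Rightarrow> 'l \<Rightarrow> 'l \<Rightarrow> 't \<Rightarrow> 't \<Rightarrow> 'c \<Rightarrow> bool" where
  "is_cell D M N s t \<alpha> \<longleftrightarrow> \<alpha> \<in> Hom (Cells D) M N \<and> LeftA D \<alpha> = s \<and> RightA D \<alpha> = t"

definition thin :: "('o, 't, 'l, 'c, 'z) double_category_scheme \<Rightarrow> bool" where
  "thin D \<longleftrightarrow> (\<forall>M N s t \<alpha> \<beta>. is_cell D M N s t \<alpha> \<longrightarrow> is_cell D M N s t \<beta> \<longrightarrow> \<alpha> = \<beta>)"

definition loose_category ::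
  "('o, 't, 'l, 'c, 'z) double_category_scheme \<Rightarrow> ('o, 'l) category" where
  "loose_category D = \<lparr>
     Obj = Obj (Tight D),
     Arr = Obj (Cells D),
     Dom = LeftO D,
     Cod = RightO D,
     Ident = LIdentO D,
     Comp = LCompO D\<rparr>"

end

theory Submission
  imports Defs "HOL-Library.Multiset"
begin

text \<open>
  Loose maps compose by a trace, cells are commuting squares. That cells compose in the loose
  direction is what uniformity gives: if \<open>(t\<^sup>+ \<otimes> s\<^sup>-) \<cdot> f = f' \<cdot> (t\<^sup>- \<otimes> s\<^sup>+)\<close> and
  \<open>(u\<^sup>+ \<otimes> t\<^sup>-) \<cdot> g = g' \<cdot> (u\<^sup>- \<otimes> t\<^sup>+)\<close>, then the arrows \<open>k\<close> and \<open>k'\<close> whose traces along \<open>B\<^sup>-\<close> are the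
  two composites satisfy \<open>((u\<^sup>+ \<otimes> s\<^sup>-) \<otimes> t\<^sup>-) \<cdot> k = k' \<cdot> ((u\<^sup>- \<otimes> s\<^sup>+) \<otimes> t\<^sup>-)\<close>, and strictness of
  \<open>t\<^sup>-\<close> turns this into the required equation between the traces (\<open>icomp_square\<close>). The other
  operations on cells preserve commuting squares by pasting or by naturality, and a cell is determined
  by its boundary, so each equation between cells reduces to equations between loose maps and between
  tight maps. This reduction is carried out once and for all in the locale \<open>square_system\<close>.

  What remains is the theorem of Joyal, Street and Verity that Int arrows form a monoidal category:
  composition is associative and unital, and the tensor product preserves it. String diagrams make
  this evident, and the proof follows them. A diagram is a \<^emph>\<open>network\<close>
  \<open>Tr\<^sup>U(q \<cdot> F \<cdot> p)\<close>, where \<open>F\<close> is a tensor product of boxes and \<open>p\<close>, \<open>q\<close> are permutations of wires. The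
  composite of \<open>f\<close> and \<open>g\<close> is the network with box \<open>g \<otimes> f\<close> in which the wires \<open>B\<^sup>-\<close> and \<open>B\<^sup>+\<close> are fed
  back (\<open>icomp_net\<close>, by yanking). By superposing and the monoidality of the trace, networks are closed
  under tensor products and under insertion into one another (\<open>net_Tensor_left\<close>, \<open>net_Tensor_right\<close>,
  \<open>net_nest\<close>), and by dinaturality a network does not depend on how its boxes and its feedback wires are
  arranged (\<open>net_cong\<close>). Both sides of associativity, and of the compatibility with tensor products, thus
  become networks with the same boxes and the same connections; the unit laws follow from yanking directly.

  Permutations of wires have to be compared with composites of associators, unitors and braidings.
  To this end the coherence theorem for symmetric monoidal categories is proved for bracketed tensor
  products whose factors carry labels: between two such products there is at most one canonical arrow
  (\<open>canonical_unique\<close>), the structural isomorphisms are canonical (the braiding if its two sides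
  share no label), canonical arrows are closed
  under composition, tensor products and inverses, and any two products with the same factors, all of
  them with different labels, are related by a canonical arrow \<open>can\<close> (\<open>canonical_can\<close>).
\<close>

section \<open>Categories and symmetric monoidal categories\<close>

context category
begin

lemma Hom_iff: "f \<in> Hom C A B \<longleftrightarrow> f \<in> Arr C \<and> Dom C f = A \<and> Cod C f = B"
  by (simp add: Hom_def)

lemmas [simp] = Dom_Obj Cod_Obj

lemma Ident_simps [simp]:
  assumes "A \<in> Obj C"
  shows "\<one> A \<in> Arr C" "Dom C (\<one> A) = A" "Cod C (\<one> A) = A"
  using Ident_Hom[OF assms] by (simp_all add: Hom_iff)

lemma Comp_simps [simp]:
  assumes "f \<in> Arr C" "g \<in> Arr C" "Dom C g = Cod C f"
  shows "g \<cdot> f \<in> Arr C" "Dom C (g \<cdot> f) = Dom C f" "Cod C (g \<cdot> f) = Cod C g"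
  using Comp_Hom[of f "Dom C f" "Cod C f" g "Cod C g"] assms by (simp_all add: Hom_iff)

lemma Comp_Ident' [simp]: "f \<in> Arr C \<Longrightarrow> Dom C f = A \<Longrightarrow> f \<cdot> \<one> A = f"
  using Comp_Ident[of f "Dom C f" "Cod C f"] by (auto simp: Hom_iff)

lemma Ident_Comp' [simp]: "f \<in> Arr C \<Longrightarrow> Cod C f = A \<Longrightarrow> \<one> A \<cdot> f = f"
  using Ident_Comp[of f "Dom C f" "Cod C f"] by (auto simp: Hom_iff)

lemma Comp_assoc' [simp]:
  "f \<in> Arr C \<Longrightarrow> g \<in> Arr C \<Longrightarrow> h \<in> Arr C \<Longrightarrow> Dom C g = Cod C f \<Longrightarrow> Dom C h = Cod C g \<Longrightarrow>
   (h \<cdot> g) \<cdot> f = h \<cdot> g \<cdot> f"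
  using Comp_assoc by (simp add: Hom_iff)

text \<open>
  Composites are kept bracketed to the right. An equation for a composite of two arrows can then only
  be used for rewriting inside longer composites if it is also available with a further factor.
\<close>

lemma Comp_prefix:
  assumes "a \<cdot> b = m"
    and "a \<in> Arr C" "b \<in> Arr C" "k \<in> Arr C" "Dom C a = Cod C b" "Dom C b = Cod C k"
  shows "a \<cdot> b \<cdot> k = m \<cdot> k"
  using Comp_assoc'[of k b a] assms by simp

lemma is_inverse_unique:
  assumes "f \<in> Arr C" "is_inverse C f g" "is_inverse C f h"
  shows "g = h"
proof -
  have [simp]: "g \<in> Arr C" "h \<in> Arr C" "Dom C g = Cod C f" "Dom C h = Cod C f" "Cod C g = Dom C f" "Cod C h = Dom C f"
    and gf: "g \<cdot> f = \<one> (Dom C f)" and fh: "f \<cdot> h = \<one> (Cod C f)"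
    using assms(2,3) by (auto simp: is_inverse_def Hom_iff)
  have "g = g \<cdot> f \<cdot> h" using assms(1) by (simp add: fh)
  also have "\<dots> = h" using assms(1) by (simp add: Comp_prefix[OF gf])
  finally show ?thesis .
qed

lemma is_inverse_Inverse:
  assumes "iso C f"
  shows "is_inverse C f (Inverse C f)"
proof -
  obtain g where g: "f \<in> Arr C" "is_inverse C f g" using assms by (auto simp: iso_def)
  then have "(THE g. is_inverse C f g) = g"
    by (intro the_equality) (auto intro: is_inverse_unique)
  then show ?thesis using g by (simp add: Inverse_def)
qed

lemma iso_Arr: "iso C f \<Longrightarrow> f \<in> Arr C"
  by (simp add: iso_def)

lemma Inverse_simps [simp]:
  assumes "iso C f"
  shows "Inverse C f \<in> Arr C" "Dom C (Inverse C f) = Cod C f" "Cod C (Inverse C f) = Dom C f"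
    "Inverse C f \<cdot> f = \<one> (Dom C f)" "f \<cdot> Inverse C f = \<one> (Cod C f)"
  using is_inverse_Inverse[OF assms] assms by (auto simp: is_inverse_def Hom_iff iso_def)

lemma Inverse_prefix [simp]:
  assumes "iso C f" "k \<in> Arr C"
  shows "Cod C k = Dom C f \<Longrightarrow> Inverse C f \<cdot> f \<cdot> k = k" "Cod C k = Cod C f \<Longrightarrow> f \<cdot> Inverse C f \<cdot> k = k"
  using Comp_prefix[OF Inverse_simps(4), of f k] Comp_prefix[OF Inverse_simps(5), of f k] assms by (simp_all add: iso_Arr)

lemma isoI:
  assumes "f \<in> Arr C" "g \<in> Arr C" "Dom C g = Cod C f" "Cod C g = Dom C f"
    "g \<cdot> f = \<one> (Dom C f)" "f \<cdot> g = \<one> (Cod C f)"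
  shows "iso C f" "Inverse C f = g"
proof -
  have g: "is_inverse C f g" using assms by (simp add: is_inverse_def Hom_iff)
  then show iso: "iso C f" using assms by (auto simp: iso_def)
  show "Inverse C f = g" by (rule is_inverse_unique[OF assms(1) is_inverse_Inverse[OF iso] g])
qed

lemma iso_Inverse [simp]: "iso C f \<Longrightarrow> iso C (Inverse C f)" 
  by (rule isoI[of _ f]) (auto simp: iso_Arr)

lemma iso_Ident [simp]: "A \<in> Obj C \<Longrightarrow> iso C (\<one> A)"
  by (rule isoI[of _ "\<one> A"]) auto

lemma iso_Comp [simp]:
  assumes "iso C f" "iso C g" "Dom C g = Cod C f"
  shows "iso C (g \<cdot> f)"
  by (rule isoI[of _ "Inverse C f \<cdot> Inverse C g"]) (use assms in \<open>auto simp: iso_Arr\<close>)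

lemma iso_cancel_left:
  assumes "iso C g" "f \<in> Arr C" "f' \<in> Arr C" "Cod C f = Dom C g" "Cod C f' = Dom C g" "g \<cdot> f = g \<cdot> f'"
  shows "f = f'"
  using Inverse_prefix(1)[of g f] Inverse_prefix(1)[of g f'] assms by metis

lemma iso_cancel_right:
  assumes "iso C g" "f \<in> Arr C" "f' \<in> Arr C" "Dom C f = Cod C g" "Dom C f' = Cod C g" "f \<cdot> g = f' \<cdot> g"
  shows "f = f'"
proof -
  have "(f \<cdot> g) \<cdot> Inverse C g = (f' \<cdot> g) \<cdot> Inverse C g" using assms by simp
  then show ?thesis using assms(1-5) by (simp add: iso_Arr)
qed

end

context symmetric_monoidal_category
begin

lemmas [simp] = MUnit_Obj TensorO_Obj Assoc_iso Lunit_iso Runit_iso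

lemma Tensor_simps [simp]:
  assumes "f \<in> Arr C" "g \<in> Arr C"
  shows "f \<otimes> g \<in> Arr C" "Dom C (f \<otimes> g) = Dom C f \<boxtimes> Dom C g" "Cod C (f \<otimes> g) = Cod C f \<boxtimes> Cod C g"
  using TensorA_Hom[of f "Dom C f" "Cod C f" g "Dom C g" "Cod C g"] assms by (simp_all add: Hom_iff)

lemma Assoc_simps [simp]:
  assumes "A \<in> Obj C" "B \<in> Obj C" "D \<in> Obj C"
  shows "Assoc C A B D \<in> Arr C" "Dom C (Assoc C A B D) = (A \<boxtimes> B) \<boxtimes> D"
    "Cod C (Assoc C A B D) = A \<boxtimes> (B \<boxtimes> D)"
  using Assoc_Hom[OF assms] by (simp_all add: Hom_iff)

lemma Unitor_simps [simp]:
  assumes "A \<in> Obj C"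
  shows "Lunit C A \<in> Arr C" "Dom C (Lunit C A) = MUnit C \<boxtimes> A" "Cod C (Lunit C A) = A"
    "Runit C A \<in> Arr C" "Dom C (Runit C A) = A \<boxtimes> MUnit C" "Cod C (Runit C A) = A"
  using Lunit_Hom[OF assms] Runit_Hom[OF assms] by (simp_all add: Hom_iff)

lemma Braid_simps [simp]:
  assumes "A \<in> Obj C" "B \<in> Obj C"
  shows "Braid C A B \<in> Arr C" "Dom C (Braid C A B) = A \<boxtimes> B" "Cod C (Braid C A B) = B \<boxtimes> A"
    "Braid C B A \<cdot> Braid C A B = \<one> (A \<boxtimes> B)" "iso C (Braid C A B)" "Inverse C (Braid C A B) = Braid C B A"
proof -
  show *: "Braid C A B \<in> Arr C" "Dom C (Braid C A B) = A \<boxtimes> B" "Cod C (Braid C A B) = B \<boxtimes> A"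
    "Braid C B A \<cdot> Braid C A B = \<one> (A \<boxtimes> B)"
    using Braid_Hom[OF assms] Braid_symmetric assms by (simp_all add: Hom_iff)
  have "Braid C B A \<in> Arr C" "Dom C (Braid C B A) = B \<boxtimes> A" "Cod C (Braid C B A) = A \<boxtimes> B"
    "Braid C A B \<cdot> Braid C B A = \<one> (B \<boxtimes> A)"
    using Braid_Hom[of B A] Braid_symmetric[of B A] assms by (simp_all add: Hom_iff)
  then show "iso C (Braid C A B)" "Inverse C (Braid C A B) = Braid C B A"
    using * by (auto intro!: isoI[of _ "Braid C B A"])
qed

lemmas [simp] = TensorA_Ident

lemma Tensor_Comp:
  "f \<in> Arr C \<Longrightarrow> g \<in> Arr C \<Longrightarrow> f' \<in> Arr C \<Longrightarrow> g' \<in> Arr C \<Longrightarrow>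
   Dom C g = Cod C f \<Longrightarrow> Dom C g' = Cod C f' \<Longrightarrow>
   (g \<otimes> g') \<cdot> (f \<otimes> f') = (g \<cdot> f) \<otimes> (g' \<cdot> f')"
  using TensorA_Comp by (simp add: Hom_iff)

lemma Tensor_Comp_prefix:
  "f \<in> Arr C \<Longrightarrow> g \<in> Arr C \<Longrightarrow> f' \<in> Arr C \<Longrightarrow> g' \<in> Arr C \<Longrightarrow> k \<in> Arr C \<Longrightarrow>
   Dom C g = Cod C f \<Longrightarrow> Dom C g' = Cod C f' \<Longrightarrow> Cod C k = Dom C f \<boxtimes> Dom C f' \<Longrightarrow>
   (g \<otimes> g') \<cdot> (f \<otimes> f') \<cdot> k = ((g \<cdot> f) \<otimes> (g' \<cdot> f')) \<cdot> k"
  by (intro Comp_prefix Tensor_Comp) simp_all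

lemmas Tensor_merge = Tensor_Comp Tensor_Comp_prefix

lemma iso_Tensor [simp]:
  assumes "iso C f" "iso C g"
  shows "iso C (f \<otimes> g)"
  by (rule isoI[of _ "Inverse C f \<otimes> Inverse C g"]) (use assms in \<open>auto simp: Tensor_merge iso_Arr\<close>)

lemma Inverse_Tensor:
  assumes "iso C f" "iso C g"
  shows "Inverse C (f \<otimes> g) = Inverse C f \<otimes> Inverse C g"
  by (rule isoI(2)[of _ "Inverse C f \<otimes> Inverse C g"]) (use assms in \<open>auto simp: Tensor_merge iso_Arr\<close>)

lemma Assoc_nat:
  "f \<in> Arr C \<Longrightarrow> g \<in> Arr C \<Longrightarrow> h \<in> Arr C \<Longrightarrow> Cod C f = A \<Longrightarrow> Cod C g = B \<Longrightarrow> Cod C h = D \<Longrightarrow>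
   Assoc C A B D \<cdot> ((f \<otimes> g) \<otimes> h) = (f \<otimes> (g \<otimes> h)) \<cdot> Assoc C (Dom C f) (Dom C g) (Dom C h)"
  using Assoc_natural by (auto simp: Hom_iff)

lemma Assoc_nat_prefix:
  "f \<in> Arr C \<Longrightarrow> g \<in> Arr C \<Longrightarrow> h \<in> Arr C \<Longrightarrow> Cod C f = A \<Longrightarrow> Cod C g = B \<Longrightarrow> Cod C h = D \<Longrightarrow>
   k \<in> Arr C \<Longrightarrow> Cod C k = (Dom C f \<boxtimes> Dom C g) \<boxtimes> Dom C h \<Longrightarrow>
   Assoc C A B D \<cdot> ((f \<otimes> g) \<otimes> h) \<cdot> k = (f \<otimes> (g \<otimes> h)) \<cdot> Assoc C (Dom C f) (Dom C g) (Dom C h) \<cdot> k"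
  using Comp_prefix[OF Assoc_nat] by auto

lemma Assoc_inv_nat:
  assumes "f \<in> Arr C" "g \<in> Arr C" "h \<in> Arr C" "Cod C f = A" "Cod C g = B" "Cod C h = D"
  shows "Inverse C (Assoc C A B D) \<cdot> (f \<otimes> (g \<otimes> h)) =
    ((f \<otimes> g) \<otimes> h) \<cdot> Inverse C (Assoc C (Dom C f) (Dom C g) (Dom C h))"
proof -
  have [simp]: "A \<in> Obj C" "B \<in> Obj C" "D \<in> Obj C" using assms by auto
  have "Assoc C A B D \<cdot> Inverse C (Assoc C A B D) \<cdot> (f \<otimes> (g \<otimes> h)) =
    Assoc C A B D \<cdot> ((f \<otimes> g) \<otimes> h) \<cdot> Inverse C (Assoc C (Dom C f) (Dom C g) (Dom C h))"
    using assms by (simp add: Assoc_nat_prefix)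
  then show ?thesis
    by (rule iso_cancel_left[rotated 5]) (use assms in simp_all)
qed

lemma Assoc_inv_nat_prefix:
  "f \<in> Arr C \<Longrightarrow> g \<in> Arr C \<Longrightarrow> h \<in> Arr C \<Longrightarrow> Cod C f = A \<Longrightarrow> Cod C g = B \<Longrightarrow> Cod C h = D \<Longrightarrow>
   k \<in> Arr C \<Longrightarrow> Cod C k = Dom C f \<boxtimes> Dom C g \<boxtimes> Dom C h \<Longrightarrow>
   Inverse C (Assoc C A B D) \<cdot> (f \<otimes> (g \<otimes> h)) \<cdot> k =
    ((f \<otimes> g) \<otimes> h) \<cdot> Inverse C (Assoc C (Dom C f) (Dom C g) (Dom C h)) \<cdot> k"
  using Comp_prefix[OF Assoc_inv_nat] by auto

lemma Braid_nat:
  "f \<in> Arr C \<Longrightarrow> g \<in> Arr C \<Longrightarrow> Cod C f = A \<Longrightarrow> Cod C g = B \<Longrightarrow>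
   Braid C A B \<cdot> (f \<otimes> g) = (g \<otimes> f) \<cdot> Braid C (Dom C f) (Dom C g)"
  using Braid_natural by (auto simp: Hom_iff)

lemma Braid_nat_prefix:
  "f \<in> Arr C \<Longrightarrow> g \<in> Arr C \<Longrightarrow> Cod C f = A \<Longrightarrow> Cod C g = B \<Longrightarrow>
   k \<in> Arr C \<Longrightarrow> Cod C k = Dom C f \<boxtimes> Dom C g \<Longrightarrow>
   Braid C A B \<cdot> (f \<otimes> g) \<cdot> k = (g \<otimes> f) \<cdot> Braid C (Dom C f) (Dom C g) \<cdot> k"
  using Comp_prefix[OF Braid_nat] by auto

lemma Lunit_nat:
  "f \<in> Arr C \<Longrightarrow> Cod C f = B \<Longrightarrow> Lunit C B \<cdot> (\<one> (MUnit C) \<otimes> f) = f \<cdot> Lunit C (Dom C f)"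
  using Lunit_natural by (auto simp: Hom_iff)

lemma Runit_nat:
  "f \<in> Arr C \<Longrightarrow> Cod C f = B \<Longrightarrow> Runit C B \<cdot> (f \<otimes> \<one> (MUnit C)) = f \<cdot> Runit C (Dom C f)"
  using Runit_natural by (auto simp: Hom_iff)

text \<open>
  Tensoring with the unit is faithful because the unitor is a natural isomorphism.
\<close>

lemma Tensor_unit_right_cancel:
  assumes "f \<in> Arr C" "g \<in> Arr C" "Dom C f = Dom C g" "Cod C f = Cod C g"
    "f \<otimes> \<one> (MUnit C) = g \<otimes> \<one> (MUnit C)"
  shows "f = g"
proof -
  have "f \<cdot> Runit C (Dom C f) = g \<cdot> Runit C (Dom C f)"
    using Runit_nat[of f, symmetric] Runit_nat[of g, symmetric] assms by simp
  then show ?thesis by (rule iso_cancel_right[rotated 5]) (use assms in simp_all)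
qed

lemma Tensor_unit_left_cancel:
  assumes "f \<in> Arr C" "g \<in> Arr C" "Dom C f = Dom C g" "Cod C f = Cod C g"
    "\<one> (MUnit C) \<otimes> f = \<one> (MUnit C) \<otimes> g"
  shows "f = g"
proof -
  have "f \<cdot> Lunit C (Dom C f) = g \<cdot> Lunit C (Dom C f)"
    using Lunit_nat[of f, symmetric] Lunit_nat[of g, symmetric] assms by simp
  then show ?thesis by (rule iso_cancel_right[rotated 5]) (use assms in simp_all)
qed

lemma pentagon_prefix:
  "A \<in> Obj C \<Longrightarrow> B \<in> Obj C \<Longrightarrow> D \<in> Obj C \<Longrightarrow> E \<in> Obj C \<Longrightarrow>
   k \<in> Arr C \<Longrightarrow> Cod C k = ((A \<boxtimes> B) \<boxtimes> D) \<boxtimes> E \<Longrightarrow>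
   Assoc C A B (D \<boxtimes> E) \<cdot> Assoc C (A \<boxtimes> B) D E \<cdot> k =
   (\<one> A \<otimes> Assoc C B D E) \<cdot> Assoc C A (B \<boxtimes> D) E \<cdot> (Assoc C A B D \<otimes> \<one> E) \<cdot> k"
  using Comp_prefix[OF pentagon] by auto

text \<open>
  One of Kelly's consequences of the pentagon and the triangle. Tensoring with the unit is faithful, so
  it suffices to prove the equation tensored with the unit on the left; there the pentagon for \<open>I\<close>, \<open>I\<close>,
  \<open>A\<close>, \<open>B\<close> makes both unitors accessible to the triangle.
\<close>

lemma Lunit_Tensor:
  assumes [simp]: "A \<in> Obj C" "B \<in> Obj C"
  shows "Lunit C (A \<boxtimes> B) \<cdot> Assoc C (MUnit C) A B = Lunit C A \<otimes> \<one> B"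
proof -
  let ?I = "MUnit C"
  let ?k = "Assoc C ?I (?I \<boxtimes> A) B \<cdot> (Assoc C ?I ?I A \<otimes> \<one> B)"
  have "(\<one> ?I \<otimes> (Lunit C (A \<boxtimes> B) \<cdot> Assoc C ?I A B)) \<cdot> ?k =
    (\<one> ?I \<otimes> Lunit C (A \<boxtimes> B)) \<cdot> (Assoc C ?I ?I (A \<boxtimes> B) \<cdot> Assoc C (?I \<boxtimes> ?I) A B)"
    unfolding pentagon[OF MUnit_Obj MUnit_Obj assms] by (simp add: Tensor_merge)
  also have "\<dots> = (Runit C ?I \<otimes> \<one> (A \<boxtimes> B)) \<cdot> Assoc C (?I \<boxtimes> ?I) A B"
    using Comp_prefix[OF triangle[of ?I "A \<boxtimes> B"], of "Assoc C (?I \<boxtimes> ?I) A B"] by simp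
  also have "\<dots> = Assoc C ?I A B \<cdot> ((Runit C ?I \<otimes> \<one> A) \<otimes> \<one> B)"
    by (simp add: Assoc_nat)
  also have "\<dots> = (\<one> ?I \<otimes> (Lunit C A \<otimes> \<one> B)) \<cdot> ?k"
    using Assoc_nat_prefix[of "\<one> ?I" "Lunit C A" "\<one> B" ?I A B "Assoc C ?I ?I A \<otimes> \<one> B"]
    by (simp add: triangle[symmetric] Tensor_merge)
  finally have "\<one> ?I \<otimes> (Lunit C (A \<boxtimes> B) \<cdot> Assoc C ?I A B) = \<one> ?I \<otimes> (Lunit C A \<otimes> \<one> B)"
    by (rule iso_cancel_right[rotated 5]) simp_all
  then show ?thesis by (rule Tensor_unit_left_cancel[rotated 4]) simp_all
qed

text \<open>
  The hexagon for \<open>A\<close>, \<open>I\<close>, \<open>I\<close>, followed by the left unitor, has \<open>Runit A \<otimes> \<one> I\<close> on one side and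
  \<open>(Lunit A \<cdot> Braid A I) \<otimes> \<one> I\<close> on the other, up to an invertible factor.
\<close>

lemma Lunit_Braid:
  assumes [simp]: "A \<in> Obj C"
  shows "Lunit C A \<cdot> Braid C A (MUnit C) = Runit C A"
proof -
  let ?I = "MUnit C"
  have "Lunit C (?I \<boxtimes> A) \<cdot> Assoc C ?I ?I A \<cdot> Braid C A (?I \<boxtimes> ?I) \<cdot> Assoc C A ?I ?I =
    (Lunit C ?I \<otimes> \<one> A) \<cdot> Braid C A (?I \<boxtimes> ?I) \<cdot> Assoc C A ?I ?I"
    using Comp_prefix[OF Lunit_Tensor[of ?I A], of "Braid C A (?I \<boxtimes> ?I) \<cdot> Assoc C A ?I ?I"] by simp
  also have "\<dots> = Braid C A ?I \<cdot> (\<one> A \<otimes> Lunit C ?I) \<cdot> Assoc C A ?I ?I"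
    by (simp add: Braid_nat_prefix)
  also have "\<dots> = Braid C A ?I \<cdot> (Runit C A \<otimes> \<one> ?I)" by (simp add: triangle)
  finally have 1: "Lunit C (?I \<boxtimes> A) \<cdot> Assoc C ?I ?I A \<cdot> Braid C A (?I \<boxtimes> ?I) \<cdot> Assoc C A ?I ?I =
    Braid C A ?I \<cdot> (Runit C A \<otimes> \<one> ?I)" .
  have "Lunit C (?I \<boxtimes> A) \<cdot> (\<one> ?I \<otimes> Braid C A ?I) \<cdot> Assoc C ?I A ?I \<cdot> (Braid C A ?I \<otimes> \<one> ?I) =
    Braid C A ?I \<cdot> Lunit C (A \<boxtimes> ?I) \<cdot> Assoc C ?I A ?I \<cdot> (Braid C A ?I \<otimes> \<one> ?I)"
    using Comp_prefix[OF Lunit_nat[of "Braid C A ?I"], of _ "Assoc C ?I A ?I \<cdot> (Braid C A ?I \<otimes> \<one> ?I)"] by simp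
  also have "\<dots> = Braid C A ?I \<cdot> (Lunit C A \<otimes> \<one> ?I) \<cdot> (Braid C A ?I \<otimes> \<one> ?I)"
    using Comp_prefix[OF Lunit_Tensor[of A ?I], of "Braid C A ?I \<otimes> \<one> ?I"] by simp
  also have "\<dots> = Braid C A ?I \<cdot> ((Lunit C A \<cdot> Braid C A ?I) \<otimes> \<one> ?I)" by (simp add: Tensor_merge)
  finally have 2: "Braid C A ?I \<cdot> ((Lunit C A \<cdot> Braid C A ?I) \<otimes> \<one> ?I) = Braid C A ?I \<cdot> (Runit C A \<otimes> \<one> ?I)"
    using 1 hexagon[of A ?I ?I] by simp
  have "(Lunit C A \<cdot> Braid C A ?I) \<otimes> \<one> ?I = Runit C A \<otimes> \<one> ?I"
    using 2 by (rule iso_cancel_left[rotated 5]) simp_all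
  then show ?thesis by (rule Tensor_unit_right_cancel[rotated 4]) simp_all
qed

end

section \<open>Permutations of the factors of a tensor product\<close>

context symmetric_monoidal_category
begin

text \<open>
  The transposition of the first two factors of \<open>X \<boxtimes> Y \<boxtimes> R\<close>. Every permutation of the factors of a
  tensor product nested to the right is composed of such transpositions, applied at some depth.
\<close>

definition swap_left :: "'o \<Rightarrow> 'o \<Rightarrow> 'o \<Rightarrow> 'm" where
  "swap_left X Y R = Assoc C Y X R \<cdot> (Braid C X Y \<otimes> \<one> R) \<cdot> Inverse C (Assoc C X Y R)"

lemma swap_left_simps [simp]:
  assumes "X \<in> Obj C" "Y \<in> Obj C" "R \<in> Obj C"
  shows "swap_left X Y R \<in> Arr C" "Dom C (swap_left X Y R) = X \<boxtimes> Y \<boxtimes> R" "Cod C (swap_left X Y R) = Y \<boxtimes> X \<boxtimes> R"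
    "iso C (swap_left X Y R)"
  using assms by (simp_all add: swap_left_def)

lemma swap_left_nat:
  assumes "f \<in> Arr C" "g \<in> Arr C" "h \<in> Arr C" "Cod C f = A" "Cod C g = B" "Cod C h = D"
  shows "swap_left A B D \<cdot> (f \<otimes> g \<otimes> h) = (g \<otimes> f \<otimes> h) \<cdot> swap_left (Dom C f) (Dom C g) (Dom C h)"
proof -
  have [simp]: "A \<in> Obj C" "B \<in> Obj C" "D \<in> Obj C" using assms by auto
  have "swap_left A B D \<cdot> (f \<otimes> g \<otimes> h) = Assoc C B A D \<cdot> (Braid C A B \<otimes> \<one> D) \<cdot> ((f \<otimes> g) \<otimes> h) \<cdot>
    Inverse C (Assoc C (Dom C f) (Dom C g) (Dom C h))"
    using assms by (simp add: swap_left_def Assoc_inv_nat)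
  also have "\<dots> = Assoc C B A D \<cdot> ((g \<otimes> f) \<otimes> h) \<cdot> (Braid C (Dom C f) (Dom C g) \<otimes> \<one> (Dom C h)) \<cdot>
    Inverse C (Assoc C (Dom C f) (Dom C g) (Dom C h))"
    using assms by (simp add: Tensor_merge Braid_nat)
  also have "\<dots> = (g \<otimes> f \<otimes> h) \<cdot> swap_left (Dom C f) (Dom C g) (Dom C h)"
    using assms by (simp add: swap_left_def Assoc_nat_prefix)
  finally show ?thesis .
qed

lemma swap_left_nat_prefix:
  "f \<in> Arr C \<Longrightarrow> g \<in> Arr C \<Longrightarrow> h \<in> Arr C \<Longrightarrow> Cod C f = A \<Longrightarrow> Cod C g = B \<Longrightarrow> Cod C h = D \<Longrightarrow>
   k \<in> Arr C \<Longrightarrow> Cod C k = Dom C f \<boxtimes> Dom C g \<boxtimes> Dom C h \<Longrightarrow>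
   swap_left A B D \<cdot> (f \<otimes> g \<otimes> h) \<cdot> k = (g \<otimes> f \<otimes> h) \<cdot> swap_left (Dom C f) (Dom C g) (Dom C h) \<cdot> k"
  using Comp_prefix[OF swap_left_nat] by auto

lemma swap_left_swap_left:
  assumes [simp]: "X \<in> Obj C" "Y \<in> Obj C" "R \<in> Obj C"
  shows "swap_left Y X R \<cdot> swap_left X Y R = \<one> (X \<boxtimes> Y \<boxtimes> R)"
  by (simp add: swap_left_def Tensor_merge)

text \<open>
  This is the hexagon tensored with \<open>R\<close>; the pentagon moves \<open>R\<close> past the associators.
\<close>

lemma swap_left_hexagon:
  assumes [simp]: "W \<in> Obj C" "Y \<in> Obj C" "Z \<in> Obj C" "R \<in> Obj C"
  shows "Assoc C Y Z (W \<boxtimes> R) \<cdot> swap_left W (Y \<boxtimes> Z) R =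
    (\<one> Y \<otimes> swap_left W Z R) \<cdot> swap_left W Y (Z \<boxtimes> R) \<cdot> (\<one> W \<otimes> Assoc C Y Z R)"
proof -
  let ?a = "Assoc C"
  let ?k = "?a W (Y \<boxtimes> Z) R \<cdot> (?a W Y Z \<otimes> \<one> R)"
  \<comment> \<open>Precomposed with \<open>?k\<close>, the left-hand side contains the left-hand side of the hexagon, tensored
      with \<open>R\<close>.\<close>
  have "(?a Y Z (W \<boxtimes> R) \<cdot> swap_left W (Y \<boxtimes> Z) R) \<cdot> ?k =
    ?a Y Z (W \<boxtimes> R) \<cdot> ?a (Y \<boxtimes> Z) W R \<cdot> ((Braid C W (Y \<boxtimes> Z) \<cdot> ?a W Y Z) \<otimes> \<one> R)"
    by (simp add: swap_left_def Tensor_merge)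
  also have "\<dots> = (\<one> Y \<otimes> ?a Z W R) \<cdot> ?a Y (Z \<boxtimes> W) R \<cdot>
      ((?a Y Z W \<cdot> Braid C W (Y \<boxtimes> Z) \<cdot> ?a W Y Z) \<otimes> \<one> R)"
    by (simp add: pentagon_prefix Tensor_merge)
  also have "\<dots> = (\<one> Y \<otimes> ?a Z W R) \<cdot> ?a Y (Z \<boxtimes> W) R \<cdot> ((\<one> Y \<otimes> Braid C W Z) \<otimes> \<one> R) \<cdot>
      (?a Y W Z \<otimes> \<one> R) \<cdot> ((Braid C W Y \<otimes> \<one> Z) \<otimes> \<one> R)"
    by (simp add: hexagon Tensor_merge)
  also have "\<dots> = (\<one> Y \<otimes> ?a Z W R) \<cdot> (\<one> Y \<otimes> (Braid C W Z \<otimes> \<one> R)) \<cdot> ?a Y (W \<boxtimes> Z) R \<cdot>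
      (?a Y W Z \<otimes> \<one> R) \<cdot> ((Braid C W Y \<otimes> \<one> Z) \<otimes> \<one> R)"
    by (simp add: Assoc_nat_prefix)
  finally have 1: "(?a Y Z (W \<boxtimes> R) \<cdot> swap_left W (Y \<boxtimes> Z) R) \<cdot> ?k = \<dots>" .
  have "(\<one> W \<otimes> ?a Y Z R) \<cdot> ?k = ?a W Y (Z \<boxtimes> R) \<cdot> ?a (W \<boxtimes> Y) Z R"
    by (simp add: pentagon)
  then have "((\<one> Y \<otimes> swap_left W Z R) \<cdot> swap_left W Y (Z \<boxtimes> R) \<cdot> (\<one> W \<otimes> ?a Y Z R)) \<cdot> ?k =
    (\<one> Y \<otimes> swap_left W Z R) \<cdot> swap_left W Y (Z \<boxtimes> R) \<cdot> ?a W Y (Z \<boxtimes> R) \<cdot> ?a (W \<boxtimes> Y) Z R"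
    by simp
  also have "\<dots> = (\<one> Y \<otimes> swap_left W Z R) \<cdot> ?a Y W (Z \<boxtimes> R) \<cdot> ?a (Y \<boxtimes> W) Z R \<cdot> ((Braid C W Y \<otimes> \<one> Z) \<otimes> \<one> R)"
    using Assoc_nat[of "Braid C W Y" "\<one> Z" "\<one> R" "Y \<boxtimes> W" Z R]
    by (simp add: swap_left_def[of W Y])
  also have "\<dots> = (\<one> Y \<otimes> ?a Z W R) \<cdot> (\<one> Y \<otimes> (Braid C W Z \<otimes> \<one> R)) \<cdot> ?a Y (W \<boxtimes> Z) R \<cdot>
      (?a Y W Z \<otimes> \<one> R) \<cdot> ((Braid C W Y \<otimes> \<one> Z) \<otimes> \<one> R)"
    by (simp add: pentagon_prefix swap_left_def Tensor_merge)
  finally have "(?a Y Z (W \<boxtimes> R) \<cdot> swap_left W (Y \<boxtimes> Z) R) \<cdot> ?k =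
    ((\<one> Y \<otimes> swap_left W Z R) \<cdot> swap_left W Y (Z \<boxtimes> R) \<cdot> (\<one> W \<otimes> ?a Y Z R)) \<cdot> ?k"
    using 1 by simp
  then show ?thesis by (rule iso_cancel_right[rotated 5]) simp_all
qed

text \<open>
  Moving \<open>W\<close> past \<open>Y \<boxtimes> Z\<close> commutes with the braiding of \<open>Y\<close> and \<open>Z\<close> by naturality;
  \<open>swap_left_hexagon\<close> splits the move of \<open>W\<close> into two transpositions, once before and once after the braiding.
\<close>

lemma swap_left_Yang_Baxter:
  assumes [simp]: "W \<in> Obj C" "Y \<in> Obj C" "Z \<in> Obj C" "R \<in> Obj C"
  shows "swap_left Y Z (W \<boxtimes> R) \<cdot> (\<one> Y \<otimes> swap_left W Z R) \<cdot> swap_left W Y (Z \<boxtimes> R) =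
    (\<one> Z \<otimes> swap_left W Y R) \<cdot> swap_left W Z (Y \<boxtimes> R) \<cdot> (\<one> W \<otimes> swap_left Y Z R)"
proof -
  let ?a = "Assoc C" and ?b = "Inverse C (Assoc C Y Z R)"
  have "(\<one> Z \<otimes> swap_left W Y R) \<cdot> swap_left W Z (Y \<boxtimes> R) \<cdot> (\<one> W \<otimes> swap_left Y Z R) =
    ((\<one> Z \<otimes> swap_left W Y R) \<cdot> swap_left W Z (Y \<boxtimes> R) \<cdot> (\<one> W \<otimes> ?a Z Y R)) \<cdot>
      (\<one> W \<otimes> (Braid C Y Z \<otimes> \<one> R)) \<cdot> (\<one> W \<otimes> ?b)"
    by (simp add: swap_left_def[of Y Z] Tensor_merge)
  also have "\<dots> = ?a Z Y (W \<boxtimes> R) \<cdot> swap_left W (Z \<boxtimes> Y) R \<cdot> (\<one> W \<otimes> (Braid C Y Z \<otimes> \<one> R)) \<cdot> (\<one> W \<otimes> ?b)"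
    by (subst swap_left_hexagon[symmetric]) simp_all
  also have "\<dots> = ?a Z Y (W \<boxtimes> R) \<cdot> (Braid C Y Z \<otimes> \<one> (W \<boxtimes> R)) \<cdot> swap_left W (Y \<boxtimes> Z) R \<cdot> (\<one> W \<otimes> ?b)"
    using swap_left_nat_prefix[of "\<one> W" "Braid C Y Z" "\<one> R" W "Z \<boxtimes> Y" R "\<one> W \<otimes> ?b"] by simp
  also have "\<dots> = swap_left Y Z (W \<boxtimes> R) \<cdot> (?a Y Z (W \<boxtimes> R) \<cdot> swap_left W (Y \<boxtimes> Z) R) \<cdot> (\<one> W \<otimes> ?b)"
    by (simp add: swap_left_def[of Y Z])
  also have "\<dots> = swap_left Y Z (W \<boxtimes> R) \<cdot> (\<one> Y \<otimes> swap_left W Z R) \<cdot> swap_left W Y (Z \<boxtimes> R)"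
    unfolding swap_left_hexagon[OF assms] by (simp add: Tensor_merge)
  finally show ?thesis by simp
qed

text \<open>
  A list of labelled objects acts on a base object \<open>R\<close> by tensoring from the left. With a variable base
  instead of the unit, concatenation of lists is composition of these actions on the nose, so that no
  isomorphism is needed to compare the product of a concatenation with the product of the parts.
\<close>

primrec stack :: "(nat \<times> 'o) list \<Rightarrow> 'o \<Rightarrow> 'o" where
  "stack [] R = R"
| "stack (x # xs) R = snd x \<boxtimes> stack xs R"

primrec stack_map :: "(nat \<times> 'o) list \<Rightarrow> 'm \<Rightarrow> 'm" where
  "stack_map [] h = h"
| "stack_map (x # xs) h = \<one> (snd x) \<otimes> stack_map xs h"

text \<open>
  Moves the first occurrence of \<open>y\<close> to the front by transpositions. The value for lists without \<open>y\<close> is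
  arbitrary.
\<close>

primrec pull_front :: "nat \<times> 'o \<Rightarrow> (nat \<times> 'o) list \<Rightarrow> 'o \<Rightarrow> 'm" where
  "pull_front y [] R = \<one> R"
| "pull_front y (x # xs) R = (if x = y then \<one> (stack (x # xs) R)
     else swap_left (snd x) (snd y) (stack (remove1 y xs) R) \<cdot> (\<one> (snd x) \<otimes> pull_front y xs R))"

text \<open>
  The permutation from \<open>xs\<close> to \<open>ys\<close>, which pulls the elements of \<open>ys\<close> to the front one after the other.
  Elements that occur several times keep their order.
\<close>

primrec permute :: "(nat \<times> 'o) list \<Rightarrow> (nat \<times> 'o) list \<Rightarrow> 'o \<Rightarrow> 'm" where
  "permute xs [] R = \<one> R"
| "permute xs (y # ys) R = (\<one> (snd y) \<otimes> permute (remove1 y xs) ys R) \<cdot> pull_front y xs R"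

definition objs :: "(nat \<times> 'o) list \<Rightarrow> bool" where
  "objs xs \<longleftrightarrow> snd ` set xs \<subseteq> Obj C"

lemma objs_simps [simp]:
  "objs []" "objs (x # xs) \<longleftrightarrow> snd x \<in> Obj C \<and> objs xs" "objs (xs @ ys) \<longleftrightarrow> objs xs \<and> objs ys"
  by (auto simp: objs_def)

lemma objs_mem [simp]: "x \<in> set xs \<Longrightarrow> objs xs \<Longrightarrow> snd x \<in> Obj C"
  by (auto simp: objs_def)

lemma objs_remove1 [simp]: "objs xs \<Longrightarrow> objs (remove1 x xs)"
  using set_remove1_subset[of x xs] by (auto simp: objs_def)

lemma objs_mset: "mset xs = mset ys \<Longrightarrow> objs xs \<longleftrightarrow> objs ys"
  by (metis mset_eq_setD objs_def)

lemma stack_Obj [simp]: "objs xs \<Longrightarrow> R \<in> Obj C \<Longrightarrow> stack xs R \<in> Obj C"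
  by (induction xs) auto

lemma stack_append [simp]: "stack (xs @ ys) R = stack xs (stack ys R)"
  by (induction xs) auto

lemma stack_map_simps [simp]:
  assumes "objs xs" "h \<in> Arr C"
  shows "stack_map xs h \<in> Arr C" "Dom C (stack_map xs h) = stack xs (Dom C h)" "Cod C (stack_map xs h) = stack xs (Cod C h)"
  using assms by (induction xs) auto

lemma stack_map_append: "stack_map (xs @ ys) h = stack_map xs (stack_map ys h)"
  by (induction xs) auto

lemma pull_front_simps [simp]:
  assumes "y \<in> set xs" "objs xs" "R \<in> Obj C"
  shows "pull_front y xs R \<in> Arr C" "Dom C (pull_front y xs R) = stack xs R"
    "Cod C (pull_front y xs R) = snd y \<boxtimes> stack (remove1 y xs) R"
  using assms by (induction xs) auto

text \<open>
  The Yang-Baxter equation enters here: it is the induction step for a head that is neither \<open>y\<close> nor \<open>z\<close>.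
  With \<open>y\<close> at the head, that pull is trivial; with \<open>z\<close> at the head, the transposition cancels against
  its inverse.
\<close>

lemma pull_front_exchange:
  assumes "y \<noteq> z" "y \<in> set xs" "z \<in> set xs" "objs xs" "R \<in> Obj C"
  shows "swap_left (snd y) (snd z) (stack (remove1 z (remove1 y xs)) R) \<cdot>
      (\<one> (snd y) \<otimes> pull_front z (remove1 y xs) R) \<cdot> pull_front y xs R =
    (\<one> (snd z) \<otimes> pull_front y (remove1 z xs) R) \<cdot> pull_front z xs R"
  using assms
proof (induction xs)
  case (Cons x xs)
  consider "x = y" | "x = z" | "x \<noteq> y" "x \<noteq> z" by blast
  then show ?case
  proof cases
    case 1
    then show ?thesis using Cons.prems by simp
  next
    case 2
    let ?L = "stack (remove1 y xs) R"
    have "swap_left (snd y) (snd z) ?L \<cdot> swap_left (snd z) (snd y) ?L \<cdot> (\<one> (snd z) \<otimes> pull_front y xs R) =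
      \<one> (snd z) \<otimes> pull_front y xs R"
      using 2 Cons.prems by (subst Comp_prefix[OF swap_left_swap_left]) auto
    then show ?thesis using 2 Cons.prems by simp
  next
    \<comment> \<open>Both \<open>y\<close> and \<open>z\<close> are pulled out of the tail and then past the head \<open>x\<close>.\<close>
    case 3
    let ?w = "snd x" and ?y = "snd y" and ?z = "snd z"
    let ?L = "stack (remove1 z (remove1 y xs)) R"
    have L: "stack (remove1 y (remove1 z xs)) R = ?L" by (simp add: remove1_commute)
    have mem: "y \<in> set xs" "z \<in> set xs" "z \<in> set (remove1 y xs)" "y \<in> set (remove1 z xs)"
      using 3 Cons.prems by auto
    have [simp]: "?w \<in> Obj C" "?y \<in> Obj C" "?z \<in> Obj C" "objs xs" "R \<in> Obj C" "?L \<in> Obj C"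
      using Cons.prems by auto
    note [simp] = mem
    let ?fy = "pull_front y xs R" and ?fz = "pull_front z xs R"
      and ?fyz = "pull_front z (remove1 y xs) R" and ?fzy = "pull_front y (remove1 z xs) R"
    have "swap_left ?y ?z (stack (remove1 z (remove1 y (x # xs))) R) \<cdot>
      (\<one> ?y \<otimes> pull_front z (remove1 y (x # xs)) R) \<cdot> pull_front y (x # xs) R =
      swap_left ?y ?z (?w \<boxtimes> ?L) \<cdot> (\<one> ?y \<otimes> (swap_left ?w ?z ?L \<cdot> (\<one> ?w \<otimes> ?fyz))) \<cdot>
        swap_left ?w ?y (stack (remove1 y xs) R) \<cdot> (\<one> ?w \<otimes> ?fy)"
      using 3 by (simp add: eq_commute[of x])
    also have "\<dots> = swap_left ?y ?z (?w \<boxtimes> ?L) \<cdot> (\<one> ?y \<otimes> swap_left ?w ?z ?L) \<cdot> (\<one> ?y \<otimes> \<one> ?w \<otimes> ?fyz) \<cdot>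
        swap_left ?w ?y (stack (remove1 y xs) R) \<cdot> (\<one> ?w \<otimes> ?fy)"
      by (simp add: Tensor_merge del: TensorA_Ident)
    also have "\<dots> = swap_left ?y ?z (?w \<boxtimes> ?L) \<cdot> (\<one> ?y \<otimes> swap_left ?w ?z ?L) \<cdot> swap_left ?w ?y (?z \<boxtimes> ?L) \<cdot>
        (\<one> ?w \<otimes> \<one> ?y \<otimes> ?fyz) \<cdot> (\<one> ?w \<otimes> ?fy)"
      using swap_left_nat_prefix[of "\<one> ?w" "\<one> ?y" ?fyz ?w ?y "?z \<boxtimes> ?L" "\<one> ?w \<otimes> ?fy"] by simp
    also have "\<dots> = (swap_left ?y ?z (?w \<boxtimes> ?L) \<cdot> (\<one> ?y \<otimes> swap_left ?w ?z ?L) \<cdot> swap_left ?w ?y (?z \<boxtimes> ?L)) \<cdot>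
        (\<one> ?w \<otimes> \<one> ?y \<otimes> ?fyz) \<cdot> (\<one> ?w \<otimes> ?fy)"
      by simp
    also have "\<dots> = (\<one> ?z \<otimes> swap_left ?w ?y ?L) \<cdot> swap_left ?w ?z (?y \<boxtimes> ?L) \<cdot>
        (\<one> ?w \<otimes> (swap_left ?y ?z ?L \<cdot> (\<one> ?y \<otimes> ?fyz) \<cdot> ?fy))"
      by (simp add: swap_left_Yang_Baxter Tensor_merge)
    also have "swap_left ?y ?z ?L \<cdot> (\<one> ?y \<otimes> ?fyz) \<cdot> ?fy = (\<one> ?z \<otimes> ?fzy) \<cdot> ?fz"
      using Cons by simp
    also have "(\<one> ?z \<otimes> swap_left ?w ?y ?L) \<cdot> swap_left ?w ?z (?y \<boxtimes> ?L) \<cdot> (\<one> ?w \<otimes> ((\<one> ?z \<otimes> ?fzy) \<cdot> ?fz)) =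
      (\<one> ?z \<otimes> swap_left ?w ?y ?L) \<cdot> swap_left ?w ?z (?y \<boxtimes> ?L) \<cdot> (\<one> ?w \<otimes> \<one> ?z \<otimes> ?fzy) \<cdot> (\<one> ?w \<otimes> ?fz)"
      by (simp add: Tensor_merge L del: TensorA_Ident)
    also have "\<dots> = (\<one> ?z \<otimes> swap_left ?w ?y ?L) \<cdot> (\<one> ?z \<otimes> \<one> ?w \<otimes> ?fzy) \<cdot>
        swap_left ?w ?z (stack (remove1 z xs) R) \<cdot> (\<one> ?w \<otimes> ?fz)"
      using swap_left_nat_prefix[of "\<one> ?w" "\<one> ?z" ?fzy ?w ?z "?y \<boxtimes> ?L" "\<one> ?w \<otimes> ?fz"] by (simp add: L)
    also have "\<dots> = (\<one> ?z \<otimes> pull_front y (remove1 z (x # xs)) R) \<cdot> pull_front z (x # xs) R"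
      using 3 by (simp add: L Tensor_merge eq_commute[of x] del: TensorA_Ident)
    finally show ?thesis .
  qed
qed simp

(* Multisets of lists with an element removed are compared as they stand, not as differences. *)
declare mset_remove1 [simp del]

lemma mset_eq_ConsD:
  "mset xs = mset (y # ys) \<Longrightarrow> y \<in> set xs \<and> mset (remove1 y xs) = mset ys"
  by (metis list.set_intros(1) mset_eq_setD mset_remove1 remove1.simps(2))

lemma mset_eq_remove1: "mset xs = mset ys \<Longrightarrow> mset (remove1 y xs) = mset (remove1 y ys)"
  by (simp add: mset_remove1)

lemma permute_simps [simp]:
  assumes "mset xs = mset ys" "objs xs" "R \<in> Obj C"
  shows "permute xs ys R \<in> Arr C" "Dom C (permute xs ys R) = stack xs R" "Cod C (permute xs ys R) = stack ys R"
proof -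
  have "permute xs ys R \<in> Arr C \<and> Dom C (permute xs ys R) = stack xs R \<and> Cod C (permute xs ys R) = stack ys R"
    using assms
  proof (induction ys arbitrary: xs)
    case (Cons y ys)
    then show ?case using mset_eq_ConsD[of xs y ys] objs_mem[of y xs] by simp
  qed simp
  then show "permute xs ys R \<in> Arr C" "Dom C (permute xs ys R) = stack xs R" "Cod C (permute xs ys R) = stack ys R"
    by auto
qed

lemma permute_Ident: "objs xs \<Longrightarrow> R \<in> Obj C \<Longrightarrow> permute xs xs R = \<one> (stack xs R)"
  by (induction xs) auto

text \<open>
  The pull of \<open>z\<close> out of \<open>ys\<close> is performed after \<open>permute\<close> has pulled all elements of \<open>ys\<close> that precede
  \<open>z\<close>; \<open>pull_front_exchange\<close> moves it before these.
\<close>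

lemma permute_pull_front:
  assumes "mset xs = mset ys" "z \<in> set ys" "objs xs" "R \<in> Obj C"
  shows "pull_front z ys R \<cdot> permute xs ys R = (\<one> (snd z) \<otimes> permute (remove1 z xs) (remove1 z ys) R) \<cdot> pull_front z xs R"
  using assms
proof (induction ys arbitrary: xs)
  case (Cons y ys)
  note xs = mset_eq_ConsD[OF Cons.prems(1)]
  have [simp]: "y \<in> set xs" "mset (remove1 y xs) = mset ys" "objs xs" "R \<in> Obj C" "objs ys"
    "snd y \<in> Obj C"
    using xs Cons.prems objs_mset[OF Cons.prems(1)] by auto
  show ?case
  proof (cases "z = y")
    case True
    then show ?thesis by simp
  next
    case False
    have zys [simp]: "z \<in> set ys" using False Cons.prems by simp
    have [simp]: "z \<in> set xs" "z \<in> set (remove1 y xs)" "y \<in> set (remove1 z xs)"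
      using mset_eq_setD[OF Cons.prems(1)] False by auto
    have [simp]: "snd z \<in> Obj C" by (rule objs_mem[of z xs]) auto
    have m [simp]: "mset (remove1 z (remove1 y xs)) = mset (remove1 z ys)"
      using xs by (metis mset_eq_remove1)
    let ?y = "snd y" and ?z = "snd z"
    let ?L = "stack (remove1 z ys) R" and ?L' = "stack (remove1 z (remove1 y xs)) R"
    let ?P = "permute (remove1 z (remove1 y xs)) (remove1 z ys) R"
    have "pull_front z (y # ys) R \<cdot> permute xs (y # ys) R =
      swap_left ?y ?z ?L \<cdot> (\<one> ?y \<otimes> (pull_front z ys R \<cdot> permute (remove1 y xs) ys R)) \<cdot> pull_front y xs R"
      using False by (simp add: Tensor_merge)
    also have "\<dots> = swap_left ?y ?z ?L \<cdot> (\<one> ?y \<otimes> ((\<one> ?z \<otimes> ?P) \<cdot> pull_front z (remove1 y xs) R)) \<cdot> pull_front y xs R"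
      using Cons.IH[of "remove1 y xs"] by simp
    also have "\<dots> = swap_left ?y ?z ?L \<cdot> (\<one> ?y \<otimes> \<one> ?z \<otimes> ?P) \<cdot> (\<one> ?y \<otimes> pull_front z (remove1 y xs) R) \<cdot> pull_front y xs R"
      by (simp add: Tensor_merge del: TensorA_Ident)
    also have "\<dots> = (\<one> ?z \<otimes> \<one> ?y \<otimes> ?P) \<cdot> swap_left ?y ?z ?L' \<cdot> (\<one> ?y \<otimes> pull_front z (remove1 y xs) R) \<cdot> pull_front y xs R"
      using swap_left_nat_prefix[of "\<one> ?y" "\<one> ?z" ?P ?y ?z ?L "(\<one> ?y \<otimes> pull_front z (remove1 y xs) R) \<cdot> pull_front y xs R"]
      by simp
    also have "\<dots> = (\<one> ?z \<otimes> \<one> ?y \<otimes> ?P) \<cdot> (\<one> ?z \<otimes> pull_front y (remove1 z xs) R) \<cdot> pull_front z xs R"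
      using False by (subst pull_front_exchange) auto
    also have "\<dots> = (\<one> ?z \<otimes> permute (remove1 z xs) (remove1 z (y # ys)) R) \<cdot> pull_front z xs R"
      using False by (simp add: remove1_commute[of y z] Tensor_merge)
    finally show ?thesis .
  qed
qed simp

text \<open>
  The core of the coherence theorem: the result of a sequence of rearrangements depends on the first and
  the last list only. The induction is on the last list, whose head is pulled to the front before the
  rearrangement of \<open>xs\<close> to \<open>ys\<close> instead of after it.
\<close>

lemma permute_Comp:
  assumes "mset xs = mset ys" "mset ys = mset zs" "objs xs" "R \<in> Obj C"
  shows "permute ys zs R \<cdot> permute xs ys R = permute xs zs R"
  using assms
proof (induction zs arbitrary: xs ys)
  case (Cons z zs)
  have m: "mset xs = mset (z # zs)" using Cons.prems by simp
  note [simp] = objs_mset[OF Cons.prems(1), symmetric]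
  have [simp]: "z \<in> set ys" "mset (remove1 z ys) = mset zs" "z \<in> set xs" "mset (remove1 z xs) = mset zs"
    "objs xs" "R \<in> Obj C"
    using mset_eq_ConsD[OF m] mset_eq_ConsD[OF Cons.prems(2)] Cons.prems(3,4) by auto
  have [simp]: "snd z \<in> Obj C" by (rule objs_mem[of z xs]) auto
  have "permute ys (z # zs) R \<cdot> permute xs ys R =
    (\<one> (snd z) \<otimes> permute (remove1 z ys) zs R) \<cdot> pull_front z ys R \<cdot> permute xs ys R"
    using Cons.prems(1) by simp
  also have "\<dots> = (\<one> (snd z) \<otimes> (permute (remove1 z ys) zs R \<cdot> permute (remove1 z xs) (remove1 z ys) R)) \<cdot> pull_front z xs R"
    using Cons.prems(1) by (simp add: permute_pull_front Tensor_merge)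
  also have "permute (remove1 z ys) zs R \<cdot> permute (remove1 z xs) (remove1 z ys) R = permute (remove1 z xs) zs R"
    by (rule Cons.IH) auto
  finally show ?case by simp
qed simp

lemma pull_front_nat:
  assumes "y \<in> set xs" "objs xs" "h \<in> Arr C"
  shows "pull_front y xs (Cod C h) \<cdot> stack_map xs h = (\<one> (snd y) \<otimes> stack_map (remove1 y xs) h) \<cdot> pull_front y xs (Dom C h)"
  using assms
proof (induction xs)
  case (Cons x xs)
  show ?case
  proof (cases "x = y")
    case True
    then show ?thesis using Cons.prems by simp
  next
    case False
    then have [simp]: "y \<in> set xs" "objs xs" "h \<in> Arr C" "snd x \<in> Obj C" using Cons.prems by auto
    then have [simp]: "snd y \<in> Obj C" by (rule_tac objs_mem[of y xs])
    let ?w = "snd x" and ?y = "snd y" and ?l = "stack_map (remove1 y xs) h"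
    have "pull_front y (x # xs) (Cod C h) \<cdot> stack_map (x # xs) h =
      swap_left ?w ?y (stack (remove1 y xs) (Cod C h)) \<cdot> (\<one> ?w \<otimes> (pull_front y xs (Cod C h) \<cdot> stack_map xs h))"
      using False by (simp add: Tensor_merge)
    also have "\<dots> = swap_left ?w ?y (stack (remove1 y xs) (Cod C h)) \<cdot>
        (\<one> ?w \<otimes> \<one> ?y \<otimes> ?l) \<cdot> (\<one> ?w \<otimes> pull_front y xs (Dom C h))"
      using Cons by (simp add: Tensor_merge del: TensorA_Ident)
    also have "\<dots> = (\<one> ?y \<otimes> \<one> ?w \<otimes> ?l) \<cdot> swap_left ?w ?y (stack (remove1 y xs) (Dom C h)) \<cdot>
        (\<one> ?w \<otimes> pull_front y xs (Dom C h))"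
      using swap_left_nat_prefix[of "\<one> ?w" "\<one> ?y" ?l ?w ?y "stack (remove1 y xs) (Cod C h)" "\<one> ?w \<otimes> pull_front y xs (Dom C h)"]
      by simp
    finally show ?thesis using False by (simp add: Tensor_merge)
  qed
qed simp

lemma pull_front_append:
  "y \<in> set xs \<Longrightarrow> pull_front y (xs @ ys) R = pull_front y xs (stack ys R)"
  by (induction xs) (auto simp: remove1_append)

lemma permute_append:
  assumes "mset xs = mset xs'" "mset ys = mset ys'" "objs xs" "objs ys" "R \<in> Obj C"
  shows "permute (xs @ ys) (xs' @ ys') R = permute xs xs' (stack ys' R) \<cdot> stack_map xs (permute ys ys' R)"
  using assms
proof (induction xs' arbitrary: xs)
  case (Cons x xs')
  have [simp]: "x \<in> set xs" "mset (remove1 x xs) = mset xs'" "objs xs" "R \<in> Obj C" "objs ys" "objs ys'"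
    using mset_eq_ConsD[OF Cons.prems(1)] Cons.prems(3-) objs_mset[OF assms(2)] by auto
  have [simp]: "snd x \<in> Obj C" by (rule objs_mem[of x xs]) auto
  note [simp] = assms(2)
  have "permute (xs @ ys) ((x # xs') @ ys') R =
    (\<one> (snd x) \<otimes> (permute (remove1 x xs) xs' (stack ys' R) \<cdot> stack_map (remove1 x xs) (permute ys ys' R))) \<cdot> pull_front x xs (stack ys R)"
    using Cons.IH[of "remove1 x xs"] by (simp add: remove1_append pull_front_append)
  also have "\<dots> = (\<one> (snd x) \<otimes> permute (remove1 x xs) xs' (stack ys' R)) \<cdot>
      (\<one> (snd x) \<otimes> stack_map (remove1 x xs) (permute ys ys' R)) \<cdot> pull_front x xs (stack ys R)"
    by (simp add: Tensor_merge)
  also have "\<dots> = permute xs (x # xs') (stack ys' R) \<cdot> stack_map xs (permute ys ys' R)"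
    using pull_front_nat[of x xs "permute ys ys' R"] by simp
  finally show ?case .
qed simp

end

section \<open>Coherence for symmetric monoidal categories\<close>

text \<open>
  A bracketed tensor product with labelled factors. The labels tell apart factors which are the same
  object, so that a permutation of the factors can be read off from its source and its target.
\<close>

datatype 'o cable = Wire nat 'o | Empty | Join "'o cable" "'o cable" (infixr \<open>\<odot>\<close> 70)

primrec wires :: "'o cable \<Rightarrow> (nat \<times> 'o) list" where
  "wires (Wire n X) = [(n, X)]"
| "wires Empty = []"
| "wires (s \<odot> t) = wires s @ wires t"

context symmetric_monoidal_category
begin

primrec obj :: "'o cable \<Rightarrow> 'o" where
  "obj (Wire n X) = X"
| "obj Empty = MUnit C"
| "obj (s \<odot> t) = obj s \<boxtimes> obj t"

text \<open>
  The structural isomorphism that removes brackets and units from \<open>obj t \<boxtimes> R\<close>.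
\<close>

primrec comb :: "'o cable \<Rightarrow> 'o \<Rightarrow> 'm" where
  "comb (Wire n X) R = \<one> (X \<boxtimes> R)"
| "comb Empty R = Lunit C R"
| "comb (s \<odot> t) R = comb s (stack (wires t) R) \<cdot> (\<one> (obj s) \<otimes> comb t R) \<cdot> Assoc C (obj s) (obj t) R"

lemma obj_Obj [simp]: "objs (wires t) \<Longrightarrow> obj t \<in> Obj C"
  by (induction t) auto

lemma comb_simps [simp]:
  assumes "objs (wires t)" "R \<in> Obj C"
  shows "comb t R \<in> Arr C" "Dom C (comb t R) = obj t \<boxtimes> R" "Cod C (comb t R) = stack (wires t) R"
    "iso C (comb t R)"
proof -
  have "iso C (comb t R) \<and> Dom C (comb t R) = obj t \<boxtimes> R \<and> Cod C (comb t R) = stack (wires t) R"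
    using assms by (induction t arbitrary: R) (auto simp: iso_Arr)
  then show "comb t R \<in> Arr C" "Dom C (comb t R) = obj t \<boxtimes> R" "Cod C (comb t R) = stack (wires t) R"
    "iso C (comb t R)"
    by (auto simp: iso_Arr)
qed

lemma comb_nat:
  assumes "objs (wires t)" "h \<in> Arr C"
  shows "comb t (Cod C h) \<cdot> (\<one> (obj t) \<otimes> h) = stack_map (wires t) h \<cdot> comb t (Dom C h)"
  using assms
proof (induction t arbitrary: h)
  case (Join s t)
  then have [simp]: "objs (wires s)" "objs (wires t)" "h \<in> Arr C" by auto
  let ?s = "obj s" and ?t = "obj t" and ?R = "Dom C h" and ?R' = "Cod C h"
  have "comb (s \<odot> t) ?R' \<cdot> (\<one> (obj (s \<odot> t)) \<otimes> h) =
    comb s (stack (wires t) ?R') \<cdot> (\<one> ?s \<otimes> comb t ?R') \<cdot> (\<one> ?s \<otimes> \<one> ?t \<otimes> h) \<cdot> Assoc C ?s ?t ?R"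
    using Assoc_nat[of "\<one> ?s" "\<one> ?t" h ?s ?t ?R'] by simp
  also have "\<dots> = comb s (stack (wires t) ?R') \<cdot> (\<one> ?s \<otimes> stack_map (wires t) h) \<cdot> (\<one> ?s \<otimes> comb t ?R) \<cdot> Assoc C ?s ?t ?R"
    using Join.IH(2)[of h] by (simp add: Tensor_merge)
  also have "\<dots> = stack_map (wires s) (stack_map (wires t) h) \<cdot> comb s (stack (wires t) ?R) \<cdot> (\<one> ?s \<otimes> comb t ?R) \<cdot> Assoc C ?s ?t ?R"
    using Comp_prefix[OF Join.IH(1)[of "stack_map (wires t) h"], of "(\<one> ?s \<otimes> comb t ?R) \<cdot> Assoc C ?s ?t ?R"] by simp
  finally show ?case by (simp add: stack_map_append)
qed (simp_all add: Lunit_nat)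

text \<open>
  An arrow between cables is canonical if it is the permutation of the labels once both ends have been
  combed. Asking this for every base object \<open>R\<close> makes the notion stable under tensor products; the case
  of the unit already determines the arrow.
\<close>

definition canonical :: "'o cable \<Rightarrow> 'o cable \<Rightarrow> 'm \<Rightarrow> bool" where
  "canonical s t m \<longleftrightarrow> iso C m \<and> Dom C m = obj s \<and> Cod C m = obj t \<and>
     objs (wires s) \<and> objs (wires t) \<and> mset (wires s) = mset (wires t) \<and>
     (\<forall>R \<in> Obj C. comb t R \<cdot> (m \<otimes> \<one> R) = permute (wires s) (wires t) R \<cdot> comb s R)"

lemma canonicalD:
  assumes "canonical s t m"
  shows "iso C m" "m \<in> Arr C" "Dom C m = obj s" "Cod C m = obj t"
    "objs (wires s)" "objs (wires t)" "mset (wires s) = mset (wires t)"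
    "R \<in> Obj C \<Longrightarrow> comb t R \<cdot> (m \<otimes> \<one> R) = permute (wires s) (wires t) R \<cdot> comb s R"
  using assms by (auto simp: canonical_def iso_Arr)

lemma canonical_unique:
  assumes "canonical s t m" "canonical s t m'"
  shows "m = m'"
proof -
  note [simp] = canonicalD(1-6)[OF assms(1)] canonicalD(1-6)[OF assms(2)]
  have "comb t (MUnit C) \<cdot> (m \<otimes> \<one> (MUnit C)) = comb t (MUnit C) \<cdot> (m' \<otimes> \<one> (MUnit C))"
    using canonicalD(8)[OF assms(1)] canonicalD(8)[OF assms(2)] by simp
  then have "m \<otimes> \<one> (MUnit C) = m' \<otimes> \<one> (MUnit C)" by (rule iso_cancel_left[rotated 5]) simp_all
  then show ?thesis by (rule Tensor_unit_right_cancel[rotated 4]) simp_all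
qed

lemma canonical_Ident: "objs (wires s) \<Longrightarrow> canonical s s (\<one> (obj s))"
  by (simp add: canonical_def permute_Ident)

lemma canonical_Comp:
  assumes "canonical s t m" "canonical t u n"
  shows "canonical s u (n \<cdot> m)"
proof -
  note [simp] = canonicalD(1-6)[OF assms(1)] canonicalD(1-6)[OF assms(2)]
  note ms = canonicalD(7)[OF assms(1)] canonicalD(7)[OF assms(2)]
  have "comb u R \<cdot> ((n \<cdot> m) \<otimes> \<one> R) = permute (wires s) (wires u) R \<cdot> comb s R" if [simp]: "R \<in> Obj C" for R
  proof -
    have "comb u R \<cdot> ((n \<cdot> m) \<otimes> \<one> R) = (comb u R \<cdot> (n \<otimes> \<one> R)) \<cdot> (m \<otimes> \<one> R)"
      by (simp add: Tensor_merge)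
    also have "\<dots> = permute (wires t) (wires u) R \<cdot> comb t R \<cdot> (m \<otimes> \<one> R)"
      using canonicalD(8)[OF assms(2)] ms by simp
    also have "\<dots> = permute (wires t) (wires u) R \<cdot> permute (wires s) (wires t) R \<cdot> comb s R"
      using canonicalD(8)[OF assms(1)] by simp
    also have "\<dots> = permute (wires s) (wires u) R \<cdot> comb s R"
      using ms by (subst Comp_prefix[OF permute_Comp[of _ "wires t"]]) auto
    finally show ?thesis .
  qed
  then show ?thesis using ms by (simp add: canonical_def)
qed

lemma canonical_Inverse:
  assumes "canonical s t m"
  shows "canonical t s (Inverse C m)"
proof -
  note [simp] = canonicalD(1-6)[OF assms(1)]
  note ms = canonicalD(7)[OF assms(1)]
  have "comb s R \<cdot> (Inverse C m \<otimes> \<one> R) = permute (wires t) (wires s) R \<cdot> comb t R" if [simp]: "R \<in> Obj C" for R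
  proof -
    have "permute (wires t) (wires s) R \<cdot> comb t R =
      permute (wires t) (wires s) R \<cdot> (comb t R \<cdot> (m \<otimes> \<one> R)) \<cdot> (Inverse C m \<otimes> \<one> R)"
      using ms by (simp add: Tensor_merge)
    also have "\<dots> = permute (wires t) (wires s) R \<cdot> permute (wires s) (wires t) R \<cdot> comb s R \<cdot> (Inverse C m \<otimes> \<one> R)"
      using canonicalD(8)[OF assms(1)] ms by simp
    also have "\<dots> = comb s R \<cdot> (Inverse C m \<otimes> \<one> R)"
      using ms by (subst Comp_prefix[OF permute_Comp[of _ "wires t"]]) (auto simp: permute_Ident)
    finally show ?thesis by simp
  qed
  then show ?thesis using ms by (simp add: canonical_def)
qed

text \<open>
  Combing \<open>t \<odot> t'\<close> combs \<open>t'\<close> on the base \<open>R\<close> and then \<open>t\<close> on the resulting base, so the two hypotheses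
  apply in turn; \<open>permute_append\<close> collects the two permutations.
\<close>

lemma canonical_Tensor:
  assumes "canonical s t m" "canonical s' t' m'"
  shows "canonical (s \<odot> s') (t \<odot> t') (m \<otimes> m')"
proof -
  note [simp] = canonicalD(1-6)[OF assms(1)] canonicalD(1-6)[OF assms(2)]
  note ms = canonicalD(7)[OF assms(1)] canonicalD(7)[OF assms(2)]
  have "comb (t \<odot> t') R \<cdot> ((m \<otimes> m') \<otimes> \<one> R) = permute (wires (s \<odot> s')) (wires (t \<odot> t')) R \<cdot> comb (s \<odot> s') R"
    if [simp]: "R \<in> Obj C" for R
  proof -
    let ?L = "stack (wires s') R" and ?L' = "stack (wires t') R" and ?P = "permute (wires s') (wires t') R"
    have "comb (t \<odot> t') R \<cdot> ((m \<otimes> m') \<otimes> \<one> R) =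
      comb t ?L' \<cdot> (m \<otimes> (comb t' R \<cdot> (m' \<otimes> \<one> R))) \<cdot> Assoc C (obj s) (obj s') R"
      by (simp add: Assoc_nat Tensor_merge)
    also have "\<dots> = comb t ?L' \<cdot> (m \<otimes> (?P \<cdot> comb s' R)) \<cdot> Assoc C (obj s) (obj s') R"
      using canonicalD(8)[OF assms(2)] by simp
    also have "\<dots> = (comb t ?L' \<cdot> (m \<otimes> \<one> ?L')) \<cdot> (\<one> (obj s) \<otimes> ?P) \<cdot> (\<one> (obj s) \<otimes> comb s' R) \<cdot>
      Assoc C (obj s) (obj s') R"
      using ms by (simp add: Tensor_merge)
    also have "\<dots> = permute (wires s) (wires t) ?L' \<cdot> (comb s ?L' \<cdot> (\<one> (obj s) \<otimes> ?P)) \<cdot>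
      (\<one> (obj s) \<otimes> comb s' R) \<cdot> Assoc C (obj s) (obj s') R"
      using canonicalD(8)[OF assms(1), of ?L'] ms by simp
    also have "comb s ?L' \<cdot> (\<one> (obj s) \<otimes> ?P) = stack_map (wires s) ?P \<cdot> comb s ?L"
      using comb_nat[of s ?P] ms by simp
    finally show ?thesis using ms by (simp add: permute_append)
  qed
  then show ?thesis using ms by (simp add: canonical_def)
qed

lemma canonical_Assoc:
  assumes [simp]: "objs (wires a)" "objs (wires b)" "objs (wires c)"
  shows "canonical ((a \<odot> b) \<odot> c) (a \<odot> (b \<odot> c)) (Assoc C (obj a) (obj b) (obj c))"
proof -
  have "comb (a \<odot> b \<odot> c) R \<cdot> (Assoc C (obj a) (obj b) (obj c) \<otimes> \<one> R) = comb ((a \<odot> b) \<odot> c) R"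
    if [simp]: "R \<in> Obj C" for R
  proof -
    let ?a = "obj a" and ?b = "obj b" and ?c = "obj c"
    have "comb (a \<odot> b \<odot> c) R \<cdot> (Assoc C ?a ?b ?c \<otimes> \<one> R) =
      comb a (stack (wires b) (stack (wires c) R)) \<cdot> (\<one> ?a \<otimes> comb b (stack (wires c) R)) \<cdot> (\<one> ?a \<otimes> \<one> ?b \<otimes> comb c R) \<cdot>
      (\<one> ?a \<otimes> Assoc C ?b ?c R) \<cdot> Assoc C ?a (?b \<boxtimes> ?c) R \<cdot> (Assoc C ?a ?b ?c \<otimes> \<one> R)"
      by (simp add: Tensor_merge)
    also have "\<dots> = comb a (stack (wires b) (stack (wires c) R)) \<cdot> (\<one> ?a \<otimes> comb b (stack (wires c) R)) \<cdot>
      (\<one> ?a \<otimes> \<one> ?b \<otimes> comb c R) \<cdot> Assoc C ?a ?b (?c \<boxtimes> R) \<cdot> Assoc C (?a \<boxtimes> ?b) ?c R"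
      by (simp add: pentagon)
    also have "\<dots> = comb ((a \<odot> b) \<odot> c) R"
      using Assoc_nat_prefix[of "\<one> ?a" "\<one> ?b" "comb c R" ?a ?b _ "Assoc C (?a \<boxtimes> ?b) ?c R"] by simp
    finally show ?thesis .
  qed
  then show ?thesis by (simp add: canonical_def permute_Ident)
qed

lemma canonical_Lunit:
  assumes [simp]: "objs (wires a)"
  shows "canonical (Empty \<odot> a) a (Lunit C (obj a))"
proof -
  have "comb a R \<cdot> (Lunit C (obj a) \<otimes> \<one> R) = comb (Empty \<odot> a) R" if [simp]: "R \<in> Obj C" for R
    using Comp_prefix[OF Lunit_nat[of "comb a R"], of _ "Assoc C (MUnit C) (obj a) R"]
    by (simp add: Lunit_Tensor[symmetric])
  then show ?thesis by (simp add: canonical_def permute_Ident)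
qed

lemma canonical_Runit:
  assumes [simp]: "objs (wires a)"
  shows "canonical (a \<odot> Empty) a (Runit C (obj a))"
  by (simp add: canonical_def permute_Ident triangle)

text \<open>
  The hexagon expresses the braiding with \<open>t \<odot> u\<close> by the braidings with \<open>t\<close> and with \<open>u\<close>.
\<close>

lemma canonical_Braid_Join:
  assumes "canonical (s \<odot> t) (t \<odot> s) (Braid C (obj s) (obj t))"
    "canonical (s \<odot> u) (u \<odot> s) (Braid C (obj s) (obj u))"
  shows "canonical (s \<odot> (t \<odot> u)) ((t \<odot> u) \<odot> s) (Braid C (obj s) (obj (t \<odot> u)))"
proof -
  let ?s = "obj s" and ?t = "obj t" and ?u = "obj u"
  have [simp]: "objs (wires s)" "objs (wires t)" "objs (wires u)"
    using canonicalD(5)[OF assms(1)] canonicalD(5)[OF assms(2)] by auto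
  have "Inverse C (Assoc C ?t ?u ?s) \<cdot> (Assoc C ?t ?u ?s \<cdot> Braid C ?s (?t \<boxtimes> ?u) \<cdot> Assoc C ?s ?t ?u) \<cdot>
      Inverse C (Assoc C ?s ?t ?u) = Braid C ?s (?t \<boxtimes> ?u)"
    by simp
  then have "Braid C ?s (?t \<boxtimes> ?u) = Inverse C (Assoc C ?t ?u ?s) \<cdot>
    ((\<one> ?t \<otimes> Braid C ?s ?u) \<cdot> Assoc C ?t ?s ?u \<cdot> (Braid C ?s ?t \<otimes> \<one> ?u)) \<cdot> Inverse C (Assoc C ?s ?t ?u)"
    by (simp only: hexagon obj_Obj \<open>objs (wires s)\<close> \<open>objs (wires t)\<close> \<open>objs (wires u)\<close>)
  also have "canonical (s \<odot> (t \<odot> u)) ((t \<odot> u) \<odot> s) \<dots>"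
    by (rule canonical_Comp canonical_Tensor canonical_Inverse canonical_Assoc canonical_Ident assms | simp)+
  finally show ?thesis by simp
qed

lemma canonical_Braid_Empty:
  assumes [simp]: "objs (wires s)"
  shows "canonical (s \<odot> Empty) (Empty \<odot> s) (Braid C (obj s) (MUnit C))"
proof -
  have "Inverse C (Lunit C (obj s)) \<cdot> Runit C (obj s) = Braid C (obj s) (MUnit C)"
    by (simp add: Lunit_Braid[symmetric])
  moreover have "canonical (s \<odot> Empty) (Empty \<odot> s) (Inverse C (Lunit C (obj s)) \<cdot> Runit C (obj s))"
    by (rule canonical_Comp canonical_Runit canonical_Lunit canonical_Inverse | simp)+
  ultimately show ?thesis by simp
qed

lemma canonical_Braid_sym:
  "canonical (s \<odot> t) (t \<odot> s) (Braid C (obj s) (obj t)) \<Longrightarrow>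
   canonical (t \<odot> s) (s \<odot> t) (Braid C (obj t) (obj s))"
  using canonical_Inverse[of "s \<odot> t" "t \<odot> s" "Braid C (obj s) (obj t)"]
    canonicalD(5)[of "s \<odot> t" "t \<odot> s" "Braid C (obj s) (obj t)"] by simp

text \<open>
  By the hexagon and the symmetry of the braiding, the claim reduces to two single wires. There the
  labels have to differ, since \<open>permute\<close> does not exchange equal labels.
\<close>

lemma canonical_Braid:
  assumes "objs (wires s)" "objs (wires t)" "set (wires s) \<inter> set (wires t) = {}"
  shows "canonical (s \<odot> t) (t \<odot> s) (Braid C (obj s) (obj t))"
proof -
  have wire: "canonical (Wire n X \<odot> t) (t \<odot> Wire n X) (Braid C X (obj t))"
    if "X \<in> Obj C" "objs (wires t)" "(n, X) \<notin> set (wires t)" for n X t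
    using that
  proof (induction t)
    case (Wire k Y)
    then have "comb (Wire k Y \<odot> Wire n X) R \<cdot> (Braid C X Y \<otimes> \<one> R) =
      permute [(n, X), (k, Y)] [(k, Y), (n, X)] R \<cdot> comb (Wire n X \<odot> Wire k Y) R" if "R \<in> Obj C" for R
      using that by (auto simp: swap_left_def)
    then show ?case using Wire by (simp add: canonical_def add_mset_commute)
  next
    case Empty
    then show ?case using canonical_Braid_Empty[of "Wire n X"] by simp
  next
    case (Join t u)
    then show ?case using canonical_Braid_Join[of "Wire n X" t u] by simp
  qed
  show ?thesis
    using assms
  proof (induction s)
    case (Wire n X)
    then show ?case using wire by simp
  next
    case Empty
    then show ?case using canonical_Braid_sym[of t Empty] canonical_Braid_Empty[of t] by simp
  next
    case (Join s u)
    then have "canonical (t \<odot> s) (s \<odot> t) (Braid C (obj t) (obj s))"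
      "canonical (t \<odot> u) (u \<odot> t) (Braid C (obj t) (obj u))"
      by (auto intro: canonical_Braid_sym)
    then have "canonical (t \<odot> (s \<odot> u)) ((s \<odot> u) \<odot> t) (Braid C (obj t) (obj (s \<odot> u)))"
      by (rule canonical_Braid_Join)
    then show ?case by (rule canonical_Braid_sym)
  qed
qed

definition connected :: "'o cable \<Rightarrow> 'o cable \<Rightarrow> bool" where
  "connected s t \<longleftrightarrow> (\<exists>m. canonical s t m)"

lemma connected_refl: "objs (wires s) \<Longrightarrow> connected s s"
  unfolding connected_def using canonical_Ident by blast

lemma connected_sym: "connected s t \<Longrightarrow> connected t s"
  unfolding connected_def using canonical_Inverse by blast

lemma connected_trans [trans]: "connected s t \<Longrightarrow> connected t u \<Longrightarrow> connected s u"
  unfolding connected_def using canonical_Comp by blast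

lemma connected_Join: "connected s t \<Longrightarrow> connected s' t' \<Longrightarrow> connected (s \<odot> s') (t \<odot> t')"
  unfolding connected_def using canonical_Tensor by blast

lemma connected_Assoc:
  "objs (wires a) \<Longrightarrow> objs (wires b) \<Longrightarrow> objs (wires c) \<Longrightarrow> connected ((a \<odot> b) \<odot> c) (a \<odot> (b \<odot> c))"
  unfolding connected_def using canonical_Assoc by blast

text \<open>
  The normal form of a cable, used to show that cables with the same labels are related by some
  canonical arrow.
\<close>

primrec row :: "(nat \<times> 'o) list \<Rightarrow> 'o cable" where
  "row [] = Empty"
| "row (x # xs) = Wire (fst x) (snd x) \<odot> row xs"

lemma wires_row [simp]: "wires (row xs) = xs"
  by (induction xs) auto

lemma connected_row_append:
  "objs xs \<Longrightarrow> objs ys \<Longrightarrow> connected (row xs \<odot> row ys) (row (xs @ ys))"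
proof (induction xs)
  case Nil
  then show ?case using canonical_Lunit[of "row ys"] by (auto simp: connected_def)
next
  case (Cons x xs)
  then have "connected ((Wire (fst x) (snd x) \<odot> row xs) \<odot> row ys) (Wire (fst x) (snd x) \<odot> (row xs \<odot> row ys))"
    by (intro connected_Assoc) auto
  also have "connected \<dots> (Wire (fst x) (snd x) \<odot> row (xs @ ys))"
    using Cons by (intro connected_Join connected_refl) auto
  finally show ?case by simp
qed

lemma connected_row: "objs (wires t) \<Longrightarrow> connected t (row (wires t))"
proof (induction t)
  case (Wire n X)
  then show ?case
    using canonical_Inverse[OF canonical_Runit[of "Wire n X"]] by (auto simp: connected_def)
next
  case Empty
  then show ?case by (simp add: connected_refl)
next
  case (Join s t)
  then have "connected (s \<odot> t) (row (wires s) \<odot> row (wires t))"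
    by (intro connected_Join) auto
  also have "connected \<dots> (row (wires (s \<odot> t)))"
    using Join.prems by (simp add: connected_row_append)
  finally show ?case .
qed

lemma connected_pull_front:
  assumes "objs xs" "y \<in> set xs" "distinct xs"
  shows "connected (row xs) (Wire (fst y) (snd y) \<odot> row (remove1 y xs))"
  using assms
proof (induction xs)
  case (Cons x xs)
  let ?w = "\<lambda>x. Wire (fst x) (snd x)"
  show ?case
  proof (cases "x = y")
    case True
    then show ?thesis using Cons.prems by (simp add: connected_refl)
  next
    case False
    then have y: "y \<in> set xs" and o: "objs xs" "snd x \<in> Obj C" "snd y \<in> Obj C"
      using Cons.prems objs_mem[of y xs] by auto
    have "connected (?w x \<odot> row xs) (?w x \<odot> (?w y \<odot> row (remove1 y xs)))"
      using Cons y by (intro connected_Join connected_refl) auto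
    also have "connected \<dots> ((?w x \<odot> ?w y) \<odot> row (remove1 y xs))"
      using o by (intro connected_sym[OF connected_Assoc]) auto
    also have "connected \<dots> ((?w y \<odot> ?w x) \<odot> row (remove1 y xs))"
    proof (rule connected_Join)
      show "connected (?w x \<odot> ?w y) (?w y \<odot> ?w x)"
        using o False canonical_Braid[of "?w x" "?w y"] by (auto simp: connected_def prod_eq_iff)
    qed (use o in \<open>simp add: connected_refl\<close>)
    also have "connected \<dots> (?w y \<odot> (?w x \<odot> row (remove1 y xs)))"
      using o by (intro connected_Assoc) auto
    finally show ?thesis using False by simp
  qed
qed simp

lemma connected_permute:
  assumes "mset xs = mset ys" "distinct xs" "objs xs"
  shows "connected (row xs) (row ys)"
  using assms
proof (induction ys arbitrary: xs)
  case (Cons y ys)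
  have *: "y \<in> set xs" "mset (remove1 y xs) = mset ys"
    using mset_eq_ConsD[OF Cons.prems(1)] by auto
  then have "snd y \<in> Obj C" using Cons.prems objs_mem[of y xs] by auto
  have "connected (row xs) (Wire (fst y) (snd y) \<odot> row (remove1 y xs))"
    using Cons.prems * by (intro connected_pull_front) auto
  also have "connected \<dots> (Wire (fst y) (snd y) \<odot> row ys)"
    using Cons * \<open>snd y \<in> Obj C\<close> by (intro connected_Join connected_refl) auto
  finally show ?case by simp
qed (simp add: connected_refl)

text \<open>
  Distinct labels make the permutation between two cables with the same wires unique, and thus equality
  of the sets of wires the only condition for a canonical arrow between valid cables.
\<close>

definition valid :: "'o cable \<Rightarrow> bool" where
  "valid t \<longleftrightarrow> distinct (wires t) \<and> objs (wires t)"

definition can :: "'o cable \<Rightarrow> 'o cable \<Rightarrow> 'm" where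
  "can s t = (THE m. canonical s t m)"

lemma canonical_eq_can: "canonical s t m \<Longrightarrow> can s t = m"
  unfolding can_def by (rule the_equality) (auto intro: canonical_unique)

lemma canonical_can:
  assumes "valid s" "valid t" "set (wires s) = set (wires t)"
  shows "canonical s t (can s t)"
proof -
  have m: "mset (wires s) = mset (wires t)"
    using assms by (simp add: valid_def set_eq_iff_mset_eq_distinct[symmetric])
  have "connected s (row (wires s))" using assms by (intro connected_row) (simp add: valid_def)
  also have "connected \<dots> (row (wires t))" using assms m by (intro connected_permute) (auto simp: valid_def)
  also have "connected \<dots> t" using assms by (intro connected_sym[OF connected_row]) (simp add: valid_def)
  finally show ?thesis unfolding connected_def using canonical_eq_can by metis
qed

lemma valid_simps [simp]:
  "valid (Wire n X) \<longleftrightarrow> X \<in> Obj C" "valid Empty"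
  "valid (s \<odot> t) \<longleftrightarrow> valid s \<and> valid t \<and> set (wires s) \<inter> set (wires t) = {}"
  by (auto simp: valid_def)

lemma valid_objs [simp]: "valid s \<Longrightarrow> objs (wires s)"
  by (simp add: valid_def)

lemma can_simps [simp]:
  assumes "valid s" "valid t" "set (wires s) = set (wires t)"
  shows "can s t \<in> Arr C" "Dom C (can s t) = obj s" "Cod C (can s t) = obj t" "iso C (can s t)"
    "Inverse C (can s t) = can t s"
  using canonicalD[OF canonical_can[OF assms]]
    canonical_eq_can[OF canonical_Inverse[OF canonical_can[OF assms]]] by auto

lemma can_Ident: "valid s \<Longrightarrow> can s s = \<one> (obj s)"
  by (intro canonical_eq_can canonical_Ident) simp

lemma can_Comp:
  assumes "valid s" "valid t" "valid u" "set (wires s) = set (wires t)" "set (wires t) = set (wires u)"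
  shows "can t u \<cdot> can s t = can s u"
  using assms by (intro canonical_eq_can[symmetric] canonical_Comp[OF canonical_can[of s t] canonical_can])

lemma can_Comp_prefix:
  assumes "valid s" "valid t" "valid u" "set (wires s) = set (wires t)" "set (wires t) = set (wires u)"
    "k \<in> Arr C" "Cod C k = obj s"
  shows "can t u \<cdot> can s t \<cdot> k = can s u \<cdot> k"
  using assms by (intro Comp_prefix can_Comp) auto

lemma can_Tensor:
  assumes "valid s" "valid t" "valid s'" "valid t'" "set (wires s) = set (wires t)" "set (wires s') = set (wires t')"
  shows "can s t \<otimes> can s' t' = can (s \<odot> s') (t \<odot> t')"
  using assms by (intro canonical_eq_can[symmetric] canonical_Tensor canonical_can)

end

section \<open>Networks in a traced category\<close>

context symmetric_monoidal_category
begin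

lemma canonical_identI: "obj s = A \<Longrightarrow> objs (wires s) \<Longrightarrow> canonical s s (\<one> A)"
  using canonical_Ident by blast

lemma canonical_assocI:
  "obj a = A \<Longrightarrow> obj b = B \<Longrightarrow> obj c = D \<Longrightarrow> objs (wires a) \<Longrightarrow> objs (wires b) \<Longrightarrow> objs (wires c) \<Longrightarrow>
   canonical ((a \<odot> b) \<odot> c) (a \<odot> (b \<odot> c)) (Assoc C A B D)"
  using canonical_Assoc by blast

lemma canonical_lunitI: "obj a = A \<Longrightarrow> objs (wires a) \<Longrightarrow> canonical (Empty \<odot> a) a (Lunit C A)"
  using canonical_Lunit by blast

lemma canonical_runitI: "obj a = A \<Longrightarrow> objs (wires a) \<Longrightarrow> canonical (a \<odot> Empty) a (Runit C A)"
  using canonical_Runit by blast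

lemma canonical_braidI:
  "obj s = A \<Longrightarrow> obj t = B \<Longrightarrow> objs (wires s) \<Longrightarrow> objs (wires t) \<Longrightarrow> set (wires s) \<inter> set (wires t) = {} \<Longrightarrow>
   canonical (s \<odot> t) (t \<odot> s) (Braid C A B)"
  using canonical_Braid by blast

text \<open>
  Used as introduction rules, these derive that a given expression is canonical. They work through the
  expression from the right; the cable at the source of each factor then determines the one at its target.
\<close>

lemmas canonicalI = canonical_Comp canonical_Tensor canonical_Inverse canonical_identI
  canonical_assocI canonical_lunitI canonical_runitI canonical_braidI canonical_can

text \<open>
  The transposition of the last two factors of \<open>(X \<boxtimes> Y) \<boxtimes> Z\<close>. Traces are taken over the last factor, so
  this is the form in which crossings with a traced wire occur.
\<close>

definition swap_right :: "'o \<Rightarrow> 'o \<Rightarrow> 'o \<Rightarrow> 'm" where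
  "swap_right X Y Z = Inverse C (Assoc C X Z Y) \<cdot> (\<one> X \<otimes> Braid C Y Z) \<cdot> Assoc C X Y Z"

lemma swap_right_simps [simp]:
  assumes "X \<in> Obj C" "Y \<in> Obj C" "Z \<in> Obj C"
  shows "swap_right X Y Z \<in> Arr C" "Dom C (swap_right X Y Z) = (X \<boxtimes> Y) \<boxtimes> Z" "Cod C (swap_right X Y Z) = (X \<boxtimes> Z) \<boxtimes> Y"
  using assms by (simp_all add: swap_right_def)

lemma swap_right_nat:
  assumes "f \<in> Arr C" "g \<in> Arr C" "h \<in> Arr C" "Cod C f = X" "Cod C g = Y" "Cod C h = Z"
  shows "swap_right X Y Z \<cdot> ((f \<otimes> g) \<otimes> h) = ((f \<otimes> h) \<otimes> g) \<cdot> swap_right (Dom C f) (Dom C g) (Dom C h)"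
proof -
  have [simp]: "X \<in> Obj C" "Y \<in> Obj C" "Z \<in> Obj C" using assms by auto
  have "swap_right X Y Z \<cdot> ((f \<otimes> g) \<otimes> h) =
    Inverse C (Assoc C X Z Y) \<cdot> (\<one> X \<otimes> Braid C Y Z) \<cdot> (f \<otimes> g \<otimes> h) \<cdot> Assoc C (Dom C f) (Dom C g) (Dom C h)"
    using assms by (simp add: swap_right_def Assoc_nat)
  also have "\<dots> = Inverse C (Assoc C X Z Y) \<cdot> (f \<otimes> h \<otimes> g) \<cdot> (\<one> (Dom C f) \<otimes> Braid C (Dom C g) (Dom C h)) \<cdot>
      Assoc C (Dom C f) (Dom C g) (Dom C h)"
    using assms by (simp add: Tensor_merge Braid_nat)
  also have "\<dots> = ((f \<otimes> h) \<otimes> g) \<cdot> swap_right (Dom C f) (Dom C g) (Dom C h)"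
    using assms by (simp add: swap_right_def Assoc_inv_nat_prefix)
  finally show ?thesis .
qed

lemma canonical_swap_rightI:
  assumes "obj x = X" "obj y = Y" "obj z = Z" "valid ((x \<odot> y) \<odot> z)"
  shows "canonical ((x \<odot> y) \<odot> z) ((x \<odot> z) \<odot> y) (swap_right X Y Z)"
  unfolding swap_right_def by (rule canonicalI assms | use assms in force)+

end

context traced_category
begin

lemma Trace_simps [simp]:
  assumes "k \<in> Arr T" "A \<in> Obj T" "B \<in> Obj T" "U \<in> Obj T" "Dom T k = A \<boxtimes> U" "Cod T k = B \<boxtimes> U"
  shows "Trace T U A B k \<in> Arr T" "Dom T (Trace T U A B k) = A" "Cod T (Trace T U A B k) = B"
  using Trace_Hom[of A B U k] assms by (simp_all add: Hom_iff)

lemma Trace_nat: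
  assumes "f \<in> Arr T" "g \<in> Arr T" "k \<in> Arr T" "U \<in> Obj T"
    "Dom T k = Cod T f \<boxtimes> U" "Cod T k = Dom T g \<boxtimes> U"
  shows "Trace T U (Dom T f) (Cod T g) ((g \<otimes> \<one> U) \<cdot> k \<cdot> (f \<otimes> \<one> U)) =
    g \<cdot> Trace T U (Cod T f) (Dom T g) k \<cdot> f"
  using naturality[of "Cod T f" "Dom T g" "Dom T f" "Cod T g" U f g k] assms by (simp add: Hom_iff)

text \<open>
  Yanking next to an idle wire, by superposing.
\<close>

lemma Trace_swap_right:
  assumes [simp]: "E \<in> Obj T" "V \<in> Obj T"
  shows "Trace T V (E \<boxtimes> V) (E \<boxtimes> V) (swap_right E V V) = \<one> (E \<boxtimes> V)"
  using superposing[of V V E E V "\<one> E" "Braid T V V"] by (simp add: swap_right_def yanking Hom_iff)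

text \<open>
  A wire \<open>B\<close> that goes through the feedback loop once can be pulled straight. Since the object \<open>B\<close> occurs
  on two wires, coherence is applied with different labels for the two; it factors the traced arrow
  through a single crossing of the loop with the wire \<open>B\<close>.
\<close>

lemma Trace_crossing:
  assumes [simp]: "X \<in> Obj T" "A \<in> Obj T" "B \<in> Obj T"
  shows "Trace T B (X \<boxtimes> B \<boxtimes> A) ((X \<boxtimes> B) \<boxtimes> A)
      ((Inverse T (Assoc T (X \<boxtimes> B) A B) \<cdot> (\<one> (X \<boxtimes> B) \<otimes> Braid T B A)) \<cdot> swap_right X (B \<boxtimes> A) B) =
    Inverse T (Assoc T X B A)"
proof -
  let ?x = "Wire 0 X" and ?b = "Wire 1 B" and ?b' = "Wire 2 B" and ?a = "Wire 3 A"
  let ?in = "Inverse T (Assoc T X A B) \<cdot> (\<one> X \<otimes> Braid T B A)"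
  have 2: "swap_right X A B \<cdot> \<one> ((X \<boxtimes> A) \<boxtimes> B) \<cdot> ?in = Inverse T (Assoc T X B A)"
    by (rule canonical_unique[of "?x \<odot> (?b \<odot> ?a)" "(?x \<odot> ?b) \<odot> ?a"])
      (rule canonicalI canonical_swap_rightI | simp)+
  have "(Inverse T (Assoc T (X \<boxtimes> B) A B) \<cdot> (\<one> (X \<boxtimes> B) \<otimes> Braid T B A)) \<cdot> swap_right X (B \<boxtimes> A) B =
    (swap_right X A B \<otimes> \<one> B) \<cdot> swap_right (X \<boxtimes> A) B B \<cdot> (?in \<otimes> \<one> B)"
    by (rule canonical_unique[of "(?x \<odot> (?b \<odot> ?a)) \<odot> ?b'" "((?x \<odot> ?b') \<odot> ?a) \<odot> ?b"])
      (rule canonicalI canonical_swap_rightI | simp)+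
  then have "Trace T B (X \<boxtimes> B \<boxtimes> A) ((X \<boxtimes> B) \<boxtimes> A)
      ((Inverse T (Assoc T (X \<boxtimes> B) A B) \<cdot> (\<one> (X \<boxtimes> B) \<otimes> Braid T B A)) \<cdot> swap_right X (B \<boxtimes> A) B) =
    swap_right X A B \<cdot> Trace T B ((X \<boxtimes> A) \<boxtimes> B) ((X \<boxtimes> A) \<boxtimes> B) (swap_right (X \<boxtimes> A) B B) \<cdot> ?in"
    using Trace_nat[of ?in "swap_right X A B" "swap_right (X \<boxtimes> A) B B" B] by simp
  then show ?thesis
    by (simp only: Trace_swap_right TensorO_Obj assms 2)
qed

text \<open>
  A network has boxes \<open>F\<close> with input wires \<open>s\<close> and output wires \<open>r\<close>; the wires of \<open>u\<close> are fed back from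
  the outputs to the inputs, and \<open>a\<close> and \<open>b\<close> are the external inputs and outputs.
\<close>

definition network :: "'o cable \<Rightarrow> 'o cable \<Rightarrow> 'o cable \<Rightarrow> 'o cable \<Rightarrow> 'o cable \<Rightarrow> 'm \<Rightarrow> bool" where
  "network a b u s r F \<longleftrightarrow> valid (a \<odot> u) \<and> valid (b \<odot> u) \<and> valid s \<and> valid r \<and>
     set (wires (a \<odot> u)) = set (wires s) \<and> set (wires (b \<odot> u)) = set (wires r) \<and>
     F \<in> Arr T \<and> Dom T F = obj s \<and> Cod T F = obj r"

definition net :: "'o cable \<Rightarrow> 'o cable \<Rightarrow> 'o cable \<Rightarrow> 'o cable \<Rightarrow> 'o cable \<Rightarrow> 'm \<Rightarrow> 'm" where
  "net a b u s r F = Trace T (obj u) (obj a) (obj b) (can r (b \<odot> u) \<cdot> F \<cdot> can (a \<odot> u) s)"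

lemma networkD:
  assumes "network a b u s r F"
  shows "valid a" "valid b" "valid u" "valid s" "valid r"
    "set (wires a) \<inter> set (wires u) = {}" "set (wires b) \<inter> set (wires u) = {}"
    "set (wires s) = set (wires a) \<union> set (wires u)" "set (wires r) = set (wires b) \<union> set (wires u)"
    "F \<in> Arr T" "Dom T F = obj s" "Cod T F = obj r"
  using assms by (auto simp: network_def)

lemma network_simps [simp]:
  assumes "network a b u s r F"
  shows "net a b u s r F \<in> Arr T" "Dom T (net a b u s r F) = obj a" "Cod T (net a b u s r F) = obj b"
  using networkD[OF assms] by (simp_all add: net_def)

text \<open>
  Feedback wires may be reordered by dinaturality, with the permutation as sliding arrow. A
  rearrangement of the boxes is absorbed by the canonical arrows around them.
\<close>

lemma net_cong:
  assumes "network a b u s r F" "network a b u' s' r' F'"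
    and [simp]: "set (wires u) = set (wires u')"
    and eq: "can r r' \<cdot> F = F' \<cdot> can s s'"
  shows "net a b u s r F = net a b u' s' r' F'"
proof -
  note [simp] = networkD[OF assms(1)] networkD[OF assms(2)]
  \<comment> \<open>The loop is cut at \<open>?h\<close>: the two networks are the traces of \<open>?k\<close> with \<open>?h\<close> on either side.\<close>
  let ?h = "can u u'" and ?k = "can r (b \<odot> u) \<cdot> F \<cdot> can (a \<odot> u') s"
  have 1: "\<one> (obj b) \<otimes> ?h = can (b \<odot> u) (b \<odot> u')" "\<one> (obj a) \<otimes> ?h = can (a \<odot> u) (a \<odot> u')"
    using can_Tensor[of b b u u'] can_Tensor[of a a u u'] by (auto simp: can_Ident)
  have "(\<one> (obj b) \<otimes> ?h) \<cdot> ?k = can r (b \<odot> u') \<cdot> F \<cdot> can (a \<odot> u') s"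
    unfolding 1 by (rule can_Comp_prefix) auto
  also have "\<dots> = can r' (b \<odot> u') \<cdot> (can r r' \<cdot> F) \<cdot> can (a \<odot> u') s"
    by (simp add: can_Comp_prefix)
  also have "\<dots> = can r' (b \<odot> u') \<cdot> F' \<cdot> can (a \<odot> u') s'"
    unfolding eq by (simp add: can_Comp)
  finally have 2: "(\<one> (obj b) \<otimes> ?h) \<cdot> ?k = can r' (b \<odot> u') \<cdot> F' \<cdot> can (a \<odot> u') s'" .
  have 3: "?k \<cdot> (\<one> (obj a) \<otimes> ?h) = can r (b \<odot> u) \<cdot> F \<cdot> can (a \<odot> u) s"
    unfolding 1 by (simp add: can_Comp)
  show ?thesis
    using dinaturality[of "obj a" "obj b" "obj u" "obj u'" ?h ?k]
    unfolding net_def 2 3 by (simp add: Hom_iff)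
qed

lemma net_conj:
  assumes "network a b u s r F" "network a' b' u s r F"
    and [simp]: "set (wires a) = set (wires a')" "set (wires b) = set (wires b')"
  shows "can b b' \<cdot> net a b u s r F \<cdot> can a' a = net a' b' u s r F"
proof -
  note [simp] = networkD[OF assms(1)] networkD[OF assms(2)]
  have 1: "can b b' \<otimes> \<one> (obj u) = can (b \<odot> u) (b' \<odot> u)" "can a' a \<otimes> \<one> (obj u) = can (a' \<odot> u) (a \<odot> u)"
    using can_Tensor[of b b' u u] can_Tensor[of a' a u u] by (auto simp: can_Ident)
  have "(can b b' \<otimes> \<one> (obj u)) \<cdot> (can r (b \<odot> u) \<cdot> F \<cdot> can (a \<odot> u) s) \<cdot> (can a' a \<otimes> \<one> (obj u)) =
    can r (b' \<odot> u) \<cdot> F \<cdot> can (a' \<odot> u) s"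
    unfolding 1 by (simp add: can_Comp can_Comp_prefix)
  then show ?thesis
    using Trace_nat[of "can a' a" "can b b'" "can r (b \<odot> u) \<cdot> F \<cdot> can (a \<odot> u) s" "obj u"]
    by (simp add: net_def)
qed

text \<open>
  Superposing, up to canonical arrows.
\<close>

lemma net_Tensor_left:
  assumes "network a b u s r F" and [simp]: "h \<in> Arr T" "Dom T h = obj a'" "Cod T h = obj b'"
    and "valid (a' \<odot> s)" "valid (b' \<odot> r)"
  shows "h \<otimes> net a b u s r F = net (a' \<odot> a) (b' \<odot> b) u (a' \<odot> s) (b' \<odot> r) (h \<otimes> F)"
proof -
  note [simp] = networkD[OF assms(1)]
  have [simp]: "valid a'" "valid b'" "set (wires a') \<inter> set (wires s) = {}" "set (wires b') \<inter> set (wires r) = {}"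
    using assms(5,6) by auto
  have d: "set (wires a') \<inter> set (wires a) = {}" "set (wires a') \<inter> set (wires u) = {}"
    "set (wires b') \<inter> set (wires b) = {}" "set (wires b') \<inter> set (wires u) = {}"
    using assms(5,6) by auto
  note [simp] = d Int_Un_distrib Int_Un_distrib2
  let ?k = "can r (b \<odot> u) \<cdot> F \<cdot> can (a \<odot> u) s"
  have "h \<otimes> ?k = (\<one> (obj b') \<otimes> can r (b \<odot> u)) \<cdot> (h \<otimes> F) \<cdot> (\<one> (obj a') \<otimes> can (a \<odot> u) s)"
    by (simp add: Tensor_merge)
  also have "\<dots> = can (b' \<odot> r) (b' \<odot> (b \<odot> u)) \<cdot> (h \<otimes> F) \<cdot> can (a' \<odot> (a \<odot> u)) (a' \<odot> s)"
    using can_Tensor[of b' b' r "b \<odot> u"] can_Tensor[of a' a' "a \<odot> u" s] by (simp add: can_Ident)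
  finally have 1: "h \<otimes> ?k = \<dots>" .
  have a: "Assoc T (obj a') (obj a) (obj u) = can ((a' \<odot> a) \<odot> u) (a' \<odot> (a \<odot> u))"
    by (rule canonical_eq_can[symmetric], rule canonical_Assoc) auto
  have b: "Inverse T (Assoc T (obj b') (obj b) (obj u)) = can (b' \<odot> (b \<odot> u)) ((b' \<odot> b) \<odot> u)"
    by (rule canonical_eq_can[symmetric], rule canonical_Inverse, rule canonical_Assoc) auto
  have "Inverse T (Assoc T (obj b') (obj b) (obj u)) \<cdot> (h \<otimes> ?k) \<cdot> Assoc T (obj a') (obj a) (obj u) =
    can (b' \<odot> r) ((b' \<odot> b) \<odot> u) \<cdot> (h \<otimes> F) \<cdot> can ((a' \<odot> a) \<odot> u) (a' \<odot> s)"
    unfolding 1 a b by (simp add: can_Comp can_Comp_prefix Un_assoc)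
  then show ?thesis
    using superposing[of "obj a" "obj b" "obj a'" "obj b'" "obj u" h ?k] by (simp add: net_def Hom_iff)
qed

lemma network_Tensor_left:
  assumes "network a b u s r F" "h \<in> Arr T" "Dom T h = obj a'" "Cod T h = obj b'"
    "valid (a' \<odot> s)" "valid (b' \<odot> r)"
  shows "network (a' \<odot> a) (b' \<odot> b) u (a' \<odot> s) (b' \<odot> r) (h \<otimes> F)"
  using assms by (auto simp: network_def)

lemma network_Tensor_right:
  assumes "network a b u s r F" "h \<in> Arr T" "Dom T h = obj a'" "Cod T h = obj b'"
    "valid (s \<odot> a')" "valid (r \<odot> b')"
  shows "network (a \<odot> a') (b \<odot> b') u (s \<odot> a') (r \<odot> b') (F \<otimes> h)"
  using assms by (auto simp: network_def)

text \<open>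
  Obtained from the tensor product on the left by conjugation with braidings, which \<open>net_conj\<close> and
  \<open>net_cong\<close> absorb.
\<close>

lemma net_Tensor_right:
  assumes N: "network a b u s r F" and h [simp]: "h \<in> Arr T" "Dom T h = obj a'" "Cod T h = obj b'"
    and v: "valid (s \<odot> a')" "valid (r \<odot> b')"
  shows "net a b u s r F \<otimes> h = net (a \<odot> a') (b \<odot> b') u (s \<odot> a') (r \<odot> b') (F \<otimes> h)"
proof -
  note [simp] = networkD[OF N]
  have v': "valid (a' \<odot> s)" "valid (b' \<odot> r)" using v by auto
  note L = network_Tensor_left[OF N h v'] and R = network_Tensor_right[OF N h v]
  have O [simp]: "objs (wires a)" "objs (wires b)" "objs (wires a')" "objs (wires b')" "objs (wires s)" "objs (wires r)"
    using networkD(1,2)[OF N] v by (auto simp: valid_def)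
  have d: "set (wires s) \<inter> set (wires a') = {}" "set (wires r) \<inter> set (wires b') = {}"
    "set (wires a) \<inter> set (wires a') = {}" "set (wires b) \<inter> set (wires b') = {}"
    using v by auto
  have B: "can (b' \<odot> b) (b \<odot> b') = Braid T (obj b') (obj b)" "can (a \<odot> a') (a' \<odot> a) = Braid T (obj a) (obj a')"
    "can (b' \<odot> r) (r \<odot> b') = Braid T (obj b') (obj r)" "can (a' \<odot> s) (s \<odot> a') = Braid T (obj a') (obj s)"
    using d by (auto intro!: canonical_eq_can canonical_Braid)
  have "net a b u s r F \<otimes> h = Braid T (obj b') (obj b) \<cdot> (h \<otimes> net a b u s r F) \<cdot> Braid T (obj a) (obj a')"
    using N Braid_nat_prefix[of h "net a b u s r F" "obj b'" "obj b" "Braid T (obj a) (obj a')"]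
    by simp
  also have "\<dots> = can (b' \<odot> b) (b \<odot> b') \<cdot> net (a' \<odot> a) (b' \<odot> b) u (a' \<odot> s) (b' \<odot> r) (h \<otimes> F) \<cdot> can (a \<odot> a') (a' \<odot> a)"
    using net_Tensor_left[OF N h v'] B by simp
  also have "\<dots> = net (a \<odot> a') (b \<odot> b') u (a' \<odot> s) (b' \<odot> r) (h \<otimes> F)"
    by (rule net_conj[OF L]) (use L in \<open>auto simp: network_def\<close>)
  also have "\<dots> = net (a \<odot> a') (b \<odot> b') u (s \<odot> a') (r \<odot> b') (F \<otimes> h)"
    by (rule net_cong[OF _ R]) (use L B in \<open>auto simp: network_def Braid_nat\<close>)
  finally show ?thesis .
qed

lemma network_nest:
  assumes "network s r v p q F" "valid (a \<odot> u)" "valid (b \<odot> u)"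
    "set (wires a) \<union> set (wires u) = set (wires s)" "set (wires b) \<union> set (wires u) = set (wires r)"
  shows "network a b (u \<odot> v) p q F" "network (a \<odot> u) (b \<odot> u) v p q F"
proof -
  have d: "valid a" "valid b" "valid u" "set (wires a) \<inter> set (wires u) = {}" "set (wires b) \<inter> set (wires u) = {}"
    "set (wires a) \<inter> set (wires v) = {}" "set (wires b) \<inter> set (wires v) = {}" "set (wires u) \<inter> set (wires v) = {}"
    using assms(2-5) networkD(6,7)[OF assms(1)] by auto
  note [simp] = networkD[OF assms(1)]
  show "network a b (u \<odot> v) p q F" "network (a \<odot> u) (b \<odot> u) v p q F"
    using d assms(4,5) by (simp_all add: network_def Int_Un_distrib Int_Un_distrib2 Un_assoc[symmetric])
qed

text \<open>
  A network used as a box of another network: the inner feedback wires join the outer ones. The canonical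
  arrows around the inner network enter its trace by naturality, and the two traces merge by monoidality.
\<close>

lemma net_nest:
  assumes N: "network s r v p q F" and v: "valid (a \<odot> u)" "valid (b \<odot> u)"
    and w: "set (wires a) \<union> set (wires u) = set (wires s)" "set (wires b) \<union> set (wires u) = set (wires r)"
  shows "net a b u s r (net s r v p q F) = net a b (u \<odot> v) p q F"
proof -
  note M = network_nest[OF N v w]
  note [simp] = networkD[OF N] networkD[OF M(1)]
  let ?k = "can q (b \<odot> u \<odot> v) \<cdot> F \<cdot> can (a \<odot> u \<odot> v) p"
  have a: "Assoc T (obj a) (obj u) (obj v) = can ((a \<odot> u) \<odot> v) (a \<odot> (u \<odot> v))"
    using networkD[OF M(1)] by (intro canonical_eq_can[symmetric] canonical_Assoc) auto
  have b: "Inverse T (Assoc T (obj b) (obj u) (obj v)) = can (b \<odot> (u \<odot> v)) ((b \<odot> u) \<odot> v)"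
    using networkD[OF M(1)] by (intro canonical_eq_can[symmetric] canonical_Inverse canonical_Assoc) auto
  have k: "Inverse T (Assoc T (obj b) (obj u) (obj v)) \<cdot> ?k \<cdot> Assoc T (obj a) (obj u) (obj v) =
    can q ((b \<odot> u) \<odot> v) \<cdot> F \<cdot> can ((a \<odot> u) \<odot> v) p"
    using networkD[OF M(1)] networkD[OF M(2)] unfolding a b by (simp add: can_Comp can_Comp_prefix Un_assoc)
  have "net a b u s r (net s r v p q F) =
    Trace T (obj u) (obj a) (obj b) (net (a \<odot> u) (b \<odot> u) v p q F)"
    using net_conj[OF N M(2)] w by (simp add: net_def[of a])
  also have "\<dots> = net a b (u \<odot> v) p q F"
    using monoidality_tensor[of "obj a" "obj b" "obj u" "obj v" ?k] networkD[OF M(1)]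
    unfolding k by (simp add: net_def Hom_iff)
  finally show ?thesis .
qed

end

section \<open>The composition of the Int construction\<close>

context traced_category
begin

text \<open>
  The arrow that underlies a composite of Int arrows.
\<close>

definition icomp :: "'o \<Rightarrow> 'o \<Rightarrow> 'o \<Rightarrow> 'o \<Rightarrow> 'o \<Rightarrow> 'o \<Rightarrow> 'm \<Rightarrow> 'm \<Rightarrow> 'm" where
  "icomp Am Ap Bm Bp Cm Cp g f = Trace T Bm (Cm \<boxtimes> Ap) (Cp \<boxtimes> Am)
     (swap_right Cp Bm Am \<cdot> (g \<otimes> \<one> Am) \<cdot> Inverse T (Assoc T Cm Bp Am) \<cdot> (\<one> Cm \<otimes> f) \<cdot>
      ((\<one> Cm \<otimes> Braid T Ap Bm) \<cdot> Assoc T Cm Ap Bm))"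

lemma int_comp_icomp:
  "int_comp T (B', (Cm, Cp), g) ((Am, Ap), (Bm, Bp), f) =
     ((Am, Ap), (Cm, Cp), icomp Am Ap Bm Bp Cm Cp g f)"
  by (simp add: icomp_def swap_right_def)

lemma icomp_simps [simp]:
  assumes "Am \<in> Obj T" "Ap \<in> Obj T" "Bm \<in> Obj T" "Bp \<in> Obj T" "Cm \<in> Obj T" "Cp \<in> Obj T"
    and "f \<in> Arr T" "Dom T f = Bm \<boxtimes> Ap" "Cod T f = Bp \<boxtimes> Am"
    and "g \<in> Arr T" "Dom T g = Cm \<boxtimes> Bp" "Cod T g = Cp \<boxtimes> Bm"
  shows "icomp Am Ap Bm Bp Cm Cp g f \<in> Arr T"
    "Dom T (icomp Am Ap Bm Bp Cm Cp g f) = Cm \<boxtimes> Ap" "Cod T (icomp Am Ap Bm Bp Cm Cp g f) = Cp \<boxtimes> Am"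
  using assms by (simp_all add: icomp_def)

lemma interchange_swap_left:
  "interchange T X Y Z W = Inverse T (Assoc T X Z (Y \<boxtimes> W)) \<cdot> (\<one> X \<otimes> swap_left Y Z W) \<cdot> Assoc T X Y (Z \<boxtimes> W)"
  by (simp add: interchange_def swap_left_def)

lemma interchange_simps [simp]:
  assumes "X \<in> Obj T" "Y \<in> Obj T" "Z \<in> Obj T" "W \<in> Obj T"
  shows "interchange T X Y Z W \<in> Arr T"
    "Dom T (interchange T X Y Z W) = (X \<boxtimes> Y) \<boxtimes> (Z \<boxtimes> W)"
    "Cod T (interchange T X Y Z W) = (X \<boxtimes> Z) \<boxtimes> (Y \<boxtimes> W)"
  using assms by (simp_all add: interchange_swap_left)

lemma interchange_nat:
  assumes "f \<in> Arr T" "g \<in> Arr T" "h \<in> Arr T" "k \<in> Arr T"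
    "Cod T f = X" "Cod T g = Y" "Cod T h = Z" "Cod T k = W"
  shows "interchange T X Y Z W \<cdot> ((f \<otimes> g) \<otimes> (h \<otimes> k)) =
    ((f \<otimes> h) \<otimes> (g \<otimes> k)) \<cdot> interchange T (Dom T f) (Dom T g) (Dom T h) (Dom T k)"
proof -
  have [simp]: "X \<in> Obj T" "Y \<in> Obj T" "Z \<in> Obj T" "W \<in> Obj T" using assms by auto
  have "interchange T X Y Z W \<cdot> ((f \<otimes> g) \<otimes> (h \<otimes> k)) =
    Inverse T (Assoc T X Z (Y \<boxtimes> W)) \<cdot> (\<one> X \<otimes> swap_left Y Z W) \<cdot> (f \<otimes> (g \<otimes> (h \<otimes> k))) \<cdot>
    Assoc T (Dom T f) (Dom T g) (Dom T h \<boxtimes> Dom T k)"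
    using assms by (simp add: interchange_swap_left Assoc_nat)
  also have "\<dots> = Inverse T (Assoc T X Z (Y \<boxtimes> W)) \<cdot> (f \<otimes> (h \<otimes> (g \<otimes> k))) \<cdot>
      (\<one> (Dom T f) \<otimes> swap_left (Dom T g) (Dom T h) (Dom T k)) \<cdot> Assoc T (Dom T f) (Dom T g) (Dom T h \<boxtimes> Dom T k)"
    using assms by (simp add: Tensor_merge swap_left_nat)
  also have "\<dots> = ((f \<otimes> h) \<otimes> (g \<otimes> k)) \<cdot> interchange T (Dom T f) (Dom T g) (Dom T h) (Dom T k)"
    using assms by (simp add: interchange_swap_left Assoc_inv_nat_prefix)
  finally show ?thesis .
qed

lemma interchange_nat_prefix:
  "f \<in> Arr T \<Longrightarrow> g \<in> Arr T \<Longrightarrow> h \<in> Arr T \<Longrightarrow> k \<in> Arr T \<Longrightarrow>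
   Cod T f = X \<Longrightarrow> Cod T g = Y \<Longrightarrow> Cod T h = Z \<Longrightarrow> Cod T k = W \<Longrightarrow>
   l \<in> Arr T \<Longrightarrow> Cod T l = (Dom T f \<boxtimes> Dom T g) \<boxtimes> (Dom T h \<boxtimes> Dom T k) \<Longrightarrow>
   interchange T X Y Z W \<cdot> ((f \<otimes> g) \<otimes> (h \<otimes> k)) \<cdot> l =
    ((f \<otimes> h) \<otimes> (g \<otimes> k)) \<cdot> interchange T (Dom T f) (Dom T g) (Dom T h) (Dom T k) \<cdot> l"
  using Comp_prefix[OF interchange_nat] by auto

lemma canonical_interchangeI:
  assumes "obj x = X" "obj y = Y" "obj z = Z" "obj w = W" "valid ((x \<odot> y) \<odot> (z \<odot> w))"
  shows "canonical ((x \<odot> y) \<odot> (z \<odot> w)) ((x \<odot> z) \<odot> (y \<odot> w)) (interchange T X Y Z W)"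
  unfolding interchange_def by (rule canonicalI assms | use assms in force)+

lemmas canonicalI' = canonicalI canonical_swap_rightI canonical_interchangeI

text \<open>
  The composite treats \<open>f\<close> and \<open>g\<close> symmetrically: both boxes are placed side by side, and \<open>B\<^sup>+\<close>, which in the
  definition leads directly from \<open>f\<close> to \<open>g\<close>, is fed back in the same way as \<open>B\<^sup>-\<close>. The two traces of the
  network are taken one after the other; for the inner one, over \<open>B\<^sup>+\<close>, the boxes slide out of the trace by
  naturality, and \<open>Trace_crossing\<close> pulls the remaining wire straight.
\<close>

lemma icomp_net:
  fixes am ap bm bp cm cp
  assumes v: "valid ((am \<odot> ap) \<odot> (bm \<odot> bp) \<odot> (cm \<odot> cp))"
    and f: "f \<in> Arr T" "Dom T f = obj (bm \<odot> ap)" "Cod T f = obj (bp \<odot> am)"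
    and g: "g \<in> Arr T" "Dom T g = obj (cm \<odot> bp)" "Cod T g = obj (cp \<odot> bm)"
  shows "network (cm \<odot> ap) (cp \<odot> am) (bm \<odot> bp) ((cm \<odot> bp) \<odot> (bm \<odot> ap)) ((cp \<odot> bm) \<odot> (bp \<odot> am)) (g \<otimes> f)"
    and "icomp (obj am) (obj ap) (obj bm) (obj bp) (obj cm) (obj cp) g f =
      net (cm \<odot> ap) (cp \<odot> am) (bm \<odot> bp) ((cm \<odot> bp) \<odot> (bm \<odot> ap)) ((cp \<odot> bm) \<odot> (bp \<odot> am)) (g \<otimes> f)"
proof -
  have [simp]: "valid am" "valid ap" "valid bm" "valid bp" "valid cm" "valid cp"
    using v by auto
  show N: "network (cm \<odot> ap) (cp \<odot> am) (bm \<odot> bp) ((cm \<odot> bp) \<odot> (bm \<odot> ap)) ((cp \<odot> bm) \<odot> (bp \<odot> am)) (g \<otimes> f)"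
    using v f g by (auto simp: network_def)
  let ?Am = "obj am" and ?Ap = "obj ap" and ?Bm = "obj bm" and ?Bp = "obj bp"
    and ?Cm = "obj cm" and ?Cp = "obj cp"
  let ?s = "(cm \<odot> bp) \<odot> (bm \<odot> ap)" and ?r = "(cp \<odot> bm) \<odot> (bp \<odot> am)"
  let ?i = "(\<one> ?Cm \<otimes> Braid T ?Ap ?Bm) \<cdot> Assoc T ?Cm ?Ap ?Bm"
  \<comment> \<open>After the slide of the boxes out of the inner trace, \<open>?K1\<close> ends with \<open>f\<close>, \<open>?K2\<close> begins with \<open>g\<close>, and
      \<open>?M\<close> is the crossing between them.\<close>
  let ?Q = "\<lambda>Y. Inverse T (Assoc T Y ?Am ?Bp) \<cdot> (\<one> Y \<otimes> Braid T ?Bp ?Am)"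
  let ?k = "can ?r ((cp \<odot> am) \<odot> (bm \<odot> bp)) \<cdot> (g \<otimes> f) \<cdot> can ((cm \<odot> ap) \<odot> (bm \<odot> bp)) ?s"
  let ?K1 = "(\<one> ?Cm \<otimes> f) \<cdot> ?i" and ?K2 = "swap_right ?Cp ?Bm ?Am \<cdot> (g \<otimes> \<one> ?Am)"
  let ?M = "?Q (?Cm \<boxtimes> ?Bp) \<cdot> swap_right ?Cm (?Bp \<boxtimes> ?Am) ?Bp"
  note [simp] = f g networkD[OF N]
  have v1: "valid ((cm \<odot> ap) \<odot> (bm \<odot> bp))" "valid ?s" "valid ((cp \<odot> am) \<odot> (bm \<odot> bp))" "valid ?r"
    "set (wires ((cm \<odot> ap) \<odot> (bm \<odot> bp))) = set (wires ?s)"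
    "set (wires ?r) = set (wires ((cp \<odot> am) \<odot> (bm \<odot> bp)))"
    using v by auto
  note can_simps [OF v1(1,2,5), simp] can_simps[OF v1(4,3,6), simp]
  have 1: "can ((cm \<odot> ap) \<odot> (bm \<odot> bp)) ?s \<cdot> Assoc T (?Cm \<boxtimes> ?Ap) ?Bm ?Bp =
    swap_right ?Cm (?Bm \<boxtimes> ?Ap) ?Bp \<cdot> (?i \<otimes> \<one> ?Bp)"
    by (rule canonical_unique[of "((cm \<odot> ap) \<odot> bm) \<odot> bp" ?s])
      (rule canonicalI' v1 | simp | use v in force)+
  have 2: "Inverse T (Assoc T (?Cp \<boxtimes> ?Am) ?Bm ?Bp) \<cdot> can ?r ((cp \<odot> am) \<odot> (bm \<odot> bp)) =
    (swap_right ?Cp ?Bm ?Am \<otimes> \<one> ?Bp) \<cdot> ?Q (?Cp \<boxtimes> ?Bm)"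
    by (rule canonical_unique[of ?r "((cp \<odot> am) \<odot> bm) \<odot> bp"])
      (rule canonicalI' v1 | simp | use v in force)+
  have 3: "?Q (?Cp \<boxtimes> ?Bm) \<cdot> (g \<otimes> \<one> (?Bp \<boxtimes> ?Am)) = ((g \<otimes> \<one> ?Am) \<otimes> \<one> ?Bp) \<cdot> ?Q (?Cm \<boxtimes> ?Bp)"
    using Assoc_inv_nat_prefix[of g "\<one> ?Am" "\<one> ?Bp" "?Cp \<boxtimes> ?Bm" ?Am ?Bp "\<one> (?Cm \<boxtimes> ?Bp) \<otimes> Braid T ?Bp ?Am"]
    by (simp add: Tensor_merge)
  have 4: "(\<one> (?Cm \<boxtimes> ?Bp) \<otimes> f) \<cdot> swap_right ?Cm (?Bm \<boxtimes> ?Ap) ?Bp =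
    swap_right ?Cm (?Bp \<boxtimes> ?Am) ?Bp \<cdot> ((\<one> ?Cm \<otimes> f) \<otimes> \<one> ?Bp)"
    using swap_right_nat[of "\<one> ?Cm" f "\<one> ?Bp" ?Cm "?Bp \<boxtimes> ?Am" ?Bp] by simp
  have gf: "g \<otimes> f = (g \<otimes> \<one> (?Bp \<boxtimes> ?Am)) \<cdot> (\<one> (?Cm \<boxtimes> ?Bp) \<otimes> f)"
    by (simp add: Tensor_Comp)
  have "Inverse T (Assoc T (?Cp \<boxtimes> ?Am) ?Bm ?Bp) \<cdot> ?k \<cdot> Assoc T (?Cm \<boxtimes> ?Ap) ?Bm ?Bp =
    (Inverse T (Assoc T (?Cp \<boxtimes> ?Am) ?Bm ?Bp) \<cdot> can ?r ((cp \<odot> am) \<odot> (bm \<odot> bp))) \<cdot> (g \<otimes> f) \<cdot>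
    (can ((cm \<odot> ap) \<odot> (bm \<odot> bp)) ?s \<cdot> Assoc T (?Cm \<boxtimes> ?Ap) ?Bm ?Bp)"
    by simp
  also have "\<dots> = (swap_right ?Cp ?Bm ?Am \<otimes> \<one> ?Bp) \<cdot> (?Q (?Cp \<boxtimes> ?Bm) \<cdot> (g \<otimes> \<one> (?Bp \<boxtimes> ?Am))) \<cdot>
    ((\<one> (?Cm \<boxtimes> ?Bp) \<otimes> f) \<cdot> swap_right ?Cm (?Bm \<boxtimes> ?Ap) ?Bp) \<cdot> (?i \<otimes> \<one> ?Bp)"
    unfolding 1 2 gf by simp
  also have "\<dots> = (?K2 \<otimes> \<one> ?Bp) \<cdot> ?M \<cdot> (?K1 \<otimes> \<one> ?Bp)"
    unfolding 3 4 by (simp add: Tensor_merge)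
  finally have 5: "Inverse T (Assoc T (?Cp \<boxtimes> ?Am) ?Bm ?Bp) \<cdot> ?k \<cdot> Assoc T (?Cm \<boxtimes> ?Ap) ?Bm ?Bp =
    (?K2 \<otimes> \<one> ?Bp) \<cdot> ?M \<cdot> (?K1 \<otimes> \<one> ?Bp)" .
  have 6: "Trace T ?Bp ((?Cm \<boxtimes> ?Ap) \<boxtimes> ?Bm) ((?Cp \<boxtimes> ?Am) \<boxtimes> ?Bm) ((?K2 \<otimes> \<one> ?Bp) \<cdot> ?M \<cdot> (?K1 \<otimes> \<one> ?Bp)) =
    ?K2 \<cdot> Inverse T (Assoc T ?Cm ?Bp ?Am) \<cdot> ?K1"
    using Trace_nat[of ?K1 ?K2 ?M ?Bp] Trace_crossing[of ?Cm ?Am ?Bp] by simp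
  show "icomp ?Am ?Ap ?Bm ?Bp ?Cm ?Cp g f =
      net (cm \<odot> ap) (cp \<odot> am) (bm \<odot> bp) ((cm \<odot> bp) \<odot> (bm \<odot> ap)) ((cp \<odot> bm) \<odot> (bp \<odot> am)) (g \<otimes> f)"
    using monoidality_tensor[of "?Cm \<boxtimes> ?Ap" "?Cp \<boxtimes> ?Am" ?Bm ?Bp ?k]
    unfolding 5 6 by (simp add: net_def icomp_def Hom_iff)
qed

end

context traced_category
begin

text \<open>
  Both sides are the network with boxes \<open>f\<close>, \<open>g\<close>, \<open>h\<close> in which the wires of \<open>B\<close> and of \<open>C\<close> are fed back;
  they differ in the bracketing of the boxes and in the order of the feedback wires.
\<close>

lemma icomp_assoc:
  assumes [simp]: "Am \<in> Obj T" "Ap \<in> Obj T" "Bm \<in> Obj T" "Bp \<in> Obj T"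
      "Cm \<in> Obj T" "Cp \<in> Obj T" "Dm \<in> Obj T" "Dp \<in> Obj T"
    and f [simp]: "f \<in> Arr T" "Dom T f = Bm \<boxtimes> Ap" "Cod T f = Bp \<boxtimes> Am"
    and g [simp]: "g \<in> Arr T" "Dom T g = Cm \<boxtimes> Bp" "Cod T g = Cp \<boxtimes> Bm"
    and h [simp]: "h \<in> Arr T" "Dom T h = Dm \<boxtimes> Cp" "Cod T h = Dp \<boxtimes> Cm"
  shows "icomp Am Ap Bm Bp Dm Dp (icomp Bm Bp Cm Cp Dm Dp h g) f =
    icomp Am Ap Cm Cp Dm Dp h (icomp Am Ap Bm Bp Cm Cp g f)"
proof -
  let ?am = "Wire 2 Am" and ?ap = "Wire 3 Ap" and ?bm = "Wire 4 Bm" and ?bp = "Wire 5 Bp"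
    and ?cm = "Wire 6 Cm" and ?cp = "Wire 7 Cp" and ?dm = "Wire 8 Dm" and ?dp = "Wire 9 Dp"
  let ?a = "?dm \<odot> ?ap" and ?b = "?dp \<odot> ?am"
  let ?s = "(?cm \<odot> ?bp) \<odot> (?bm \<odot> ?ap)" and ?r = "(?cp \<odot> ?bm) \<odot> (?bp \<odot> ?am)"
  let ?s' = "(?dm \<odot> ?cp) \<odot> (?cm \<odot> ?bp)" and ?r' = "(?dp \<odot> ?cm) \<odot> (?cp \<odot> ?bm)"

  \<comment> \<open>The labels start at \<open>2\<close> because \<open>simplified\<close> would rewrite the label \<open>1\<close> to \<open>Suc 0\<close>.\<close>
  note gf = icomp_net[of ?am ?ap ?bm ?bp ?cm ?cp f g, simplified]
  note hg = icomp_net[of ?bm ?bp ?cm ?cp ?dm ?dp g h, simplified]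

  have 1: "h \<otimes> icomp Am Ap Bm Bp Cm Cp g f =
      net ((?dm \<odot> ?cp) \<odot> (?cm \<odot> ?ap)) ((?dp \<odot> ?cm) \<odot> (?cp \<odot> ?am)) (?bm \<odot> ?bp)
        ((?dm \<odot> ?cp) \<odot> ?s) ((?dp \<odot> ?cm) \<odot> ?r) (h \<otimes> g \<otimes> f)" (is "_ = ?n1")
    unfolding gf(2) by (rule net_Tensor_left[OF gf(1)]) auto
  have N1: "network ((?dm \<odot> ?cp) \<odot> (?cm \<odot> ?ap)) ((?dp \<odot> ?cm) \<odot> (?cp \<odot> ?am)) (?bm \<odot> ?bp)
        ((?dm \<odot> ?cp) \<odot> ?s) ((?dp \<odot> ?cm) \<odot> ?r) (h \<otimes> g \<otimes> f)"
    by (rule network_Tensor_left[OF gf(1)]) auto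
  have "icomp Am Ap Cm Cp Dm Dp h (icomp Am Ap Bm Bp Cm Cp g f) =
    net ?a ?b (?cm \<odot> ?cp) ((?dm \<odot> ?cp) \<odot> (?cm \<odot> ?ap)) ((?dp \<odot> ?cm) \<odot> (?cp \<odot> ?am)) ?n1"
    using icomp_net(2)[of ?am ?ap ?cm ?cp ?dm ?dp "icomp Am Ap Bm Bp Cm Cp g f" h] by (simp add: 1)
  also have "\<dots> = net ?a ?b ((?cm \<odot> ?cp) \<odot> (?bm \<odot> ?bp)) ((?dm \<odot> ?cp) \<odot> ?s) ((?dp \<odot> ?cm) \<odot> ?r) (h \<otimes> g \<otimes> f)"
    by (rule net_nest[OF N1]) auto
  finally have R: "icomp Am Ap Cm Cp Dm Dp h (icomp Am Ap Bm Bp Cm Cp g f) = \<dots>" .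
  have NR: "network ?a ?b ((?cm \<odot> ?cp) \<odot> (?bm \<odot> ?bp)) ((?dm \<odot> ?cp) \<odot> ?s) ((?dp \<odot> ?cm) \<odot> ?r) (h \<otimes> g \<otimes> f)"
    by (rule network_nest(1)[OF N1]) auto

  have 2: "icomp Bm Bp Cm Cp Dm Dp h g \<otimes> f =
      net ((?dm \<odot> ?bp) \<odot> (?bm \<odot> ?ap)) ((?dp \<odot> ?bm) \<odot> (?bp \<odot> ?am)) (?cm \<odot> ?cp)
        (?s' \<odot> (?bm \<odot> ?ap)) (?r' \<odot> (?bp \<odot> ?am)) ((h \<otimes> g) \<otimes> f)" (is "_ = ?n2")
    unfolding hg(2) by (rule net_Tensor_right[OF hg(1)]) auto
  have N2: "network ((?dm \<odot> ?bp) \<odot> (?bm \<odot> ?ap)) ((?dp \<odot> ?bm) \<odot> (?bp \<odot> ?am)) (?cm \<odot> ?cp)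
        (?s' \<odot> (?bm \<odot> ?ap)) (?r' \<odot> (?bp \<odot> ?am)) ((h \<otimes> g) \<otimes> f)"
    by (rule network_Tensor_right[OF hg(1)]) auto
  have "icomp Am Ap Bm Bp Dm Dp (icomp Bm Bp Cm Cp Dm Dp h g) f =
    net ?a ?b (?bm \<odot> ?bp) ((?dm \<odot> ?bp) \<odot> (?bm \<odot> ?ap)) ((?dp \<odot> ?bm) \<odot> (?bp \<odot> ?am)) ?n2"
    using icomp_net(2)[of ?am ?ap ?bm ?bp ?dm ?dp f "icomp Bm Bp Cm Cp Dm Dp h g"] by (simp add: 2)
  also have "\<dots> = net ?a ?b ((?bm \<odot> ?bp) \<odot> (?cm \<odot> ?cp)) (?s' \<odot> (?bm \<odot> ?ap)) (?r' \<odot> (?bp \<odot> ?am)) ((h \<otimes> g) \<otimes> f)"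
    by (rule net_nest[OF N2]) auto
  finally have L: "icomp Am Ap Bm Bp Dm Dp (icomp Bm Bp Cm Cp Dm Dp h g) f = \<dots>" .
  have NL: "network ?a ?b ((?bm \<odot> ?bp) \<odot> (?cm \<odot> ?cp)) (?s' \<odot> (?bm \<odot> ?ap)) (?r' \<odot> (?bp \<odot> ?am)) ((h \<otimes> g) \<otimes> f)"
    by (rule network_nest(1)[OF N2]) auto

  have s: "can (?s' \<odot> (?bm \<odot> ?ap)) ((?dm \<odot> ?cp) \<odot> ?s) = Assoc T (Dm \<boxtimes> Cp) (Cm \<boxtimes> Bp) (Bm \<boxtimes> Ap)"
    by (rule canonical_eq_can) (rule canonicalI | simp)+
  have r: "can (?r' \<odot> (?bp \<odot> ?am)) ((?dp \<odot> ?cm) \<odot> ?r) = Assoc T (Dp \<boxtimes> Cm) (Cp \<boxtimes> Bm) (Bp \<boxtimes> Am)"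
    by (rule canonical_eq_can) (rule canonicalI | simp)+
  show ?thesis
    unfolding L R by (rule net_cong[OF NL NR]) (auto simp: s r Assoc_nat)
qed

text \<open>
  The two braidings next to the identity cancel, and the loop that remains behind \<open>g\<close> is yanked.
\<close>

lemma icomp_Ident_right:
  assumes [simp]: "Am \<in> Obj T" "Ap \<in> Obj T" "Cm \<in> Obj T" "Cp \<in> Obj T"
    and [simp]: "g \<in> Arr T" "Dom T g = Cm \<boxtimes> Ap" "Cod T g = Cp \<boxtimes> Am"
  shows "icomp Am Ap Am Ap Cm Cp g (Braid T Am Ap) = g"
proof -
  have "(\<one> Cm \<otimes> Braid T Am Ap) \<cdot> (\<one> Cm \<otimes> Braid T Ap Am) \<cdot> Assoc T Cm Ap Am = Assoc T Cm Ap Am"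
    by (simp add: Tensor_merge)
  then have "icomp Am Ap Am Ap Cm Cp g (Braid T Am Ap) =
    Trace T Am (Cm \<boxtimes> Ap) (Cp \<boxtimes> Am) (swap_right Cp Am Am \<cdot> (g \<otimes> \<one> Am))"
    by (simp add: icomp_def)
  also have "\<dots> = g"
    using Trace_nat[of g "\<one> (Cp \<boxtimes> Am)" "swap_right Cp Am Am" Am] by (simp add: Trace_swap_right)
  finally show ?thesis .
qed

text \<open>
  The wire that passes by \<open>f\<close> can be moved to the other side of \<open>f\<close> by naturality of the braiding; the
  remaining loop in front of \<open>f\<close> is yanked.
\<close>

lemma icomp_Ident_left:
  assumes [simp]: "Am \<in> Obj T" "Ap \<in> Obj T" "Bm \<in> Obj T" "Bp \<in> Obj T"
    and [simp]: "f \<in> Arr T" "Dom T f = Bm \<boxtimes> Ap" "Cod T f = Bp \<boxtimes> Am"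
  shows "icomp Am Ap Bm Bp Bm Bp (Braid T Bm Bp) f = f"
proof -
  let ?am = "Wire 2 Am" and ?ap = "Wire 3 Ap" and ?bm = "Wire 4 Bm" and ?bp = "Wire 5 Bp" and ?bm' = "Wire 6 Bm"
  have 1: "swap_right Bp Bm Am \<cdot> (Braid T Bm Bp \<otimes> \<one> Am) \<cdot> Inverse T (Assoc T Bm Bp Am) = Braid T Bm (Bp \<boxtimes> Am)"
    by (rule canonical_unique[of "?bm \<odot> (?bp \<odot> ?am)" "(?bp \<odot> ?am) \<odot> ?bm"]) (rule canonicalI' | simp)+
  have 2: "Braid T Bm (Bm \<boxtimes> Ap) \<cdot> (\<one> Bm \<otimes> Braid T Ap Bm) \<cdot> Assoc T Bm Ap Bm =
    (Braid T Ap Bm \<otimes> \<one> Bm) \<cdot> swap_right Ap Bm Bm \<cdot> (Braid T Bm Ap \<otimes> \<one> Bm)"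
    by (rule canonical_unique[of "(?bm \<odot> ?ap) \<odot> ?bm'" "(?bm' \<odot> ?ap) \<odot> ?bm"]) (rule canonicalI' | simp)+
  have "swap_right Bp Bm Am \<cdot> (Braid T Bm Bp \<otimes> \<one> Am) \<cdot> Inverse T (Assoc T Bm Bp Am) \<cdot> (\<one> Bm \<otimes> f) \<cdot>
      ((\<one> Bm \<otimes> Braid T Ap Bm) \<cdot> Assoc T Bm Ap Bm) =
    (swap_right Bp Bm Am \<cdot> (Braid T Bm Bp \<otimes> \<one> Am) \<cdot> Inverse T (Assoc T Bm Bp Am)) \<cdot> (\<one> Bm \<otimes> f) \<cdot>
      (\<one> Bm \<otimes> Braid T Ap Bm) \<cdot> Assoc T Bm Ap Bm"
    by simp
  also have "\<dots> = (f \<otimes> \<one> Bm) \<cdot> Braid T Bm (Bm \<boxtimes> Ap) \<cdot> (\<one> Bm \<otimes> Braid T Ap Bm) \<cdot> Assoc T Bm Ap Bm"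
    unfolding 1 by (simp add: Braid_nat_prefix)
  also have "\<dots> = ((f \<cdot> Braid T Ap Bm) \<otimes> \<one> Bm) \<cdot> swap_right Ap Bm Bm \<cdot> (Braid T Bm Ap \<otimes> \<one> Bm)"
    unfolding 2 by (simp add: Tensor_merge)
  finally show ?thesis
    using Trace_nat[of "Braid T Bm Ap" "f \<cdot> Braid T Ap Bm" "swap_right Ap Bm Bm" Bm]
    by (simp add: icomp_def Trace_swap_right)
qed

text \<open>
  The arrow that underlies a tensor product of Int arrows.
\<close>

definition itensor ::
  "'o \<Rightarrow> 'o \<Rightarrow> 'o \<Rightarrow> 'o \<Rightarrow> 'o \<Rightarrow> 'o \<Rightarrow> 'o \<Rightarrow> 'o \<Rightarrow> 'm \<Rightarrow> 'm \<Rightarrow> 'm" where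
  "itensor Am Ap Bm Bp Am' Ap' Bm' Bp' f f' =
     interchange T Bp Am Bp' Am' \<cdot> (f \<otimes> f') \<cdot> interchange T Bm Bm' Ap Ap'"

lemma int_tensor_itensor:
  "int_tensor T ((Am, Ap), (Bm, Bp), f) ((Am', Ap'), (Bm', Bp'), f') =
     ((Am \<boxtimes> Am', Ap \<boxtimes> Ap'), (Bm \<boxtimes> Bm', Bp \<boxtimes> Bp'), itensor Am Ap Bm Bp Am' Ap' Bm' Bp' f f')"
  by (simp add: itensor_def)

lemma itensor_simps [simp]:
  assumes "Am \<in> Obj T" "Ap \<in> Obj T" "Bm \<in> Obj T" "Bp \<in> Obj T"
      "Am' \<in> Obj T" "Ap' \<in> Obj T" "Bm' \<in> Obj T" "Bp' \<in> Obj T"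
    and "f \<in> Arr T" "Dom T f = Bm \<boxtimes> Ap" "Cod T f = Bp \<boxtimes> Am"
    and "f' \<in> Arr T" "Dom T f' = Bm' \<boxtimes> Ap'" "Cod T f' = Bp' \<boxtimes> Am'"
  shows "itensor Am Ap Bm Bp Am' Ap' Bm' Bp' f f' \<in> Arr T"
    "Dom T (itensor Am Ap Bm Bp Am' Ap' Bm' Bp' f f') = (Bm \<boxtimes> Bm') \<boxtimes> (Ap \<boxtimes> Ap')"
    "Cod T (itensor Am Ap Bm Bp Am' Ap' Bm' Bp' f f') = (Bp \<boxtimes> Bp') \<boxtimes> (Am \<boxtimes> Am')"
  using assms by (simp_all add: itensor_def)

lemma itensor_Ident:
  assumes [simp]: "Am \<in> Obj T" "Ap \<in> Obj T" "Am' \<in> Obj T" "Ap' \<in> Obj T"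
  shows "itensor Am Ap Am Ap Am' Ap' Am' Ap' (Braid T Am Ap) (Braid T Am' Ap') = Braid T (Am \<boxtimes> Am') (Ap \<boxtimes> Ap')"
proof -
  let ?am = "Wire 2 Am" and ?ap = "Wire 3 Ap" and ?am' = "Wire 4 Am'" and ?ap' = "Wire 5 Ap'"
  show ?thesis
    unfolding itensor_def
    by (rule canonical_unique[of "(?am \<odot> ?am') \<odot> (?ap \<odot> ?ap')" "(?ap \<odot> ?ap') \<odot> (?am \<odot> ?am')"])
      (rule canonicalI' | simp)+
qed

text \<open>
  Both sides are the network with boxes \<open>f\<close>, \<open>g\<close>, \<open>f'\<close>, \<open>g'\<close>. On the left-hand side the boxes come in the
  order \<open>(g \<otimes> g') \<otimes> (f \<otimes> f')\<close> and on the right-hand side in the order \<open>(g \<otimes> f) \<otimes> (g' \<otimes> f')\<close>, and the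
  interchange maps one to the other.
\<close>

lemma itensor_icomp:
  assumes [simp]: "Am \<in> Obj T" "Ap \<in> Obj T" "Bm \<in> Obj T" "Bp \<in> Obj T" "Cm \<in> Obj T" "Cp \<in> Obj T"
      "Am' \<in> Obj T" "Ap' \<in> Obj T" "Bm' \<in> Obj T" "Bp' \<in> Obj T" "Cm' \<in> Obj T" "Cp' \<in> Obj T"
    and [simp]: "f \<in> Arr T" "Dom T f = Bm \<boxtimes> Ap" "Cod T f = Bp \<boxtimes> Am"
    and [simp]: "f' \<in> Arr T" "Dom T f' = Bm' \<boxtimes> Ap'" "Cod T f' = Bp' \<boxtimes> Am'"
    and [simp]: "g \<in> Arr T" "Dom T g = Cm \<boxtimes> Bp" "Cod T g = Cp \<boxtimes> Bm"
    and [simp]: "g' \<in> Arr T" "Dom T g' = Cm' \<boxtimes> Bp'" "Cod T g' = Cp' \<boxtimes> Bm'"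
  shows "icomp (Am \<boxtimes> Am') (Ap \<boxtimes> Ap') (Bm \<boxtimes> Bm') (Bp \<boxtimes> Bp') (Cm \<boxtimes> Cm') (Cp \<boxtimes> Cp')
      (itensor Bm Bp Cm Cp Bm' Bp' Cm' Cp' g g') (itensor Am Ap Bm Bp Am' Ap' Bm' Bp' f f') =
    itensor Am Ap Cm Cp Am' Ap' Cm' Cp' (icomp Am Ap Bm Bp Cm Cp g f) (icomp Am' Ap' Bm' Bp' Cm' Cp' g' f')"
proof -
  let ?am = "Wire 2 Am" and ?ap = "Wire 3 Ap" and ?bm = "Wire 4 Bm" and ?bp = "Wire 5 Bp"
    and ?cm = "Wire 6 Cm" and ?cp = "Wire 7 Cp"
    and ?am' = "Wire 8 Am'" and ?ap' = "Wire 9 Ap'" and ?bm' = "Wire 10 Bm'" and ?bp' = "Wire 11 Bp'"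
    and ?cm' = "Wire 12 Cm'" and ?cp' = "Wire 13 Cp'"
  let ?s = "(?cm \<odot> ?bp) \<odot> (?bm \<odot> ?ap)" and ?r = "(?cp \<odot> ?bm) \<odot> (?bp \<odot> ?am)"
    and ?s' = "(?cm' \<odot> ?bp') \<odot> (?bm' \<odot> ?ap')" and ?r' = "(?cp' \<odot> ?bm') \<odot> (?bp' \<odot> ?am')"
    and ?S = "((?cm \<odot> ?cm') \<odot> (?bp \<odot> ?bp')) \<odot> ((?bm \<odot> ?bm') \<odot> (?ap \<odot> ?ap'))"
    and ?R = "((?cp \<odot> ?cp') \<odot> (?bm \<odot> ?bm')) \<odot> ((?bp \<odot> ?bp') \<odot> (?am \<odot> ?am'))"
  let ?a = "(?cm \<odot> ?cm') \<odot> (?ap \<odot> ?ap')" and ?b = "(?cp \<odot> ?cp') \<odot> (?am \<odot> ?am')"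
  let ?G = "itensor Bm Bp Cm Cp Bm' Bp' Cm' Cp' g g'" and ?F = "itensor Am Ap Bm Bp Am' Ap' Bm' Bp' f f'"
  let ?u = "(?bm \<odot> ?bp) \<odot> (?bm' \<odot> ?bp')" and ?U = "(?bm \<odot> ?bm') \<odot> (?bp \<odot> ?bp')"
  note gf = icomp_net[of ?am ?ap ?bm ?bp ?cm ?cp f g, simplified]
  note gf' = icomp_net[of ?am' ?ap' ?bm' ?bp' ?cm' ?cp' f' g', simplified]
  note GF = icomp_net[of "?am \<odot> ?am'" "?ap \<odot> ?ap'" "?bm \<odot> ?bm'" "?bp \<odot> ?bp'" "?cm \<odot> ?cm'" "?cp \<odot> ?cp'" ?F ?G, simplified]
  let ?n = "net (?cm \<odot> ?ap) (?cp \<odot> ?am) (?bm \<odot> ?bp) ?s ?r (g \<otimes> f)"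
    and ?n' = "net (?cm' \<odot> ?ap') (?cp' \<odot> ?am') (?bm' \<odot> ?bp') ?s' ?r' (g' \<otimes> f')"

  note n' = network_simps[OF gf'(1)]
  have M: "network (?s \<odot> (?cm' \<odot> ?ap')) (?r \<odot> (?cp' \<odot> ?am')) (?bm' \<odot> ?bp') (?s \<odot> ?s') (?r \<odot> ?r') ((g \<otimes> f) \<otimes> (g' \<otimes> f'))"
    by (rule network_Tensor_left[OF gf'(1)]) auto
  have "?n \<otimes> ?n' = net ((?cm \<odot> ?ap) \<odot> (?cm' \<odot> ?ap')) ((?cp \<odot> ?am) \<odot> (?cp' \<odot> ?am')) (?bm \<odot> ?bp)
      (?s \<odot> (?cm' \<odot> ?ap')) (?r \<odot> (?cp' \<odot> ?am')) ((g \<otimes> f) \<otimes> ?n')"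
    by (rule net_Tensor_right[OF gf(1)]) (use n' in auto)
  also have "(g \<otimes> f) \<otimes> ?n' = net (?s \<odot> (?cm' \<odot> ?ap')) (?r \<odot> (?cp' \<odot> ?am')) (?bm' \<odot> ?bp') (?s \<odot> ?s') (?r \<odot> ?r')
      ((g \<otimes> f) \<otimes> (g' \<otimes> f'))"
    by (rule net_Tensor_left[OF gf'(1)]) auto
  also have "net ((?cm \<odot> ?ap) \<odot> (?cm' \<odot> ?ap')) ((?cp \<odot> ?am) \<odot> (?cp' \<odot> ?am')) (?bm \<odot> ?bp)
      (?s \<odot> (?cm' \<odot> ?ap')) (?r \<odot> (?cp' \<odot> ?am')) \<dots> =
    net ((?cm \<odot> ?ap) \<odot> (?cm' \<odot> ?ap')) ((?cp \<odot> ?am) \<odot> (?cp' \<odot> ?am')) ?u (?s \<odot> ?s') (?r \<odot> ?r')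
      ((g \<otimes> f) \<otimes> (g' \<otimes> f'))"
    by (rule net_nest[OF M]) auto
  finally have 1: "?n \<otimes> ?n' = \<dots>" .
  have N1: "network ((?cm \<odot> ?ap) \<odot> (?cm' \<odot> ?ap')) ((?cp \<odot> ?am) \<odot> (?cp' \<odot> ?am')) ?u (?s \<odot> ?s') (?r \<odot> ?r')
      ((g \<otimes> f) \<otimes> (g' \<otimes> f'))"
    by (rule network_nest(1)[OF M]) auto
  have N2: "network ?a ?b ?u (?s \<odot> ?s') (?r \<odot> ?r') ((g \<otimes> f) \<otimes> (g' \<otimes> f'))"
    using networkD[OF N1] by (auto simp: network_def)
  have ia: "can ?a ((?cm \<odot> ?ap) \<odot> (?cm' \<odot> ?ap')) = interchange T Cm Cm' Ap Ap'"
    by (rule canonical_eq_can) (rule canonicalI' | simp)+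
  have ib: "can ((?cp \<odot> ?am) \<odot> (?cp' \<odot> ?am')) ?b = interchange T Cp Am Cp' Am'"
    by (rule canonical_eq_can) (rule canonicalI' | simp)+
  have L: "itensor Am Ap Cm Cp Am' Ap' Cm' Cp' ?n ?n' = net ?a ?b ?u (?s \<odot> ?s') (?r \<odot> ?r') ((g \<otimes> f) \<otimes> (g' \<otimes> f'))"
    unfolding itensor_def 1 ia[symmetric] ib[symmetric] by (rule net_conj[OF N1 N2]) auto

  have s: "can ?S (?s \<odot> ?s') = interchange T (Cm \<boxtimes> Bp) (Cm' \<boxtimes> Bp') (Bm \<boxtimes> Ap) (Bm' \<boxtimes> Ap') \<cdot>
      (interchange T Cm Cm' Bp Bp' \<otimes> interchange T Bm Bm' Ap Ap')"
    by (rule canonical_eq_can) (rule canonicalI' | simp)+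
  have r: "can ?R (?r \<odot> ?r') \<cdot> (interchange T Cp Bm Cp' Bm' \<otimes> interchange T Bp Am Bp' Am') =
      interchange T (Cp \<boxtimes> Bm) (Cp' \<boxtimes> Bm') (Bp \<boxtimes> Am) (Bp' \<boxtimes> Am')"
    by (rule canonical_unique[of "((?cp \<odot> ?bm) \<odot> (?cp' \<odot> ?bm')) \<odot> ((?bp \<odot> ?am) \<odot> (?bp' \<odot> ?am'))" "?r \<odot> ?r'"])
      (rule canonicalI' | simp | auto)+
  have c: "can ?R (?r \<odot> ?r') \<in> Arr T" "Dom T (can ?R (?r \<odot> ?r')) = obj ?R" "Cod T (can ?R (?r \<odot> ?r')) = obj (?r \<odot> ?r')"
    by (rule can_simps; auto)+
  have "can ?R (?r \<odot> ?r') \<cdot> (?G \<otimes> ?F) =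
    (can ?R (?r \<odot> ?r') \<cdot> (interchange T Cp Bm Cp' Bm' \<otimes> interchange T Bp Am Bp' Am')) \<cdot>
      ((g \<otimes> g') \<otimes> (f \<otimes> f')) \<cdot> (interchange T Cm Cm' Bp Bp' \<otimes> interchange T Bm Bm' Ap Ap')"
    using c by (simp add: itensor_def Tensor_merge)
  also have "\<dots> = ((g \<otimes> f) \<otimes> (g' \<otimes> f')) \<cdot> can ?S (?s \<odot> ?s')"
    unfolding r s by (simp add: interchange_nat_prefix)
  finally have eq: "can ?R (?r \<odot> ?r') \<cdot> (?G \<otimes> ?F) = \<dots>" .
  show ?thesis
    unfolding gf(2) gf'(2) GF(2) L by (rule net_cong[OF GF(1) N2 _ eq]) auto
qed

end

section \<open>Commuting squares between Int arrows\<close>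

context traced_category
begin

text \<open>
  Squares are tensored by placing them side by side and conjugating with the interchange, which is
  natural.
\<close>

lemma itensor_square:
  assumes [simp]: "sm \<in> Arr T" "sp \<in> Arr T" "tm \<in> Arr T" "tp \<in> Arr T"
      "sm' \<in> Arr T" "sp' \<in> Arr T" "tm' \<in> Arr T" "tp' \<in> Arr T"
    and [simp]: "f \<in> Arr T" "Dom T f = Dom T tm \<boxtimes> Dom T sp" "Cod T f = Dom T tp \<boxtimes> Dom T sm"
    and [simp]: "g \<in> Arr T" "Dom T g = Cod T tm \<boxtimes> Cod T sp" "Cod T g = Cod T tp \<boxtimes> Cod T sm"
    and [simp]: "f' \<in> Arr T" "Dom T f' = Dom T tm' \<boxtimes> Dom T sp'" "Cod T f' = Dom T tp' \<boxtimes> Dom T sm'"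
    and [simp]: "g' \<in> Arr T" "Dom T g' = Cod T tm' \<boxtimes> Cod T sp'" "Cod T g' = Cod T tp' \<boxtimes> Cod T sm'"
    and eq: "(tp \<otimes> sm) \<cdot> f = g \<cdot> (tm \<otimes> sp)" "(tp' \<otimes> sm') \<cdot> f' = g' \<cdot> (tm' \<otimes> sp')"
  shows "((tp \<otimes> tp') \<otimes> (sm \<otimes> sm')) \<cdot>
      itensor (Dom T sm) (Dom T sp) (Dom T tm) (Dom T tp) (Dom T sm') (Dom T sp') (Dom T tm') (Dom T tp') f f' =
    itensor (Cod T sm) (Cod T sp) (Cod T tm) (Cod T tp) (Cod T sm') (Cod T sp') (Cod T tm') (Cod T tp') g g' \<cdot>
      ((tm \<otimes> tm') \<otimes> (sp \<otimes> sp'))"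
proof -
  let ?i = "interchange T (Dom T tm) (Dom T tm') (Dom T sp) (Dom T sp')"
  let ?j = "interchange T (Cod T tp) (Cod T sm) (Cod T tp') (Cod T sm')"
  have "((tp \<otimes> tp') \<otimes> (sm \<otimes> sm')) \<cdot>
      itensor (Dom T sm) (Dom T sp) (Dom T tm) (Dom T tp) (Dom T sm') (Dom T sp') (Dom T tm') (Dom T tp') f f' =
    ?j \<cdot> ((tp \<otimes> sm) \<otimes> (tp' \<otimes> sm')) \<cdot> (f \<otimes> f') \<cdot> ?i"
    by (simp add: itensor_def interchange_nat_prefix)
  also have "\<dots> = ?j \<cdot> (((tp \<otimes> sm) \<cdot> f) \<otimes> ((tp' \<otimes> sm') \<cdot> f')) \<cdot> ?i"
    by (simp add: Tensor_merge)
  also have "\<dots> = ?j \<cdot> (g \<otimes> g') \<cdot> ((tm \<otimes> sp) \<otimes> (tm' \<otimes> sp')) \<cdot> ?i"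
    unfolding eq by (simp add: Tensor_merge)
  also have "\<dots> = itensor (Cod T sm) (Cod T sp) (Cod T tm) (Cod T tp) (Cod T sm') (Cod T sp') (Cod T tm') (Cod T tp') g g' \<cdot>
      ((tm \<otimes> tm') \<otimes> (sp \<otimes> sp'))"
    by (simp add: itensor_def interchange_nat)
  finally show ?thesis .
qed

text \<open>
  In this and the next three lemmas the boxes are brought to the same order by naturality of the
  structural isomorphisms; the permutations before and behind the boxes agree by coherence.
\<close>

lemma itensor_Assoc:
  assumes [simp]: "Am \<in> Obj T" "Ap \<in> Obj T" "Bm \<in> Obj T" "Bp \<in> Obj T"
      "Am' \<in> Obj T" "Ap' \<in> Obj T" "Bm' \<in> Obj T" "Bp' \<in> Obj T"
      "Am'' \<in> Obj T" "Ap'' \<in> Obj T" "Bm'' \<in> Obj T" "Bp'' \<in> Obj T"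
    and [simp]: "f \<in> Arr T" "Dom T f = Bm \<boxtimes> Ap" "Cod T f = Bp \<boxtimes> Am"
    and [simp]: "f' \<in> Arr T" "Dom T f' = Bm' \<boxtimes> Ap'" "Cod T f' = Bp' \<boxtimes> Am'"
    and [simp]: "f'' \<in> Arr T" "Dom T f'' = Bm'' \<boxtimes> Ap''" "Cod T f'' = Bp'' \<boxtimes> Am''"
  shows "(Assoc T Bp Bp' Bp'' \<otimes> Assoc T Am Am' Am'') \<cdot>
      itensor (Am \<boxtimes> Am') (Ap \<boxtimes> Ap') (Bm \<boxtimes> Bm') (Bp \<boxtimes> Bp') Am'' Ap'' Bm'' Bp''
        (itensor Am Ap Bm Bp Am' Ap' Bm' Bp' f f') f'' =
    itensor Am Ap Bm Bp (Am' \<boxtimes> Am'') (Ap' \<boxtimes> Ap'') (Bm' \<boxtimes> Bm'') (Bp' \<boxtimes> Bp'')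
        f (itensor Am' Ap' Bm' Bp' Am'' Ap'' Bm'' Bp'' f' f'') \<cdot>
      (Assoc T Bm Bm' Bm'' \<otimes> Assoc T Ap Ap' Ap'')"
proof -
  let ?am = "Wire 0 Am" and ?ap = "Wire 1 Ap" and ?bm = "Wire 2 Bm" and ?bp = "Wire 3 Bp"
    and ?am' = "Wire 4 Am'" and ?ap' = "Wire 5 Ap'" and ?bm' = "Wire 6 Bm'" and ?bp' = "Wire 7 Bp'"
    and ?am'' = "Wire 8 Am''" and ?ap'' = "Wire 9 Ap''" and ?bm'' = "Wire 10 Bm''" and ?bp'' = "Wire 11 Bp''"
  let ?i = "interchange T"
  let ?l = "(?i Bm Bm' Ap Ap' \<otimes> \<one> (Bm'' \<boxtimes> Ap'')) \<cdot> ?i (Bm \<boxtimes> Bm') Bm'' (Ap \<boxtimes> Ap') Ap''"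
    and ?l' = "(\<one> (Bm \<boxtimes> Ap) \<otimes> ?i Bm' Bm'' Ap' Ap'') \<cdot> ?i Bm (Bm' \<boxtimes> Bm'') Ap (Ap' \<boxtimes> Ap'')"
    and ?r = "?i (Bp \<boxtimes> Bp') (Am \<boxtimes> Am') Bp'' Am'' \<cdot> (?i Bp Am Bp' Am' \<otimes> \<one> (Bp'' \<boxtimes> Am''))"
    and ?r' = "?i Bp Am (Bp' \<boxtimes> Bp'') (Am' \<boxtimes> Am'') \<cdot> (\<one> (Bp \<boxtimes> Am) \<otimes> ?i Bp' Am' Bp'' Am'')"
  have l: "Assoc T (Bm \<boxtimes> Ap) (Bm' \<boxtimes> Ap') (Bm'' \<boxtimes> Ap'') \<cdot> ?l = ?l' \<cdot> (Assoc T Bm Bm' Bm'' \<otimes> Assoc T Ap Ap' Ap'')"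
    by (rule canonical_unique[of "((?bm \<odot> ?bm') \<odot> ?bm'') \<odot> ((?ap \<odot> ?ap') \<odot> ?ap'')"
          "(?bm \<odot> ?ap) \<odot> ((?bm' \<odot> ?ap') \<odot> (?bm'' \<odot> ?ap''))"])
      (rule canonicalI' | simp)+
  have r: "(Assoc T Bp Bp' Bp'' \<otimes> Assoc T Am Am' Am'') \<cdot> ?r =
    ?r' \<cdot> Assoc T (Bp \<boxtimes> Am) (Bp' \<boxtimes> Am') (Bp'' \<boxtimes> Am'')"
    by (rule canonical_unique[of "((?bp \<odot> ?am) \<odot> (?bp' \<odot> ?am')) \<odot> (?bp'' \<odot> ?am'')"
          "(?bp \<odot> ?bp' \<odot> ?bp'') \<odot> (?am \<odot> ?am' \<odot> ?am'')"])
      (rule canonicalI' | simp)+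
  have "(Assoc T Bp Bp' Bp'' \<otimes> Assoc T Am Am' Am'') \<cdot>
      itensor (Am \<boxtimes> Am') (Ap \<boxtimes> Ap') (Bm \<boxtimes> Bm') (Bp \<boxtimes> Bp') Am'' Ap'' Bm'' Bp''
        (itensor Am Ap Bm Bp Am' Ap' Bm' Bp' f f') f'' =
    ((Assoc T Bp Bp' Bp'' \<otimes> Assoc T Am Am' Am'') \<cdot> ?r) \<cdot> ((f \<otimes> f') \<otimes> f'') \<cdot> ?l"
    by (simp add: itensor_def Tensor_merge)
  also have "\<dots> = ?r' \<cdot> (f \<otimes> (f' \<otimes> f'')) \<cdot> (Assoc T (Bm \<boxtimes> Ap) (Bm' \<boxtimes> Ap') (Bm'' \<boxtimes> Ap'') \<cdot> ?l)"
    unfolding r by (simp add: Assoc_nat_prefix)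
  also have "\<dots> = itensor Am Ap Bm Bp (Am' \<boxtimes> Am'') (Ap' \<boxtimes> Ap'') (Bm' \<boxtimes> Bm'') (Bp' \<boxtimes> Bp'')
        f (itensor Am' Ap' Bm' Bp' Am'' Ap'' Bm'' Bp'' f' f'') \<cdot>
      (Assoc T Bm Bm' Bm'' \<otimes> Assoc T Ap Ap' Ap'')"
    unfolding l by (simp add: itensor_def Tensor_merge)
  finally show ?thesis .
qed

lemma itensor_Lunit:
  assumes [simp]: "Am \<in> Obj T" "Ap \<in> Obj T" "Bm \<in> Obj T" "Bp \<in> Obj T"
    and [simp]: "f \<in> Arr T" "Dom T f = Bm \<boxtimes> Ap" "Cod T f = Bp \<boxtimes> Am"
  shows "(Lunit T Bp \<otimes> Lunit T Am) \<cdot>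
      itensor (MUnit T) (MUnit T) (MUnit T) (MUnit T) Am Ap Bm Bp (Braid T (MUnit T) (MUnit T)) f =
    f \<cdot> (Lunit T Bm \<otimes> Lunit T Ap)"
proof -
  let ?am = "Wire 0 Am" and ?ap = "Wire 1 Ap" and ?bm = "Wire 2 Bm" and ?bp = "Wire 3 Bp"
  let ?I = "MUnit T"
  let ?c = "Lunit T (Bp \<boxtimes> Am) \<cdot> (Lunit T ?I \<otimes> \<one> (Bp \<boxtimes> Am))"
  have r: "(Lunit T Bp \<otimes> Lunit T Am) \<cdot> interchange T ?I ?I Bp Am \<cdot> (Braid T ?I ?I \<otimes> \<one> (Bp \<boxtimes> Am)) = ?c"
    by (rule canonical_unique[of "(Empty \<odot> Empty) \<odot> (?bp \<odot> ?am)" "?bp \<odot> ?am"]) (rule canonicalI' | simp)+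
  have l: "Lunit T (Bm \<boxtimes> Ap) \<cdot> (Lunit T ?I \<otimes> \<one> (Bm \<boxtimes> Ap)) \<cdot> interchange T ?I Bm ?I Ap = Lunit T Bm \<otimes> Lunit T Ap"
    by (rule canonical_unique[of "(Empty \<odot> ?bm) \<odot> (Empty \<odot> ?ap)" "?bm \<odot> ?ap"]) (rule canonicalI' | simp)+
  have "(Lunit T Bp \<otimes> Lunit T Am) \<cdot> itensor ?I ?I ?I ?I Am Ap Bm Bp (Braid T ?I ?I) f =
    ((Lunit T Bp \<otimes> Lunit T Am) \<cdot> interchange T ?I ?I Bp Am \<cdot> (Braid T ?I ?I \<otimes> \<one> (Bp \<boxtimes> Am))) \<cdot>
      (\<one> (?I \<boxtimes> ?I) \<otimes> f) \<cdot> interchange T ?I Bm ?I Ap"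
    by (simp add: itensor_def Tensor_Comp_prefix)
  also have "\<dots> = Lunit T (Bp \<boxtimes> Am) \<cdot> (\<one> ?I \<otimes> f) \<cdot> (Lunit T ?I \<otimes> \<one> (Bm \<boxtimes> Ap)) \<cdot> interchange T ?I Bm ?I Ap"
    unfolding r by (simp add: Tensor_Comp_prefix)
  also have "\<dots> = f \<cdot> Lunit T (Bm \<boxtimes> Ap) \<cdot> (Lunit T ?I \<otimes> \<one> (Bm \<boxtimes> Ap)) \<cdot> interchange T ?I Bm ?I Ap"
    using Comp_prefix[OF Lunit_nat[of f "Bp \<boxtimes> Am"], of "(Lunit T ?I \<otimes> \<one> (Bm \<boxtimes> Ap)) \<cdot> interchange T ?I Bm ?I Ap"]
    by simp
  finally show ?thesis unfolding l .
qed

lemma itensor_Runit: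
  assumes [simp]: "Am \<in> Obj T" "Ap \<in> Obj T" "Bm \<in> Obj T" "Bp \<in> Obj T"
    and [simp]: "f \<in> Arr T" "Dom T f = Bm \<boxtimes> Ap" "Cod T f = Bp \<boxtimes> Am"
  shows "(Runit T Bp \<otimes> Runit T Am) \<cdot>
      itensor Am Ap Bm Bp (MUnit T) (MUnit T) (MUnit T) (MUnit T) f (Braid T (MUnit T) (MUnit T)) =
    f \<cdot> (Runit T Bm \<otimes> Runit T Ap)"
proof -
  let ?am = "Wire 0 Am" and ?ap = "Wire 1 Ap" and ?bm = "Wire 2 Bm" and ?bp = "Wire 3 Bp"
  let ?I = "MUnit T"
  let ?c = "Runit T (Bp \<boxtimes> Am) \<cdot> (\<one> (Bp \<boxtimes> Am) \<otimes> Lunit T ?I)"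
  have r: "(Runit T Bp \<otimes> Runit T Am) \<cdot> interchange T Bp Am ?I ?I \<cdot> (\<one> (Bp \<boxtimes> Am) \<otimes> Braid T ?I ?I) = ?c"
    by (rule canonical_unique[of "(?bp \<odot> ?am) \<odot> (Empty \<odot> Empty)" "?bp \<odot> ?am"]) (rule canonicalI' | simp)+
  have l: "Runit T (Bm \<boxtimes> Ap) \<cdot> (\<one> (Bm \<boxtimes> Ap) \<otimes> Lunit T ?I) \<cdot> interchange T Bm ?I Ap ?I = Runit T Bm \<otimes> Runit T Ap"
    by (rule canonical_unique[of "(?bm \<odot> Empty) \<odot> (?ap \<odot> Empty)" "?bm \<odot> ?ap"]) (rule canonicalI' | simp)+
  have "(Runit T Bp \<otimes> Runit T Am) \<cdot> itensor Am Ap Bm Bp ?I ?I ?I ?I f (Braid T ?I ?I) =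
    ((Runit T Bp \<otimes> Runit T Am) \<cdot> interchange T Bp Am ?I ?I \<cdot> (\<one> (Bp \<boxtimes> Am) \<otimes> Braid T ?I ?I)) \<cdot>
      (f \<otimes> \<one> (?I \<boxtimes> ?I)) \<cdot> interchange T Bm ?I Ap ?I"
    by (simp add: itensor_def Tensor_Comp_prefix)
  also have "\<dots> = Runit T (Bp \<boxtimes> Am) \<cdot> (f \<otimes> \<one> ?I) \<cdot> (\<one> (Bm \<boxtimes> Ap) \<otimes> Lunit T ?I) \<cdot> interchange T Bm ?I Ap ?I"
    unfolding r by (simp add: Tensor_Comp_prefix)
  also have "\<dots> = f \<cdot> Runit T (Bm \<boxtimes> Ap) \<cdot> (\<one> (Bm \<boxtimes> Ap) \<otimes> Lunit T ?I) \<cdot> interchange T Bm ?I Ap ?I"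
    using Comp_prefix[OF Runit_nat[of f "Bp \<boxtimes> Am"], of "(\<one> (Bm \<boxtimes> Ap) \<otimes> Lunit T ?I) \<cdot> interchange T Bm ?I Ap ?I"]
    by simp
  finally show ?thesis unfolding l .
qed

lemma itensor_Braid:
  assumes [simp]: "Am \<in> Obj T" "Ap \<in> Obj T" "Bm \<in> Obj T" "Bp \<in> Obj T"
      "Am' \<in> Obj T" "Ap' \<in> Obj T" "Bm' \<in> Obj T" "Bp' \<in> Obj T"
    and [simp]: "f \<in> Arr T" "Dom T f = Bm \<boxtimes> Ap" "Cod T f = Bp \<boxtimes> Am"
    and [simp]: "f' \<in> Arr T" "Dom T f' = Bm' \<boxtimes> Ap'" "Cod T f' = Bp' \<boxtimes> Am'"
  shows "(Braid T Bp Bp' \<otimes> Braid T Am Am') \<cdot> itensor Am Ap Bm Bp Am' Ap' Bm' Bp' f f' =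
    itensor Am' Ap' Bm' Bp' Am Ap Bm Bp f' f \<cdot> (Braid T Bm Bm' \<otimes> Braid T Ap Ap')"
proof -
  let ?am = "Wire 0 Am" and ?ap = "Wire 1 Ap" and ?bm = "Wire 2 Bm" and ?bp = "Wire 3 Bp"
    and ?am' = "Wire 4 Am'" and ?ap' = "Wire 5 Ap'" and ?bm' = "Wire 6 Bm'" and ?bp' = "Wire 7 Bp'"
  have r: "(Braid T Bp Bp' \<otimes> Braid T Am Am') \<cdot> interchange T Bp Am Bp' Am' =
      interchange T Bp' Am' Bp Am \<cdot> Braid T (Bp \<boxtimes> Am) (Bp' \<boxtimes> Am')"
    by (rule canonical_unique[of "(?bp \<odot> ?am) \<odot> (?bp' \<odot> ?am')" "(?bp' \<odot> ?bp) \<odot> (?am' \<odot> ?am)"])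
      (rule canonicalI' | simp)+
  have l: "Braid T (Bm \<boxtimes> Ap) (Bm' \<boxtimes> Ap') \<cdot> interchange T Bm Bm' Ap Ap' =
      interchange T Bm' Bm Ap' Ap \<cdot> (Braid T Bm Bm' \<otimes> Braid T Ap Ap')"
    by (rule canonical_unique[of "(?bm \<odot> ?bm') \<odot> (?ap \<odot> ?ap')" "(?bm' \<odot> ?ap') \<odot> (?bm \<odot> ?ap)"])
      (rule canonicalI' | simp)+
  have "(Braid T Bp Bp' \<otimes> Braid T Am Am') \<cdot> itensor Am Ap Bm Bp Am' Ap' Bm' Bp' f f' =
    ((Braid T Bp Bp' \<otimes> Braid T Am Am') \<cdot> interchange T Bp Am Bp' Am') \<cdot> (f \<otimes> f') \<cdot> interchange T Bm Bm' Ap Ap'"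
    by (simp add: itensor_def)
  also have "\<dots> = interchange T Bp' Am' Bp Am \<cdot> (f' \<otimes> f) \<cdot>
      (Braid T (Bm \<boxtimes> Ap) (Bm' \<boxtimes> Ap') \<cdot> interchange T Bm Bm' Ap Ap')"
    unfolding r by (simp add: Braid_nat_prefix)
  also have "\<dots> = itensor Am' Ap' Bm' Bp' Am Ap Bm Bp f' f \<cdot> (Braid T Bm Bm' \<otimes> Braid T Ap Ap')"
    unfolding l by (simp add: itensor_def)
  finally show ?thesis .
qed

end

context uniform_traced_category
begin

lemma uniformity:
  assumes "s \<in> Arr T" "A \<in> Obj T" "B \<in> Obj T"
    and "f \<in> Arr T" "Dom T f = A \<boxtimes> Dom T s" "Cod T f = B \<boxtimes> Dom T s"
    and "g \<in> Arr T" "Dom T g = A \<boxtimes> Cod T s" "Cod T g = B \<boxtimes> Cod T s"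
    and "(\<one> B \<otimes> s) \<cdot> f = g \<cdot> (\<one> A \<otimes> s)"
  shows "Trace T (Dom T s) A B f = Trace T (Cod T s) A B g"
  using uniform[OF assms(1)] assms by (simp add: strict_arrow_def Let_def Hom_iff)

text \<open>
  The composite of squares: the naturality of the structural isomorphisms and the given squares move \<open>tm\<close>,
  together with the outer arrows, through the traced arrow. Strictness of \<open>tm\<close> then equates the traces.
\<close>

lemma icomp_square:
  assumes [simp]: "sm \<in> Arr T" "sp \<in> Arr T" "tm \<in> Arr T" "tp \<in> Arr T" "um \<in> Arr T" "up \<in> Arr T"
    and [simp]: "f \<in> Arr T" "Dom T f = Dom T tm \<boxtimes> Dom T sp" "Cod T f = Dom T tp \<boxtimes> Dom T sm"
    and [simp]: "f' \<in> Arr T" "Dom T f' = Cod T tm \<boxtimes> Cod T sp" "Cod T f' = Cod T tp \<boxtimes> Cod T sm"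
    and [simp]: "g \<in> Arr T" "Dom T g = Dom T um \<boxtimes> Dom T tp" "Cod T g = Dom T up \<boxtimes> Dom T tm"
    and [simp]: "g' \<in> Arr T" "Dom T g' = Cod T um \<boxtimes> Cod T tp" "Cod T g' = Cod T up \<boxtimes> Cod T tm"
    and f: "(tp \<otimes> sm) \<cdot> f = f' \<cdot> (tm \<otimes> sp)" and g: "(up \<otimes> tm) \<cdot> g = g' \<cdot> (um \<otimes> tp)"
  shows "(up \<otimes> sm) \<cdot> icomp (Dom T sm) (Dom T sp) (Dom T tm) (Dom T tp) (Dom T um) (Dom T up) g f =
    icomp (Cod T sm) (Cod T sp) (Cod T tm) (Cod T tp) (Cod T um) (Cod T up) g' f' \<cdot> (um \<otimes> sp)"
proof -
  let ?K = "\<lambda>Am Ap Bm Bp Cm Cp g f. swap_right Cp Bm Am \<cdot> (g \<otimes> \<one> Am) \<cdot> Inverse T (Assoc T Cm Bp Am) \<cdot>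
    (\<one> Cm \<otimes> f) \<cdot> ((\<one> Cm \<otimes> Braid T Ap Bm) \<cdot> Assoc T Cm Ap Bm)"
  let ?k = "?K (Dom T sm) (Dom T sp) (Dom T tm) (Dom T tp) (Dom T um) (Dom T up) g f"
  let ?k' = "?K (Cod T sm) (Cod T sp) (Cod T tm) (Cod T tp) (Cod T um) (Cod T up) g' f'"
  let ?i = "(\<one> (Dom T um) \<otimes> Braid T (Dom T sp) (Dom T tm)) \<cdot> Assoc T (Dom T um) (Dom T sp) (Dom T tm)"
  let ?i' = "(\<one> (Cod T um) \<otimes> Braid T (Cod T sp) (Cod T tm)) \<cdot> Assoc T (Cod T um) (Cod T sp) (Cod T tm)"
  let ?a = "Inverse T (Assoc T (Dom T um) (Dom T tp) (Dom T sm))"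
    and ?a' = "Inverse T (Assoc T (Cod T um) (Cod T tp) (Cod T sm))"
  let ?x' = "swap_right (Cod T up) (Cod T tm) (Cod T sm)"
  have x: "((up \<otimes> sm) \<otimes> tm) \<cdot> swap_right (Dom T up) (Dom T tm) (Dom T sm) = ?x' \<cdot> ((up \<otimes> tm) \<otimes> sm)"
    by (simp add: swap_right_nat)
  have i: "(um \<otimes> tm \<otimes> sp) \<cdot> ?i = ?i' \<cdot> ((um \<otimes> sp) \<otimes> tm)"
    by (simp add: Assoc_nat Tensor_Comp Tensor_Comp_prefix Braid_nat)
  have "((up \<otimes> sm) \<otimes> tm) \<cdot> ?k =
    (((up \<otimes> sm) \<otimes> tm) \<cdot> swap_right (Dom T up) (Dom T tm) (Dom T sm)) \<cdot> (g \<otimes> \<one> (Dom T sm)) \<cdot> ?a \<cdot>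
      (\<one> (Dom T um) \<otimes> f) \<cdot> ?i"
    by simp
  also have "\<dots> = ?x' \<cdot> (((up \<otimes> tm) \<cdot> g) \<otimes> sm) \<cdot> ?a \<cdot> (\<one> (Dom T um) \<otimes> f) \<cdot> ?i"
    unfolding x by (simp add: Tensor_merge)
  also have "\<dots> = ?x' \<cdot> (g' \<otimes> \<one> (Cod T sm)) \<cdot> ((um \<otimes> tp) \<otimes> sm) \<cdot> ?a \<cdot> (\<one> (Dom T um) \<otimes> f) \<cdot> ?i"
    unfolding g by (simp add: Tensor_merge)
  also have "\<dots> = ?x' \<cdot> (g' \<otimes> \<one> (Cod T sm)) \<cdot> ?a' \<cdot> (um \<otimes> tp \<otimes> sm) \<cdot> (\<one> (Dom T um) \<otimes> f) \<cdot> ?i"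
    by (simp add: Assoc_inv_nat_prefix)
  also have "\<dots> = ?x' \<cdot> (g' \<otimes> \<one> (Cod T sm)) \<cdot> ?a' \<cdot> (um \<otimes> ((tp \<otimes> sm) \<cdot> f)) \<cdot> ?i"
    by (simp add: Tensor_Comp_prefix)
  also have "\<dots> = ?x' \<cdot> (g' \<otimes> \<one> (Cod T sm)) \<cdot> ?a' \<cdot> (\<one> (Cod T um) \<otimes> f') \<cdot> ((um \<otimes> tm \<otimes> sp) \<cdot> ?i)"
    unfolding f by (simp add: Tensor_Comp_prefix)
  also have "\<dots> = ?k' \<cdot> ((um \<otimes> sp) \<otimes> tm)"
    unfolding i by simp
  finally have k: "((up \<otimes> sm) \<otimes> tm) \<cdot> ?k = ?k' \<cdot> ((um \<otimes> sp) \<otimes> tm)" .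
  define K where "K = ?k"
  define K' where "K' = ?k'"
  have [simp]: "K \<in> Arr T" "Dom T K = (Dom T um \<boxtimes> Dom T sp) \<boxtimes> Dom T tm" "Cod T K = (Dom T up \<boxtimes> Dom T sm) \<boxtimes> Dom T tm"
    "K' \<in> Arr T" "Dom T K' = (Cod T um \<boxtimes> Cod T sp) \<boxtimes> Cod T tm" "Cod T K' = (Cod T up \<boxtimes> Cod T sm) \<boxtimes> Cod T tm"
    by (simp_all add: K_def K'_def)
  let ?F = "((up \<otimes> sm) \<otimes> \<one> (Dom T tm)) \<cdot> K" and ?G = "K' \<cdot> ((um \<otimes> sp) \<otimes> \<one> (Cod T tm))"
  have "(\<one> (Cod T up \<boxtimes> Cod T sm) \<otimes> tm) \<cdot> ?F = ?G \<cdot> (\<one> (Dom T um \<boxtimes> Dom T sp) \<otimes> tm)"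
    using k[folded K_def K'_def] by (simp add: Tensor_Comp Tensor_Comp_prefix)
  then have "Trace T (Dom T tm) (Dom T um \<boxtimes> Dom T sp) (Cod T up \<boxtimes> Cod T sm) ?F =
    Trace T (Cod T tm) (Dom T um \<boxtimes> Dom T sp) (Cod T up \<boxtimes> Cod T sm) ?G"
    by (intro uniformity) simp_all
  then show ?thesis
    using Trace_nat[of "\<one> (Dom T um \<boxtimes> Dom T sp)" "up \<otimes> sm" K "Dom T tm"]
      Trace_nat[of "um \<otimes> sp" "\<one> (Cod T up \<boxtimes> Cod T sm)" K' "Cod T tm"]
    unfolding icomp_def K_def[symmetric] K'_def[symmetric] by simp
qed

end

section \<open>Thin double categories of squares\<close>

lemma Hom_prod_smc: "Hom (prod_smc C D) A B = Hom C (fst A) (fst B) \<times> Hom D (snd A) (snd B)"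
  by (auto simp: Hom_def prod_smc_def prod_eq_iff)

lemma prod_smc_simps:
  "Obj (prod_smc C D) = Obj C \<times> Obj D"
  "Arr (prod_smc C D) = Arr C \<times> Arr D"
  "Dom (prod_smc C D) f = (Dom C (fst f), Dom D (snd f))"
  "Cod (prod_smc C D) f = (Cod C (fst f), Cod D (snd f))"
  "Ident (prod_smc C D) A = (Ident C (fst A), Ident D (snd A))"
  "Comp (prod_smc C D) g f = (Comp C (fst g) (fst f), Comp D (snd g) (snd f))"
  "MUnit (prod_smc C D) = (MUnit C, MUnit D)"
  "TensorO (prod_smc C D) A B = (TensorO C (fst A) (fst B), TensorO D (snd A) (snd B))"
  "TensorA (prod_smc C D) f g = (TensorA C (fst f) (fst g), TensorA D (snd f) (snd g))"
  "Assoc (prod_smc C D) A B E = (Assoc C (fst A) (fst B) (fst E), Assoc D (snd A) (snd B) (snd E))"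
  "Lunit (prod_smc C D) A = (Lunit C (fst A), Lunit D (snd A))"
  "Runit (prod_smc C D) A = (Runit C (fst A), Runit D (snd A))"
  "Braid (prod_smc C D) A B = (Braid C (fst A) (fst B), Braid D (snd A) (snd B))"
  by (simp_all add: prod_smc_def map_prod_def split_beta)

lemma is_inverse_prod_smc:
  "is_inverse (prod_smc C D) f g \<longleftrightarrow> is_inverse C (fst f) (fst g) \<and> is_inverse D (snd f) (snd g)"
  by (auto simp: is_inverse_def Hom_prod_smc prod_smc_simps mem_Times_iff)

lemma iso_prod_smc: "iso (prod_smc C D) f \<longleftrightarrow> iso C (fst f) \<and> iso D (snd f)"
  by (auto simp: iso_def is_inverse_prod_smc prod_smc_simps mem_Times_iff)

lemma category_prod_smc:
  assumes "category C" "category D"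
  shows "category (prod_smc C D)"
proof -
  interpret C: category C by fact
  interpret D: category D by fact
  show ?thesis
    by unfold_locales
      (auto simp: prod_smc_simps Hom_prod_smc C.Ident_Hom D.Ident_Hom
        intro: C.Comp_Hom D.Comp_Hom C.Comp_Ident D.Comp_Ident C.Ident_Comp D.Ident_Comp C.Comp_assoc D.Comp_assoc)
qed

lemma symmetric_monoidal_category_prod_smc:
  assumes "symmetric_monoidal_category C" "symmetric_monoidal_category D"
  shows "symmetric_monoidal_category (prod_smc C D)"
proof -
  interpret C: symmetric_monoidal_category C by fact
  interpret D: symmetric_monoidal_category D by fact
  interpret category "prod_smc C D"
    by (intro category_prod_smc) unfold_locales
  show ?thesis
    by unfold_locales
      (auto simp: prod_smc_simps Hom_prod_smc iso_prod_smc
          C.pentagon D.pentagon C.triangle D.triangle C.hexagon D.hexagon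
          C.Braid_symmetric D.Braid_symmetric
        intro: C.TensorA_Hom D.TensorA_Hom C.TensorA_Comp D.TensorA_Comp
          C.Assoc_Hom D.Assoc_Hom C.Assoc_natural D.Assoc_natural C.Lunit_Hom D.Lunit_Hom C.Runit_Hom D.Runit_Hom
          C.Lunit_natural D.Lunit_natural C.Runit_natural D.Runit_natural C.Braid_Hom D.Braid_Hom
          C.Braid_natural D.Braid_natural)
qed

text \<open>
  The data of a thin symmetric monoidal double category in which a cell is a boundary that satisfies a
  predicate \<open>sq\<close>: tight maps form \<open>S\<close>, loose maps form \<open>L\<close>, and \<open>tens\<close> is the tensor product of loose
  maps. Equations between cells follow from equations between their boundaries, so the axioms on
  cells say that \<open>sq\<close> is closed under the operations.
\<close>

locale square_system = S: symmetric_monoidal_category S + L: category L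
  for S :: "('p, 'n) smc" and L :: "('p, 'l) category" +
  fixes tens :: "'l \<Rightarrow> 'l \<Rightarrow> 'l" and sq :: "'l \<Rightarrow> 'l \<Rightarrow> 'n \<Rightarrow> 'n \<Rightarrow> bool"
  assumes Obj_L: "Obj L = Obj S"
    and sq_Arr: "sq M N s t \<Longrightarrow> M \<in> Arr L \<and> N \<in> Arr L"
    and sq_Hom: "sq M N s t \<Longrightarrow> s \<in> Hom S (Dom L M) (Dom L N) \<and> t \<in> Hom S (Cod L M) (Cod L N)"
    and sq_Ident: "M \<in> Arr L \<Longrightarrow> sq M M (Ident S (Dom L M)) (Ident S (Cod L M))"
    and sq_Comp: "sq M N s t \<Longrightarrow> sq N P s' t' \<Longrightarrow> sq M P (Comp S s' s) (Comp S t' t)"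
    and sq_Inverse: "sq M N s t \<Longrightarrow> iso S s \<Longrightarrow> iso S t \<Longrightarrow> sq N M (Inverse S s) (Inverse S t)"
    and sq_LIdent: "s \<in> Arr S \<Longrightarrow> sq (Ident L (Dom S s)) (Ident L (Cod S s)) s s"
    and sq_LComp: "sq M N s t \<Longrightarrow> sq M' N' t u \<Longrightarrow> sq (Comp L M' M) (Comp L N' N) s u"
    and tens_Hom: "M \<in> Hom L A B \<Longrightarrow> N \<in> Hom L A' B' \<Longrightarrow> tens M N \<in> Hom L (TensorO S A A') (TensorO S B B')"
    and tens_Ident: "A \<in> Obj S \<Longrightarrow> B \<in> Obj S \<Longrightarrow> tens (Ident L A) (Ident L B) = Ident L (TensorO S A B)"
    and tens_Comp: "M \<in> Hom L A B \<Longrightarrow> N \<in> Hom L B E \<Longrightarrow> M' \<in> Hom L A' B' \<Longrightarrow> N' \<in> Hom L B' E' \<Longrightarrow>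
      tens (Comp L N M) (Comp L N' M') = Comp L (tens N N') (tens M M')"
    and sq_tens: "sq M N s t \<Longrightarrow> sq M' N' s' t' \<Longrightarrow> sq (tens M M') (tens N N') (TensorA S s s') (TensorA S t t')"
    and sq_Assoc: "M \<in> Hom L A A' \<Longrightarrow> N \<in> Hom L B B' \<Longrightarrow> P \<in> Hom L E E' \<Longrightarrow>
      sq (tens (tens M N) P) (tens M (tens N P)) (Assoc S A B E) (Assoc S A' B' E')"
    and sq_Lunit: "M \<in> Hom L A A' \<Longrightarrow> sq (tens (Ident L (MUnit S)) M) M (Lunit S A) (Lunit S A')"
    and sq_Runit: "M \<in> Hom L A A' \<Longrightarrow> sq (tens M (Ident L (MUnit S))) M (Runit S A) (Runit S A')"
    and sq_Braid: "M \<in> Hom L A A' \<Longrightarrow> N \<in> Hom L B B' \<Longrightarrow> sq (tens M N) (tens N M) (Braid S A B) (Braid S A' B')"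
begin

definition cells :: "('l, 'l \<times> 'l \<times> 'n \<times> 'n) smc" where
  "cells = \<lparr>
     Obj = Arr L,
     Arr = {(M, N, s, t). sq M N s t},
     Dom = (\<lambda>(M, N, s, t). M),
     Cod = (\<lambda>(M, N, s, t). N),
     Ident = (\<lambda>M. (M, M, Ident S (Dom L M), Ident S (Cod L M))),
     Comp = (\<lambda>(_, P, s', t') (M, _, s, t). (M, P, Comp S s' s, Comp S t' t)),
     MUnit = Ident L (MUnit S),
     TensorO = tens,
     TensorA = (\<lambda>(M, N, s, t) (M', N', s', t'). (tens M M', tens N N', TensorA S s s', TensorA S t t')),
     Assoc = (\<lambda>M N P. (tens (tens M N) P, tens M (tens N P),
       Assoc S (Dom L M) (Dom L N) (Dom L P), Assoc S (Cod L M) (Cod L N) (Cod L P))),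
     Lunit = (\<lambda>M. (tens (Ident L (MUnit S)) M, M, Lunit S (Dom L M), Lunit S (Cod L M))),
     Runit = (\<lambda>M. (tens M (Ident L (MUnit S)), M, Runit S (Dom L M), Runit S (Cod L M))),
     Braid = (\<lambda>M N. (tens M N, tens N M, Braid S (Dom L M) (Dom L N), Braid S (Cod L M) (Cod L N)))\<rparr>"

definition double :: "('p, 'n, 'l, 'l \<times> 'l \<times> 'n \<times> 'n) double_category" where
  "double = \<lparr>
     Tight = S,
     Cells = cells,
     LeftO = Dom L,
     LeftA = (\<lambda>(M, N, s, t). s),
     RightO = Cod L,
     RightA = (\<lambda>(M, N, s, t). t),
     LIdentO = Ident L,
     LIdentA = (\<lambda>s. (Ident L (Dom S s), Ident L (Cod S s), s, s)),
     LCompO = Comp L,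
     LCompA = (\<lambda>(M', N', _, t) (M, N, s, _). (Comp L M' M, Comp L N' N, s, t))\<rparr>"

lemma cells_simps [simp]:
  "Obj cells = Arr L"
  "(M, N, s, t) \<in> Arr cells \<longleftrightarrow> sq M N s t"
  "Dom cells (M, N, s, t) = M"
  "Cod cells (M, N, s, t) = N"
  "Ident cells M = (M, M, Ident S (Dom L M), Ident S (Cod L M))"
  "Comp cells (N', P, s', t') (M, N, s, t) = (M, P, Comp S s' s, Comp S t' t)"
  "MUnit cells = Ident L (MUnit S)"
  "TensorO cells = tens"
  "TensorA cells (M, N, s, t) (M', N'', s', t') = (tens M M', tens N N'', TensorA S s s', TensorA S t t')"
  "Assoc cells M N P = (tens (tens M N) P, tens M (tens N P),
     Assoc S (Dom L M) (Dom L N) (Dom L P), Assoc S (Cod L M) (Cod L N) (Cod L P))"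
  "Lunit cells M = (tens (Ident L (MUnit S)) M, M, Lunit S (Dom L M), Lunit S (Cod L M))"
  "Runit cells M = (tens M (Ident L (MUnit S)), M, Runit S (Dom L M), Runit S (Cod L M))"
  "Braid cells M N = (tens M N, tens N M, Braid S (Dom L M) (Dom L N), Braid S (Cod L M) (Cod L N))"
  by (simp_all add: cells_def)

lemma Hom_cells: "(M', N', s, t) \<in> Hom cells M N \<longleftrightarrow> M' = M \<and> N' = N \<and> sq M N s t"
  by (auto simp: Hom_def)

lemma Hom_cellsE:
  assumes "\<alpha> \<in> Hom cells M N"
  obtains s t where "\<alpha> = (M, N, s, t)" "sq M N s t"
  using assms by (cases \<alpha>) (auto simp: Hom_cells)

lemma Arr_cellsE:
  assumes "\<alpha> \<in> Arr cells"
  obtains M N s t where "\<alpha> = (M, N, s, t)" "sq M N s t"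
  using assms by (cases \<alpha>) auto

lemma double_simps [simp]:
  "Tight double = S" "Cells double = cells" "LeftO double = Dom L" "RightO double = Cod L"
  "LeftA double (M, N, s, t) = s" "RightA double (M, N, s, t) = t"
  "LIdentO double = Ident L" "LIdentA double r = (Ident L (Dom S r), Ident L (Cod S r), r, r)"
  "LCompO double = Comp L"
  "LCompA double (M', N', s', t') (M, N, s, t) = (Comp L M' M, Comp L N' N, s, t')"
  by (simp_all add: double_def)

lemma sqD:
  assumes "sq M N s t"
  shows "M \<in> Arr L" "N \<in> Arr L" "s \<in> Arr S" "t \<in> Arr S"
    "Dom S s = Dom L M" "Cod S s = Dom L N" "Dom S t = Cod L M" "Cod S t = Cod L N"
  using sq_Arr[OF assms] sq_Hom[OF assms] by (auto simp: Hom_def)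

lemma L_Obj [simp]: "M \<in> Arr L \<Longrightarrow> Dom L M \<in> Obj S" "M \<in> Arr L \<Longrightarrow> Cod L M \<in> Obj S"
  using L.Dom_Obj L.Cod_Obj Obj_L by auto

lemma L_Ident [simp]:
  "A \<in> Obj S \<Longrightarrow> Ident L A \<in> Arr L" "A \<in> Obj S \<Longrightarrow> Dom L (Ident L A) = A" "A \<in> Obj S \<Longrightarrow> Cod L (Ident L A) = A"
  using L.Ident_simps Obj_L by auto

lemma tens_simps [simp]:
  assumes "M \<in> Arr L" "N \<in> Arr L"
  shows "tens M N \<in> Arr L" "Dom L (tens M N) = TensorO S (Dom L M) (Dom L N)"
    "Cod L (tens M N) = TensorO S (Cod L M) (Cod L N)"
  using tens_Hom[of M "Dom L M" "Cod L M" N "Dom L N" "Cod L N"] assms by (auto simp: Hom_def)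

lemma sq_Assoc': "M \<in> Arr L \<Longrightarrow> N \<in> Arr L \<Longrightarrow> P \<in> Arr L \<Longrightarrow>
    sq (tens (tens M N) P) (tens M (tens N P))
      (Assoc S (Dom L M) (Dom L N) (Dom L P)) (Assoc S (Cod L M) (Cod L N) (Cod L P))"
  by (rule sq_Assoc) (auto simp: Hom_def)

lemma sq_Lunit': "M \<in> Arr L \<Longrightarrow> sq (tens (Ident L (MUnit S)) M) M (Lunit S (Dom L M)) (Lunit S (Cod L M))"
  by (rule sq_Lunit) (auto simp: Hom_def)

lemma sq_Runit': "M \<in> Arr L \<Longrightarrow> sq (tens M (Ident L (MUnit S))) M (Runit S (Dom L M)) (Runit S (Cod L M))"
  by (rule sq_Runit) (auto simp: Hom_def)

lemma sq_Braid': "M \<in> Arr L \<Longrightarrow> N \<in> Arr L \<Longrightarrow>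
    sq (tens M N) (tens N M) (Braid S (Dom L M) (Dom L N)) (Braid S (Cod L M) (Cod L N))"
  by (rule sq_Braid) (auto simp: Hom_def)

lemma tens_Comp':
  "M \<in> Arr L \<Longrightarrow> N \<in> Arr L \<Longrightarrow> M' \<in> Arr L \<Longrightarrow> N' \<in> Arr L \<Longrightarrow> Dom L N = Cod L M \<Longrightarrow> Dom L N' = Cod L M' \<Longrightarrow>
   tens (Comp L N M) (Comp L N' M') = Comp L (tens N N') (tens M M')"
  by (rule tens_Comp) (auto simp: Hom_def)

lemma iso_cells:
  assumes "sq M N s t" "iso S s" "iso S t"
  shows "iso cells (M, N, s, t)"
proof -
  note [simp] = sqD[OF assms(1)] assms(2,3)
  have "is_inverse cells (M, N, s, t) (N, M, Inverse S s, Inverse S t)"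
    using sq_Inverse[OF assms] by (simp add: is_inverse_def Hom_cells)
  then show ?thesis using assms(1) by (auto simp: iso_def)
qed

lemma category_cells: "category cells"
  by unfold_locales
    (auto simp: Hom_cells sqD sq_Ident elim!: Hom_cellsE Arr_cellsE intro: sq_Comp)

lemma symmetric_monoidal_category_cells: "symmetric_monoidal_category cells"
proof -
  interpret category cells by (rule category_cells)
  show ?thesis
  proof
    show "MUnit cells \<in> Obj cells" by simp
    show "TensorO cells M N \<in> Obj cells" if "M \<in> Obj cells" "N \<in> Obj cells" for M N
      using that by simp
    show "TensorA cells \<alpha> \<beta> \<in> Hom cells (TensorO cells M M') (TensorO cells N N')"
      if "\<alpha> \<in> Hom cells M N" "\<beta> \<in> Hom cells M' N'" for \<alpha> \<beta> M N M' N'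
      using that by (auto simp: Hom_cells sq_tens elim!: Hom_cellsE)
    show "TensorA cells (Ident cells M) (Ident cells N) = Ident cells (TensorO cells M N)"
      if "M \<in> Obj cells" "N \<in> Obj cells" for M N
      using that by simp
    show "TensorA cells (Comp cells \<beta> \<alpha>) (Comp cells \<beta>' \<alpha>') = Comp cells (TensorA cells \<beta> \<beta>') (TensorA cells \<alpha> \<alpha>')"
      if "\<alpha> \<in> Hom cells M N" "\<beta> \<in> Hom cells N P" "\<alpha>' \<in> Hom cells M' N'" "\<beta>' \<in> Hom cells N' P'"
      for \<alpha> \<beta> \<alpha>' \<beta>' M N P M' N' P'
      using that by (auto simp: Hom_cells sqD S.Tensor_merge elim!: Hom_cellsE)
    show "Assoc cells M N P \<in> Hom cells (TensorO cells (TensorO cells M N) P) (TensorO cells M (TensorO cells N P))"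
      "iso cells (Assoc cells M N P)"
      if "M \<in> Obj cells" "N \<in> Obj cells" "P \<in> Obj cells" for M N P
      using that by (auto simp: Hom_cells sq_Assoc' iso_cells)
    show "Comp cells (Assoc cells M' N' P') (TensorA cells (TensorA cells \<alpha> \<beta>) \<gamma>) =
        Comp cells (TensorA cells \<alpha> (TensorA cells \<beta> \<gamma>)) (Assoc cells M N P)"
      if "\<alpha> \<in> Hom cells M M'" "\<beta> \<in> Hom cells N N'" "\<gamma> \<in> Hom cells P P'" for \<alpha> \<beta> \<gamma> M N P M' N' P'
      using that by (auto simp: sqD S.Assoc_nat elim!: Hom_cellsE)
    show "Lunit cells M \<in> Hom cells (TensorO cells (MUnit cells) M) M" "iso cells (Lunit cells M)"
      "Runit cells M \<in> Hom cells (TensorO cells M (MUnit cells)) M" "iso cells (Runit cells M)"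
      if "M \<in> Obj cells" for M
      using that by (auto simp: Hom_cells sq_Lunit' sq_Runit' iso_cells)
    show "Comp cells (Lunit cells N) (TensorA cells (Ident cells (MUnit cells)) \<alpha>) = Comp cells \<alpha> (Lunit cells M)"
      "Comp cells (Runit cells N) (TensorA cells \<alpha> (Ident cells (MUnit cells))) = Comp cells \<alpha> (Runit cells M)"
      if "\<alpha> \<in> Hom cells M N" for \<alpha> M N
      using that by (auto simp: sqD S.Lunit_nat S.Runit_nat elim!: Hom_cellsE)
    show "Comp cells (Assoc cells M N (TensorO cells P Q)) (Assoc cells (TensorO cells M N) P Q) =
        Comp cells (TensorA cells (Ident cells M) (Assoc cells N P Q))
          (Comp cells (Assoc cells M (TensorO cells N P) Q) (TensorA cells (Assoc cells M N P) (Ident cells Q)))"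
      if "M \<in> Obj cells" "N \<in> Obj cells" "P \<in> Obj cells" "Q \<in> Obj cells" for M N P Q
      using that by (simp add: S.pentagon)
    show "Comp cells (TensorA cells (Ident cells M) (Lunit cells N)) (Assoc cells M (MUnit cells) N) =
        TensorA cells (Runit cells M) (Ident cells N)"
      if "M \<in> Obj cells" "N \<in> Obj cells" for M N
      using that by (simp add: S.triangle)
    show "Braid cells M N \<in> Hom cells (TensorO cells M N) (TensorO cells N M)"
      if "M \<in> Obj cells" "N \<in> Obj cells" for M N
      using that by (simp add: Hom_cells sq_Braid')
    show "Comp cells (Braid cells M' N') (TensorA cells \<alpha> \<beta>) = Comp cells (TensorA cells \<beta> \<alpha>) (Braid cells M N)"
      if "\<alpha> \<in> Hom cells M M'" "\<beta> \<in> Hom cells N N'" for \<alpha> \<beta> M N M' N'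
      using that by (auto simp: sqD S.Braid_nat elim!: Hom_cellsE)
    show "Comp cells (Braid cells N M) (Braid cells M N) = Ident cells (TensorO cells M N)"
      if "M \<in> Obj cells" "N \<in> Obj cells" for M N
      using that by simp
    show "Comp cells (Assoc cells N P M) (Comp cells (Braid cells M (TensorO cells N P)) (Assoc cells M N P)) =
        Comp cells (TensorA cells (Ident cells N) (Braid cells M P))
          (Comp cells (Assoc cells N M P) (TensorA cells (Braid cells M N) (Ident cells P)))"
      if "M \<in> Obj cells" "N \<in> Obj cells" "P \<in> Obj cells" for M N P
      using that by (simp add: S.hexagon)
  qed
qed

lemma composable_simps:
  "(N, M) \<in> Obj (composable double) \<longleftrightarrow> N \<in> Arr L \<and> M \<in> Arr L \<and> Dom L N = Cod L M"
  "(\<beta>, \<alpha>) \<in> Arr (composable double) \<longleftrightarrow>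
     \<beta> \<in> Arr cells \<and> \<alpha> \<in> Arr cells \<and> LeftA double \<beta> = RightA double \<alpha>"
  "Dom (composable double) = Dom (prod_smc cells cells)"
  "Cod (composable double) = Cod (prod_smc cells cells)"
  "Ident (composable double) = Ident (prod_smc cells cells)"
  "Comp (composable double) = Comp (prod_smc cells cells)"
  "MUnit (composable double) = MUnit (prod_smc cells cells)"
  "TensorO (composable double) = TensorO (prod_smc cells cells)"
  "TensorA (composable double) = TensorA (prod_smc cells cells)"
  "Assoc (composable double) = Assoc (prod_smc cells cells)"
  "Lunit (composable double) = Lunit (prod_smc cells cells)"
  "Runit (composable double) = Runit (prod_smc cells cells)"
  "Braid (composable double) = Braid (prod_smc cells cells)"
  by (simp_all add: composable_def)

lemma strict_Left: "strict_sm_functor cells S (Dom L) (LeftA double)"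
  by (auto simp: strict_sm_functor_def is_functor_def S.Hom_iff sqD elim!: Arr_cellsE)

lemma strict_Right: "strict_sm_functor cells S (Cod L) (RightA double)"
  by (auto simp: strict_sm_functor_def is_functor_def S.Hom_iff sqD elim!: Arr_cellsE)

lemma strict_LIdent: "strict_sm_functor S cells (Ident L) (LIdentA double)"
  by (auto simp: strict_sm_functor_def is_functor_def Hom_cells sq_LIdent tens_Ident)

lemma sq_adjacent: "sq M' N' t u \<Longrightarrow> sq M N s t \<Longrightarrow> Dom L M' = Cod L M \<and> Dom L N' = Cod L N"
  by (metis sqD(5-8))

lemma strict_LComp:
  "strict_sm_functor (composable double) cells (\<lambda>(N, M). Comp L N M) (\<lambda>(\<beta>, \<alpha>). LCompA double \<beta> \<alpha>)"
  by (auto simp: strict_sm_functor_def is_functor_def composable_simps prod_smc_simps Hom_cells sqD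
        sq_adjacent tens_Comp'[symmetric]
      elim!: Arr_cellsE intro: sq_LComp)

theorem symmetric_monoidal_double_category_double: "symmetric_monoidal_double_category double"
proof (intro symmetric_monoidal_double_category.intro double_category.intro
    symmetric_monoidal_double_category_axioms.intro)
  show "category (Tight double)" "symmetric_monoidal_category (Tight double)"
    using S.category_axioms S.symmetric_monoidal_category_axioms by simp_all
  show "category (Cells double)" "symmetric_monoidal_category (Cells double)"
    by (simp_all add: category_cells symmetric_monoidal_category_cells)
  show "is_functor (Cells double) (Tight double) (LeftO double) (LeftA double)"
    "is_functor (Cells double) (Tight double) (RightO double) (RightA double)"
    "is_functor (Tight double) (Cells double) (LIdentO double) (LIdentA double)"
    "is_functor (composable double) (Cells double)
      (\<lambda>(N, M). LCompO double N M) (\<lambda>(\<beta>, \<alpha>). LCompA double \<beta> \<alpha>)"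
    using strict_Left strict_Right strict_LIdent strict_LComp by (simp_all add: strict_sm_functor_def)
  show "strict_sm_functor (Cells double) (Tight double) (LeftO double) (LeftA double)"
    "strict_sm_functor (Cells double) (Tight double) (RightO double) (RightA double)"
    "strict_sm_functor (Tight double) (Cells double) (LIdentO double) (LIdentA double)"
    "strict_sm_functor (composable double) (Cells double)
      (\<lambda>(N, M). LCompO double N M) (\<lambda>(\<beta>, \<alpha>). LCompA double \<beta> \<alpha>)"
    using strict_Left strict_Right strict_LIdent strict_LComp by simp_all
  show "LeftO double (LIdentO double A) = A \<and> RightO double (LIdentO double A) = A"
    if "A \<in> Obj (Tight double)" for A
    using that by simp
  show "LeftA double (LIdentA double s) = s \<and> RightA double (LIdentA double s) = s"
    if "s \<in> Arr (Tight double)" for s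
    by simp
  show "LeftO double (LCompO double N M) = LeftO double M \<and> RightO double (LCompO double N M) = RightO double N"
    if "(N, M) \<in> Obj (composable double)" for N M
    using that by (simp add: composable_simps)
  show "LeftA double (LCompA double \<beta> \<alpha>) = LeftA double \<alpha> \<and> RightA double (LCompA double \<beta> \<alpha>) = RightA double \<beta>"
    if "(\<beta>, \<alpha>) \<in> Arr (composable double)" for \<alpha> \<beta>
    using that by (auto simp: composable_simps elim!: Arr_cellsE)
  show "LCompO double M (LIdentO double (LeftO double M)) = M \<and>
      LCompO double (LIdentO double (RightO double M)) M = M"
    if "M \<in> Obj (Cells double)" for M
    using that by simp
  show "LCompA double \<alpha> (LIdentA double (LeftA double \<alpha>)) = \<alpha> \<and>
      LCompA double (LIdentA double (RightA double \<alpha>)) \<alpha> = \<alpha>"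
    if "\<alpha> \<in> Arr (Cells double)" for \<alpha>
    using that by (auto simp: sqD elim!: Arr_cellsE)
  show "LCompO double (LCompO double P N) M = LCompO double P (LCompO double N M)"
    if "(P, N) \<in> Obj (composable double)" "(N, M) \<in> Obj (composable double)" for M N P
    using that by (simp add: composable_simps)
  show "LCompA double (LCompA double \<gamma> \<beta>) \<alpha> = LCompA double \<gamma> (LCompA double \<beta> \<alpha>)"
    if "(\<gamma>, \<beta>) \<in> Arr (composable double)" "(\<beta>, \<alpha>) \<in> Arr (composable double)" for \<alpha> \<beta> \<gamma>
    using that by (auto simp: composable_simps sqD sq_adjacent elim!: Arr_cellsE)
qed

lemma thin_double: "thin double"
  by (auto simp: thin_def is_cell_def elim!: Hom_cellsE)

lemma is_cell_double: "(\<exists>\<alpha>. is_cell double M N s t \<alpha>) \<longleftrightarrow> sq M N s t"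
  by (auto simp: is_cell_def Hom_cells elim!: Hom_cellsE intro!: exI[of _ "(M, N, s, t)"])

lemma loose_category_double: "loose_category double = L"
  by (simp add: loose_category_def Obj_L[symmetric])

end

section \<open>The double category of a uniform traced category\<close>

lemma (in category) Inverse_eqI: "f \<in> Arr C \<Longrightarrow> is_inverse C f g \<Longrightarrow> Inverse C f = g"
  using is_inverse_unique[OF _ is_inverse_Inverse] by (auto simp: iso_def)

text \<open>
  Inverses are unique, so that the description operator in \<open>Inverse\<close> acts componentwise on pairs.
\<close>

lemma Inverse_prod_smc:
  assumes "category C" "category D" "iso C f" "iso D g"
  shows "Inverse (prod_smc C D) (f, g) = (Inverse C f, Inverse D g)"
proof -
  interpret C: category C by fact
  interpret D: category D by fact
  interpret P: category "prod_smc C D" by (intro category_prod_smc assms)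
  show ?thesis
    using assms(3,4) by (intro P.Inverse_eqI)
      (simp_all add: prod_smc_simps is_inverse_prod_smc C.is_inverse_Inverse D.is_inverse_Inverse C.iso_Arr D.iso_Arr)
qed

context traced_category
begin

lemma Int_simps [simp]:
  "Obj (Int_category T) = Obj T \<times> Obj T"
  "((Am, Ap), (Bm, Bp), f) \<in> Arr (Int_category T) \<longleftrightarrow>
     Am \<in> Obj T \<and> Ap \<in> Obj T \<and> Bm \<in> Obj T \<and> Bp \<in> Obj T \<and>
     f \<in> Arr T \<and> Dom T f = Bm \<boxtimes> Ap \<and> Cod T f = Bp \<boxtimes> Am"
  "Dom (Int_category T) (A, B, f) = A"
  "Cod (Int_category T) (A, B, f) = B"
  "Ident (Int_category T) (Am, Ap) = ((Am, Ap), (Am, Ap), Braid T Am Ap)"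
  "Comp (Int_category T) (B', (Cm, Cp), g) ((Am, Ap), (Bm, Bp), f) =
     ((Am, Ap), (Cm, Cp), icomp Am Ap Bm Bp Cm Cp g f)"
  by (auto simp: Int_category_def int_comp_icomp Hom_iff simp del: int_comp.simps)

lemma int_tensor_simp [simp]:
  "int_tensor T ((Am, Ap), (Bm, Bp), f) ((Am', Ap'), (Bm', Bp'), f') =
     ((Am \<boxtimes> Am', Ap \<boxtimes> Ap'), (Bm \<boxtimes> Bm', Bp \<boxtimes> Bp'), itensor Am Ap Bm Bp Am' Ap' Bm' Bp' f f')"
  by (rule int_tensor_itensor)

declare int_tensor.simps [simp del]

lemma Arr_IntE:
  assumes "M \<in> Arr (Int_category T)"
  obtains Am Ap Bm Bp f where "M = ((Am, Ap), (Bm, Bp), f)"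
    "Am \<in> Obj T" "Ap \<in> Obj T" "Bm \<in> Obj T" "Bp \<in> Obj T"
    "f \<in> Arr T" "Dom T f = Bm \<boxtimes> Ap" "Cod T f = Bp \<boxtimes> Am"
  using assms by (cases M) auto

lemma Hom_IntE:
  assumes "M \<in> Hom (Int_category T) A B"
  obtains Am Ap Bm Bp f where "M = ((Am, Ap), (Bm, Bp), f)" "A = (Am, Ap)" "B = (Bm, Bp)"
    "Am \<in> Obj T" "Ap \<in> Obj T" "Bm \<in> Obj T" "Bp \<in> Obj T"
    "f \<in> Arr T" "Dom T f = Bm \<boxtimes> Ap" "Cod T f = Bp \<boxtimes> Am"
  using assms by (cases M; cases A; cases B) (auto simp: Hom_def)

lemma Hom_Int [simp]:
  "((Am, Ap), (Bm, Bp), f) \<in> Hom (Int_category T) A B \<longleftrightarrow>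
     A = (Am, Ap) \<and> B = (Bm, Bp) \<and> Am \<in> Obj T \<and> Ap \<in> Obj T \<and> Bm \<in> Obj T \<and> Bp \<in> Obj T \<and>
     f \<in> Arr T \<and> Dom T f = Bm \<boxtimes> Ap \<and> Cod T f = Bp \<boxtimes> Am"
  by (auto simp: Hom_def)

lemma category_Int: "category (Int_category T)"
  by unfold_locales
    (auto elim!: Arr_IntE Hom_IntE simp: icomp_Ident_left icomp_Ident_right icomp_assoc)

fun int_square :: "('o, 'm) int_arrow \<Rightarrow> ('o, 'm) int_arrow \<Rightarrow> 'm \<times> 'm \<Rightarrow> 'm \<times> 'm \<Rightarrow> bool" where
  "int_square (A, B, f) (A', B', f') (sm, sp) (tm, tp) \<longleftrightarrow>
     (A, B, f) \<in> Arr (Int_category T) \<and> (A', B', f') \<in> Arr (Int_category T) \<and>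
     (sm, sp) \<in> Hom (prod_smc T T) A A' \<and> (tm, tp) \<in> Hom (prod_smc T T) B B' \<and>
     (tp \<otimes> sm) \<cdot> f = f' \<cdot> (tm \<otimes> sp)"

declare int_square.simps [simp del]

lemma int_square_iff:
  "int_square ((Am, Ap), (Bm, Bp), f) ((Am', Ap'), (Bm', Bp'), f') (sm, sp) (tm, tp) \<longleftrightarrow>
     f \<in> Arr T \<and> Dom T f = Bm \<boxtimes> Ap \<and> Cod T f = Bp \<boxtimes> Am \<and>
     f' \<in> Arr T \<and> Dom T f' = Bm' \<boxtimes> Ap' \<and> Cod T f' = Bp' \<boxtimes> Am' \<and>
     sm \<in> Arr T \<and> Dom T sm = Am \<and> Cod T sm = Am' \<and> sp \<in> Arr T \<and> Dom T sp = Ap \<and> Cod T sp = Ap' \<and>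
     tm \<in> Arr T \<and> Dom T tm = Bm \<and> Cod T tm = Bm' \<and> tp \<in> Arr T \<and> Dom T tp = Bp \<and> Cod T tp = Bp' \<and>
     (tp \<otimes> sm) \<cdot> f = f' \<cdot> (tm \<otimes> sp)"
  by (auto simp: int_square.simps Hom_prod_smc Hom_iff)

lemma int_squareE:
  assumes "int_square M N s t"
  obtains sm sp tm tp f f' where
    "M = ((Dom T sm, Dom T sp), (Dom T tm, Dom T tp), f)" "N = ((Cod T sm, Cod T sp), (Cod T tm, Cod T tp), f')"
    "s = (sm, sp)" "t = (tm, tp)"
    "sm \<in> Arr T" "sp \<in> Arr T" "tm \<in> Arr T" "tp \<in> Arr T"
    "f \<in> Arr T" "Dom T f = Dom T tm \<boxtimes> Dom T sp" "Cod T f = Dom T tp \<boxtimes> Dom T sm"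
    "f' \<in> Arr T" "Dom T f' = Cod T tm \<boxtimes> Cod T sp" "Cod T f' = Cod T tp \<boxtimes> Cod T sm"
    "(tp \<otimes> sm) \<cdot> f = f' \<cdot> (tm \<otimes> sp)"
proof -
  obtain Am Ap Bm Bp f where M: "M = ((Am, Ap), (Bm, Bp), f)" by (metis surj_pair)
  obtain Am' Ap' Bm' Bp' f' where N: "N = ((Am', Ap'), (Bm', Bp'), f')" by (metis surj_pair)
  obtain sm sp tm tp where st: "s = (sm, sp)" "t = (tm, tp)" by (metis surj_pair)
  show ?thesis
    using assms by (intro that[of sm sp tm tp f f']) (auto simp: M N st int_square_iff)
qed

lemma square_Comp:
  assumes [simp]: "f \<in> Arr T" "f' \<in> Arr T" "f'' \<in> Arr T" "l \<in> Arr T" "r \<in> Arr T" "l' \<in> Arr T" "r' \<in> Arr T"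
    "Dom T l = Cod T f" "Dom T r = Dom T f" "Dom T l' = Cod T l" "Dom T r' = Cod T r"
    "Dom T f' = Cod T r" "Cod T f' = Cod T l" "Dom T f'' = Cod T r'" "Cod T f'' = Cod T l'"
    and 1: "l \<cdot> f = f' \<cdot> r" and 2: "l' \<cdot> f' = f'' \<cdot> r'"
  shows "(l' \<cdot> l) \<cdot> f = f'' \<cdot> (r' \<cdot> r)"
proof -
  have "(l' \<cdot> l) \<cdot> f = l' \<cdot> f' \<cdot> r" by (simp add: 1)
  also have "\<dots> = f'' \<cdot> (r' \<cdot> r)" using Comp_prefix[OF 2, of r] by simp
  finally show ?thesis .
qed

lemma square_Inverse:
  assumes [simp]: "f \<in> Arr T" "f' \<in> Arr T" "iso T l" "iso T r"
    "Dom T l = Cod T f" "Dom T r = Dom T f" "Dom T f' = Cod T r" "Cod T f' = Cod T l"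
    and 1: "l \<cdot> f = f' \<cdot> r"
  shows "Inverse T l \<cdot> f' = f \<cdot> Inverse T r"
proof -
  have [simp]: "l \<in> Arr T" "r \<in> Arr T" by (simp_all add: iso_Arr)
  have "Inverse T l \<cdot> f' = Inverse T l \<cdot> (f' \<cdot> r) \<cdot> Inverse T r" by simp
  also have "\<dots> = f \<cdot> Inverse T r" unfolding 1[symmetric] by simp
  finally show ?thesis .
qed

end

context uniform_traced_category
begin

theorem square_system_Int: "square_system (prod_smc T T) (Int_category T) (int_tensor T) int_square"
proof (intro square_system.intro square_system_axioms.intro)
  have smc: "symmetric_monoidal_category T" and cat: "category T" by unfold_locales
  show "symmetric_monoidal_category (prod_smc T T)"
    by (intro symmetric_monoidal_category_prod_smc smc)
  show "category (Int_category T)" by (rule category_Int)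
  show "Obj (Int_category T) = Obj (prod_smc T T)" by (simp add: prod_smc_simps)
  let ?S = "prod_smc T T" and ?L = "Int_category T"
  show "M \<in> Arr ?L \<and> N \<in> Arr ?L"
    "s \<in> Hom ?S (Dom ?L M) (Dom ?L N) \<and> t \<in> Hom ?S (Cod ?L M) (Cod ?L N)"
    if "int_square M N s t" for M N s t
    using that by (auto elim!: int_squareE simp: Hom_prod_smc Hom_iff)
  show "int_square M M (Ident ?S (Dom ?L M)) (Ident ?S (Cod ?L M))" if "M \<in> Arr ?L" for M
    using that by (auto elim!: Arr_IntE simp: int_square_iff prod_smc_simps)
  show "int_square M P (Comp ?S s' s) (Comp ?S t' t)"
    if "int_square M N s t" "int_square N P s' t'" for M N P s t s' t'
  proof -
    from that(1) show ?thesis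
    proof (rule int_squareE)
      fix sm sp tm tp f f'
      assume MN: "M = ((Dom T sm, Dom T sp), (Dom T tm, Dom T tp), f)" "N = ((Cod T sm, Cod T sp), (Cod T tm, Cod T tp), f')"
        and st: "s = (sm, sp)" "t = (tm, tp)"
        and [simp]: "sm \<in> Arr T" "sp \<in> Arr T" "tm \<in> Arr T" "tp \<in> Arr T"
          "f \<in> Arr T" "Dom T f = Dom T tm \<boxtimes> Dom T sp" "Cod T f = Dom T tp \<boxtimes> Dom T sm"
          "f' \<in> Arr T" "Dom T f' = Cod T tm \<boxtimes> Cod T sp" "Cod T f' = Cod T tp \<boxtimes> Cod T sm"
        and 1: "(tp \<otimes> sm) \<cdot> f = f' \<cdot> (tm \<otimes> sp)"
      from that(2) show ?thesis
      proof (rule int_squareE)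
        fix sm' sp' tm' tp' f1 f''
        assume NP: "N = ((Dom T sm', Dom T sp'), (Dom T tm', Dom T tp'), f1)" "P = ((Cod T sm', Cod T sp'), (Cod T tm', Cod T tp'), f'')"
          and st': "s' = (sm', sp')" "t' = (tm', tp')"
          and [simp]: "sm' \<in> Arr T" "sp' \<in> Arr T" "tm' \<in> Arr T" "tp' \<in> Arr T"
            "f'' \<in> Arr T" "Dom T f'' = Cod T tm' \<boxtimes> Cod T sp'" "Cod T f'' = Cod T tp' \<boxtimes> Cod T sm'"
          and 2: "(tp' \<otimes> sm') \<cdot> f1 = f'' \<cdot> (tm' \<otimes> sp')"
        have [simp]: "f1 = f'" "Dom T sm' = Cod T sm" "Dom T sp' = Cod T sp" "Dom T tm' = Cod T tm" "Dom T tp' = Cod T tp"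
          using MN NP by auto
        have "((tp' \<otimes> sm') \<cdot> (tp \<otimes> sm)) \<cdot> f = f'' \<cdot> ((tm' \<otimes> sp') \<cdot> (tm \<otimes> sp))"
          using 1 2 by (intro square_Comp) simp_all
        then show ?thesis
          by (simp add: MN NP st st' prod_smc_simps int_square_iff Tensor_merge)
      qed
    qed
  qed
  show "int_square N M (Inverse ?S s) (Inverse ?S t)"
    if "int_square M N s t" "iso ?S s" "iso ?S t" for M N s t
    using that
    by (auto elim!: int_squareE simp: iso_prod_smc Inverse_prod_smc[OF cat cat] int_square_iff Inverse_Tensor[symmetric]
        intro!: square_Inverse)
  show "int_square (Ident ?L (Dom ?S s)) (Ident ?L (Cod ?S s)) s s" if "s \<in> Arr ?S" for s
    using that by (cases s) (auto simp: prod_smc_simps int_square_iff Braid_nat)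
  show "int_square (Comp ?L M' M) (Comp ?L N' N) s u" if "int_square M N s t" "int_square M' N' t u" for M N M' N' s t u
    using that icomp_square by (auto elim!: int_squareE simp: int_square_iff)
  show "int_tensor T M N \<in> Hom ?L (TensorO ?S A A') (TensorO ?S B B')"
    if "M \<in> Hom ?L A B" "N \<in> Hom ?L A' B'" for M N A B A' B'
    using that by (auto elim!: Hom_IntE simp: prod_smc_simps)
  show "int_tensor T (Ident ?L A) (Ident ?L B) = Ident ?L (TensorO ?S A B)" if "A \<in> Obj ?S" "B \<in> Obj ?S" for A B
    using that by (auto simp: prod_smc_simps itensor_Ident)
  show "int_tensor T (Comp ?L N M) (Comp ?L N' M') = Comp ?L (int_tensor T N N') (int_tensor T M M')"
    if "M \<in> Hom ?L A B" "N \<in> Hom ?L B E" "M' \<in> Hom ?L A' B'" "N' \<in> Hom ?L B' E'" for M N M' N' A B E A' B' E'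
    using that by (auto elim!: Hom_IntE simp: itensor_icomp)
  show "int_square (int_tensor T M M') (int_tensor T N N') (TensorA ?S s s') (TensorA ?S t t')"
    if "int_square M N s t" "int_square M' N' s' t'" for M N M' N' s t s' t'
    using that by (auto elim!: int_squareE simp: int_square_iff prod_smc_simps itensor_square)
  show "int_square (int_tensor T (int_tensor T M N) P) (int_tensor T M (int_tensor T N P))
      (Assoc ?S A B E) (Assoc ?S A' B' E')"
    if "M \<in> Hom ?L A A'" "N \<in> Hom ?L B B'" "P \<in> Hom ?L E E'" for M N P A A' B B' E E'
    using that by (auto elim!: Hom_IntE simp: int_square_iff prod_smc_simps itensor_Assoc)
  show "int_square (int_tensor T (Ident ?L (MUnit ?S)) M) M (Lunit ?S A) (Lunit ?S A')"
    "int_square (int_tensor T M (Ident ?L (MUnit ?S))) M (Runit ?S A) (Runit ?S A')"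
    if "M \<in> Hom ?L A A'" for M A A'
    using that by (auto elim!: Hom_IntE simp: int_square_iff prod_smc_simps itensor_Lunit itensor_Runit)
  show "int_square (int_tensor T M N) (int_tensor T N M) (Braid ?S A B) (Braid ?S A' B')"
    if "M \<in> Hom ?L A A'" "N \<in> Hom ?L B B'" for M N A A' B B'
    using that by (auto elim!: Hom_IntE simp: int_square_iff prod_smc_simps itensor_Braid)
qed

end

theorem theorem4p1:
  fixes U :: "('o, 'm) traced_category"
  assumes "uniform_traced_category U"
  shows "\<exists>D :: ('o \<times> 'o, 'm \<times> 'm, ('o, 'm) int_arrow,
            ('o, 'm) int_arrow \<times> ('o, 'm) int_arrow \<times> ('m \<times> 'm) \<times> ('m \<times> 'm)) double_category.
    symmetric_monoidal_double_category D \<and> thin D \<and>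
    Tight D = prod_smc U U \<and>
    loose_category D = Int_category U \<and>
    TensorO (Cells D) = int_tensor U \<and>
    (\<comment> \<open>(i)\<close>
     Obj (Tight D) = Obj U \<times> Obj U) \<and>
    (\<comment> \<open>(ii)\<close>
     MUnit (Tight D) = (MUnit U, MUnit U) \<and>
     (\<forall>Am Ap Bm Bp.
        (Am, Ap) \<boxtimes>\<^bsub>Tight D\<^esub> (Bm, Bp) = (Am \<boxtimes>\<^bsub>U\<^esub> Bm, Ap \<boxtimes>\<^bsub>U\<^esub> Bp))) \<and>
    (\<comment> \<open>(iii)\<close>
     \<forall>A1m A1p A2m A2p.
       Hom (Tight D) (A1m, A1p) (A2m, A2p) = Hom U A1m A2m \<times> Hom U A1p A2p) \<and>
    (\<comment> \<open>(iv)\<close>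
     \<forall>Am \<in> Obj U. \<forall>Ap \<in> Obj U. \<forall>Bm \<in> Obj U. \<forall>Bp \<in> Obj U.
       Hom (loose_category D) (Am, Ap) (Bm, Bp) =
       (\<lambda>f. ((Am, Ap), (Bm, Bp), f)) ` Hom U (Bm \<boxtimes>\<^bsub>U\<^esub> Ap) (Bp \<boxtimes>\<^bsub>U\<^esub> Am)) \<and>
    (\<comment> \<open>(v)\<close>
     \<forall>A1m \<in> Obj U. \<forall>A1p \<in> Obj U. \<forall>B1m \<in> Obj U. \<forall>B1p \<in> Obj U.
     \<forall>A2m \<in> Obj U. \<forall>A2p \<in> Obj U. \<forall>B2m \<in> Obj U. \<forall>B2p \<in> Obj U.
     \<forall>f1 \<in> Hom U (B1m \<boxtimes>\<^bsub>U\<^esub> A1p) (B1p \<boxtimes>\<^bsub>U\<^esub> A1m).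
     \<forall>f2 \<in> Hom U (B2m \<boxtimes>\<^bsub>U\<^esub> A2p) (B2p \<boxtimes>\<^bsub>U\<^esub> A2m).
     \<forall>sm \<in> Hom U A1m A2m. \<forall>sp \<in> Hom U A1p A2p.
     \<forall>tm \<in> Hom U B1m B2m. \<forall>tp \<in> Hom U B1p B2p.
       (\<exists>\<alpha>. is_cell D ((A1m, A1p), (B1m, B1p), f1) ((A2m, A2p), (B2m, B2p), f2) (sm, sp) (tm, tp) \<alpha>) \<longleftrightarrow>
       (tp \<otimes>\<^bsub>U\<^esub> sm) \<cdot>\<^bsub>U\<^esub> f1 = f2 \<cdot>\<^bsub>U\<^esub> (tm \<otimes>\<^bsub>U\<^esub> sp))"
proof -
  interpret U: uniform_traced_category U by (rule assms)
  interpret Q: square_system "prod_smc U U" "Int_category U" "int_tensor U" U.int_square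
    by (rule U.square_system_Int)
  show ?thesis
  proof (intro exI[of _ Q.double] conjI)
    show "symmetric_monoidal_double_category Q.double" by (rule Q.symmetric_monoidal_double_category_double)
    show "thin Q.double" by (rule Q.thin_double)
    show "loose_category Q.double = Int_category U" by (rule Q.loose_category_double)
    show "\<forall>Am \<in> Obj U. \<forall>Ap \<in> Obj U. \<forall>Bm \<in> Obj U. \<forall>Bp \<in> Obj U.
       Hom (loose_category Q.double) (Am, Ap) (Bm, Bp) =
       (\<lambda>f. ((Am, Ap), (Bm, Bp), f)) ` Hom U (Bm \<boxtimes>\<^bsub>U\<^esub> Ap) (Bp \<boxtimes>\<^bsub>U\<^esub> Am)"
      unfolding Q.loose_category_double by (auto elim!: U.Hom_IntE simp: U.Hom_iff)
  qed (auto simp: prod_smc_simps Hom_prod_smc Q.is_cell_double U.int_square_iff U.Hom_iff simp del: split_paired_Ex)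
qed

end
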